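(* Let $C_\bullet$ be the bifiltered chain complex of a $k$-critical simplicial bifiltration of constant dimension $d$ and description size $n$. The time complexity of the path algorithm on this input is linear in the description size of its output, which is $O(nk)$ in the worst case.
   Context: All vector spaces are over $\mathbb Z_2$; $\mathbb N^2$ carries the product order and $x\vee y$ is the coordinatewise maximum. A simplicial bifiltration $\mathcal K$ is a finite abstract simplicial complex with subcomplexes $(\mathcal K_s)_{s\in\mathbb N^2}$ such that $\mathcal K_s\subseteq\mathcal K_t$ whenever $s\le t$ (every simplex lies in some $\mathcal K_s$). For a simplex $\sigma$, $\mathcal G(\sigma)$ is the finite set of minimal elements of $\{s:\sigma\in\mathcal K_s\}$; $\mathcal K$ is $k$-critical if $|\mathcal G(\sigma)|\le k$ for all $\sigma$. Its description size is $n=\sum_\sigma|\mathcal G(\sigma)|$. $U_A$ is the upset module of $A\subseteq\mathbb N^2$ ($\mathbb Z_2$ at grades above some $a\in A$, $0$ elsewhere, identity structure maps inside the upset). The bifiltered chain complex has $C_i=\bigoplus_{\dim\sigma=i}U_{\mathcal G(\sigma)}$ with simplicial boundary maps. Input: a list of simplices, each with its dimension, its list $\mathcal G(\sigma)$ in lexicographic order and its list of facets. Constants in $O(\cdot)$ may depend on $d$; running time is in the usual RAM model with sparse matrices (a matrix is a list of columns, each the list of row indices of its non-zero entries). Path algorithm. Step 1: for each $i$-simplex $\sigma$ with $\mathcal G(\sigma)=\{x_1,\dots,x_m\}$ (ordered by first coordinate), add generators $g_\sigma^{x_1},\dots,g_\sigma^{x_m}$ of grades $x_j$ to the basis of a free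 module $G_i$, and relations $r_\sigma^{y_j}$ of grade $y_j=x_j\vee x_{j+1}$, $1\le j<m$, to the basis of a free module $R_i$; set $p^1_i(r_\sigma^{y_j})=g_\sigma^{x_j}+g_\sigma^{x_{j+1}}$. Step 2: for each generator $g_\sigma^x$ in $G_i$ and each facet $\tau$ of $\sigma$ find $z_\tau\in\mathcal G(\tau)$ with $z_\tau\le x$, and set $f^0_i(g_\sigma^x)=\sum_\tau g_\tau^{z_\tau}$. Step 3: compute the matrix products $[f^0_i][p^1_i]$ and $[f^0_{i-1}][f^0_i]$; a column of the first consists of one pair of generators for each facet $\tau$ of $\sigma$, and a column of the second of one pair of generators for each codimension-2 face $\tau$ of $\sigma$. For a pair $g_\tau^{x_j},g_\tau^{x_\ell}$ with $j\le\ell$ let $c_\tau=r_\tau^{y_j}+\dots+r_\tau^{y_{\ell-1}}$ be the connecting path. Set $f^1_i(r_\sigma^y)=\sum_\tau c_\tau$ (facets $\tau$) and $h^0_i(g_\sigma^x)=\sum_\tau c_\tau$ (codimension-2 faces $\tau$). Output: the generators and relations with their grades and the sparse matrices $[p^1_i],[f^0_i],[f^1_i],[h^0_i]$, which form the boundary maps $\begin{pmatrix} f^0_i & p^1_{i-1}\\ h^0_i& f^1_{i-1}\end{pmatrix}$ of a free resolution of $C_\bullet$ with degree-$i$ module $G_i\oplus R_{i-1}$. The description size of the output is its number of basis elements plus the total number of non-zero matrix entries. *)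

theory Defs
  imports "HOL-Library.Product_Order"
begin

section \<open>Simplicial bifiltrations\<close>

text \<open>Grades are pairs of natural numbers; \<^theory>\<open>HOL-Library.Product_Order\<close> equips them with the
  product order, for which \<^const>\<open>sup\<close> is the coordinatewise maximum.\<close>

type_synonym grade = "nat \<times> nat"

definition simplicial_complex :: "'v set set \<Rightarrow> bool" where
  "simplicial_complex K \<longleftrightarrow> finite K \<and> (\<forall>\<sigma>\<in>K. finite \<sigma> \<and> \<sigma> \<noteq> {}) \<and>
     (\<forall>\<sigma>\<in>K. \<forall>\<tau>. \<tau> \<subseteq> \<sigma> \<and> \<tau> \<noteq> {} \<longrightarrow> \<tau> \<in> K)"

definition dim_simplex :: "'v set \<Rightarrow> nat" where
  "dim_simplex \<sigma> = card \<sigma> - 1"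

definition has_dimension :: "'v set set \<Rightarrow> nat \<Rightarrow> bool" where
  "has_dimension K d \<longleftrightarrow> (\<forall>\<sigma>\<in>K. dim_simplex \<sigma> \<le> d) \<and> (\<exists>\<sigma>\<in>K. dim_simplex \<sigma> = d)"

definition facet_of :: "'v set \<Rightarrow> 'v set \<Rightarrow> bool" where
  "facet_of \<tau> \<sigma> \<longleftrightarrow> \<tau> \<noteq> {} \<and> \<tau> \<subseteq> \<sigma> \<and> card \<sigma> = Suc (card \<tau>)"

definition bifiltration :: "'v set set \<Rightarrow> (grade \<Rightarrow> 'v set set) \<Rightarrow> bool" where
  "bifiltration K F \<longleftrightarrow> simplicial_complex K \<and> (\<forall>s. simplicial_complex (F s) \<and> F s \<subseteq> K) \<and>
     mono F \<and> (\<forall>\<sigma>\<in>K. \<exists>s. \<sigma> \<in> F s)"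

definition min_grades :: "(grade \<Rightarrow> 'v set set) \<Rightarrow> 'v set \<Rightarrow> grade set" where
  "min_grades F \<sigma> = {s. \<sigma> \<in> F s \<and> (\<forall>t. \<sigma> \<in> F t \<and> t \<le> s \<longrightarrow> t = s)}"

definition critical :: "nat \<Rightarrow> 'v set set \<Rightarrow> (grade \<Rightarrow> 'v set set) \<Rightarrow> bool" where
  "critical k K F \<longleftrightarrow> (\<forall>\<sigma>\<in>K. card (min_grades F \<sigma>) \<le> k)"

definition description_size :: "'v set set \<Rightarrow> (grade \<Rightarrow> 'v set set) \<Rightarrow> nat" where
  "description_size K F = (\<Sum>\<sigma>\<in>K. card (min_grades F \<sigma>))"

text \<open>The usual word length convention for a RAM: the coordinates of all grades fit into machine words
  of \<open>e * log\<^sub>2 (n + 1)\<close> bits, where \<open>n\<close> is the description size and \<open>e\<close> a constant. Without such a bound,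
  comparison-based algorithms cannot find the grades \<open>z\<^sub>\<tau>\<close> in time linear in the output: if a vertex has
  \<open>k\<close> minimal grades and \<open>N\<close> incident edges with one minimal grade each, this takes about \<open>N log k\<close>
  comparisons, while the output has size \<open>O(N + k)\<close>.\<close>

definition grades_fit_words :: "nat \<Rightarrow> 'v set set \<Rightarrow> (grade \<Rightarrow> 'v set set) \<Rightarrow> bool" where
  "grades_fit_words e K F \<longleftrightarrow> (\<forall>\<sigma>\<in>K. \<forall>x\<in>min_grades F \<sigma>.
     fst x < (description_size K F + 1) ^ e \<and> snd x < (description_size K F + 1) ^ e)"


section \<open>Input and output of the path algorithm\<close>

text \<open>Facets are given by their positions in the list of simplices.\<close>

record simplex_entry =
  sdim :: nat
  grades :: "grade list"
  facets :: "nat list"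

type_synonym input = "simplex_entry list"

definition encodes :: "'v set set \<Rightarrow> (grade \<Rightarrow> 'v set set) \<Rightarrow> input \<Rightarrow> bool" where
  "encodes K F inp \<longleftrightarrow> (\<exists>\<sigma>s. distinct \<sigma>s \<and> set \<sigma>s = K \<and>
     list_all2 (\<lambda>\<sigma> e. sdim e = dim_simplex \<sigma> \<and>
       set (grades e) = min_grades F \<sigma> \<and>
       sorted_wrt (\<lambda>x y. (x, y) \<in> less_than <*lex*> less_than) (grades e) \<and>
       distinct (facets e) \<and>
       set (facets e) = {i. i < length \<sigma>s \<and> facet_of (\<sigma>s ! i) \<sigma>}) \<sigma>s inp)"

text \<open>The pair \<open>(s, j)\<close> names the generator (respectively relation) that belongs to the \<open>j\<close>-th minimal
  grade (respectively the \<open>j\<close>-th and \<open>(j + 1)\<close>-st minimal grades) of the \<open>s\<close>-th simplex, counting from 0.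
  The bases of all degrees are kept in one list each; the degree of a basis element is the
  dimension of its simplex.\<close>

definition generators :: "input \<Rightarrow> (nat \<times> nat) list" where
  "generators inp = [(s, j). s \<leftarrow> [0..<length inp], j \<leftarrow> [0..<length (grades (inp ! s))]]"

definition relations :: "input \<Rightarrow> (nat \<times> nat) list" where
  "relations inp = [(s, j). s \<leftarrow> [0..<length inp], j \<leftarrow> [0..<length (grades (inp ! s)) - 1]]"

text \<open>Columns of matrices are lists of row indices, and a row index is a position in the list of
  generators or relations. The columns of \<open>p1\<close> and \<open>f1\<close> belong to the relations, those of \<open>f0\<close> and
  \<open>h0\<close> to the generators. Basis elements are listed with their degree and grade.\<close>

type_synonym sparse_matrix = "nat list list"

record algorithm_output =
  gens :: "(nat \<times> grade) list"
  rels :: "(nat \<times> grade) list"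
  p1 :: sparse_matrix
  f0 :: sparse_matrix
  f1 :: sparse_matrix
  h0 :: sparse_matrix

definition nonzeros :: "sparse_matrix \<Rightarrow> nat" where
  "nonzeros M = sum_list (map length M)"

definition output_size :: "algorithm_output \<Rightarrow> nat" where
  "output_size out = length (gens out) + length (rels out) +
     nonzeros (p1 out) + nonzeros (f0 out) + nonzeros (f1 out) + nonzeros (h0 out)"

definition sparse_column :: "(nat \<times> nat) list \<Rightarrow> (nat \<times> nat) set \<Rightarrow> nat list \<Rightarrow> bool" where
  "sparse_column B X col \<longleftrightarrow> distinct col \<and> set col \<subseteq> {..<length B} \<and> (!) B ` set col = X"

definition connecting_path :: "nat \<Rightarrow> nat \<Rightarrow> nat \<Rightarrow> (nat \<times> nat) set" where
  "connecting_path \<tau> a b = {\<tau>} \<times> {min a b..<max a b}"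

text \<open>\<open>z s j \<tau>\<close> is the position of the chosen grade in the list of the facet \<open>\<tau>\<close>. In a column of
  \<open>[f0][p1]\<close> the pair at a facet \<open>\<tau>\<close> of \<open>s\<close> comes from the grades \<open>j\<close> and \<open>j + 1\<close> of \<open>s\<close>; in a column of
  \<open>[f0][f0]\<close> the pair at a codimension-2 face \<open>\<tau>\<close> comes from the two facets \<open>\<tau>1\<close>, \<open>\<tau>2\<close> of \<open>s\<close> that contain
  \<open>\<tau>\<close>. Paths of different \<open>\<tau>\<close> are disjoint, so their sum over the two-element field is their union.\<close>

definition path_output :: "input \<Rightarrow> algorithm_output \<Rightarrow> bool" where
  "path_output inp out \<longleftrightarrow> (\<exists>z.
     (\<forall>s<length inp. \<forall>j<length (grades (inp ! s)). \<forall>\<tau>\<in>set (facets (inp ! s)).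
        z s j \<tau> < length (grades (inp ! \<tau>)) \<and>
        grades (inp ! \<tau>) ! z s j \<tau> \<le> grades (inp ! s) ! j) \<and>
     gens out = map (\<lambda>(s, j). (sdim (inp ! s), grades (inp ! s) ! j)) (generators inp) \<and>
     rels out = map (\<lambda>(s, j). (sdim (inp ! s), sup (grades (inp ! s) ! j) (grades (inp ! s) ! Suc j)))
                  (relations inp) \<and>
     list_all2 (\<lambda>(s, j). sparse_column (generators inp) {(s, j), (s, Suc j)})
       (relations inp) (p1 out) \<and>
     list_all2 (\<lambda>(s, j). sparse_column (generators inp) {(\<tau>, z s j \<tau>) |\<tau>. \<tau> \<in> set (facets (inp ! s))})
       (generators inp) (f0 out) \<and>
     list_all2 (\<lambda>(s, j). sparse_column (relations inp)
         (\<Union>\<tau>\<in>set (facets (inp ! s)). connecting_path \<tau> (z s j \<tau>) (z s (Suc j) \<tau>)))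
       (relations inp) (f1 out) \<and>
     list_all2 (\<lambda>(s, j). sparse_column (relations inp)
         (\<Union>{connecting_path \<tau> (z \<tau>1 (z s j \<tau>1) \<tau>) (z \<tau>2 (z s j \<tau>2) \<tau>) |\<tau> \<tau>1 \<tau>2.
              \<tau>1 \<in> set (facets (inp ! s)) \<and> \<tau>2 \<in> set (facets (inp ! s)) \<and> \<tau>1 \<noteq> \<tau>2 \<and>
              \<tau> \<in> set (facets (inp ! \<tau>1)) \<inter> set (facets (inp ! \<tau>2))}))
       (generators inp) (h0 out))"


section \<open>Random access machine\<close>

text \<open>A program works on finitely many registers and finitely many arrays (which could be interleaved in
  one memory). Loads, stores, arithmetic operations and comparisons take unit time. Subtraction is
  truncated at 0. The bounds of a loop are evaluated once, on entry.\<close>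

datatype reg = numSimp | numGen | numRel | simp | gen | pos | fac | rowA | rowB | idx | ent | ptr
  | radix | power | digits | maxLen | maxX | pass | bucket | workLen

datatype arr = SDim | GPtr | GLen | GX | GY | FPtr | FLen | Fac
  | GenDeg | GenX | GenY | RelDeg | RelX | RelY
  | P1Ptr | P1Row | F0Ptr | F0Row | F1Ptr | F1Row | H0Ptr | H0Row
  | Own | RelOf | Order | Temp | Count | Last | Work

record ram =
  regs :: "reg \<Rightarrow> nat"
  mem :: "arr \<Rightarrow> nat \<Rightarrow> nat"

datatype exp = N nat | V reg | Load arr exp ("_\<langle>_\<rangle>" [1000, 0] 1000)
  | Add exp exp (infixl ".+" 65) | Sub exp exp (infixl ".-" 65) | Mul exp exp (infixl ".*" 70)
  | Div exp exp (infixl ".'/" 70) | Mod exp exp (infixl ".%" 70)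

datatype test = Less exp exp (infix ".<" 50) | Le exp exp (infix ".\<le>" 50) | Eq exp exp (infix ".=" 50)
  | Conj test test (infixr ".\<and>" 35)

datatype com = SKIP
  | Assign reg exp ("_ \<leftarrow> _" [1000, 61] 61)
  | Store arr exp exp ("_\<langle>_\<rangle> \<Leftarrow> _" [1000, 0, 61] 61)
  | Seq com com (infixr ";;" 60)
  | Cond test com com ("(IF _/ THEN _/ ELSE _)" [0, 61, 61] 61)
  | For reg exp exp com ("(FOR _/ FROM _/ TO _/ DO _)" [1000, 0, 0, 61] 61)

primrec eval :: "exp \<Rightarrow> ram \<Rightarrow> nat" where
  "eval (N c) st = c"
| "eval (V r) st = regs st r"
| "eval (Load a e) st = mem st a (eval e st)"
| "eval (Add e1 e2) st = eval e1 st + eval e2 st"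
| "eval (Sub e1 e2) st = eval e1 st - eval e2 st"
| "eval (Mul e1 e2) st = eval e1 st * eval e2 st"
| "eval (Div e1 e2) st = eval e1 st div eval e2 st"
| "eval (Mod e1 e2) st = eval e1 st mod eval e2 st"

primrec eval_time :: "exp \<Rightarrow> nat" where
  "eval_time (N c) = 1"
| "eval_time (V r) = 1"
| "eval_time (Load a e) = eval_time e + 1"
| "eval_time (Add e1 e2) = eval_time e1 + eval_time e2 + 1"
| "eval_time (Sub e1 e2) = eval_time e1 + eval_time e2 + 1"
| "eval_time (Mul e1 e2) = eval_time e1 + eval_time e2 + 1"
| "eval_time (Div e1 e2) = eval_time e1 + eval_time e2 + 1"
| "eval_time (Mod e1 e2) = eval_time e1 + eval_time e2 + 1"

primrec holds :: "test \<Rightarrow> ram \<Rightarrow> bool" where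
  "holds (Less e1 e2) st \<longleftrightarrow> eval e1 st < eval e2 st"
| "holds (Le e1 e2) st \<longleftrightarrow> eval e1 st \<le> eval e2 st"
| "holds (Eq e1 e2) st \<longleftrightarrow> eval e1 st = eval e2 st"
| "holds (Conj b1 b2) st \<longleftrightarrow> holds b1 st \<and> holds b2 st"

primrec test_time :: "test \<Rightarrow> nat" where
  "test_time (Less e1 e2) = eval_time e1 + eval_time e2 + 1"
| "test_time (Le e1 e2) = eval_time e1 + eval_time e2 + 1"
| "test_time (Eq e1 e2) = eval_time e1 + eval_time e2 + 1"
| "test_time (Conj b1 b2) = test_time b1 + test_time b2 + 1"

definition set_reg :: "reg \<Rightarrow> nat \<Rightarrow> ram \<Rightarrow> ram" where
  "set_reg r v st = st\<lparr>regs := (regs st)(r := v)\<rparr>"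

definition set_mem :: "arr \<Rightarrow> nat \<Rightarrow> nat \<Rightarrow> ram \<Rightarrow> ram" where
  "set_mem a i v st = st\<lparr>mem := (mem st)(a := (mem st a)(i := v))\<rparr>"

text \<open>\<open>run c st\<close> is the final state together with the running time.\<close>

primrec run :: "com \<Rightarrow> ram \<Rightarrow> ram \<times> nat" where
  "run SKIP = (\<lambda>st. (st, 1))"
| "run (Assign r e) = (\<lambda>st. (set_reg r (eval e st) st, eval_time e + 1))"
| "run (Store a i e) = (\<lambda>st. (set_mem a (eval i st) (eval e st) st, eval_time i + eval_time e + 1))"
| "run (Seq c1 c2) = (\<lambda>st. case run c1 st of (st1, t1) \<Rightarrow> case run c2 st1 of (st2, t2) \<Rightarrow> (st2, t1 + t2))"
| "run (Cond b c1 c2) = (\<lambda>st. case (if holds b st then run c1 st else run c2 st) of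
     (st1, t1) \<Rightarrow> (st1, test_time b + t1 + 1))"
| "run (For r lo hi c) = (\<lambda>st.
     fold (\<lambda>i (st1, t1). case run c (set_reg r i st1) of (st2, t2) \<Rightarrow> (st2, t1 + t2 + 1))
       [eval lo st..<eval hi st] (st, eval_time lo + eval_time hi + 1))"

text \<open>A list of lists is stored as one array with its concatenation and one array of start positions.
  All other cells are 0 initially.\<close>

definition starts :: "'a list list \<Rightarrow> nat \<Rightarrow> nat" where
  "starts xss i = length (concat (take i xss))"

definition cells :: "nat list \<Rightarrow> nat \<Rightarrow> nat" where
  "cells xs i = (if i < length xs then xs ! i else 0)"

definition initial_state :: "input \<Rightarrow> ram" where
  "initial_state inp = \<lparr>regs = (\<lambda>_. 0)(numSimp := length inp),
     mem = (\<lambda>_ _. 0)(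
       SDim := cells (map sdim inp),
       GPtr := cells (map (starts (map grades inp)) [0..<length inp]),
       GLen := cells (map (length \<circ> grades) inp),
       GX := cells (map fst (concat (map grades inp))),
       GY := cells (map snd (concat (map grades inp))),
       FPtr := cells (map (starts (map facets inp)) [0..<length inp]),
       FLen := cells (map (length \<circ> facets) inp),
       Fac := cells (concat (map facets inp)))\<rparr>"

text \<open>The \<open>i\<close>-th column of a matrix stored in the arrays \<open>p\<close> and \<open>a\<close> occupies the cells of \<open>a\<close> from
  position \<open>p[i]\<close> up to, but excluding, \<open>p[i + 1]\<close>.\<close>

definition read_matrix :: "ram \<Rightarrow> arr \<Rightarrow> arr \<Rightarrow> nat \<Rightarrow> sparse_matrix" where
  "read_matrix st p a cols = map (\<lambda>i. map (mem st a) [mem st p i..<mem st p (Suc i)]) [0..<cols]"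

definition read_output :: "ram \<Rightarrow> algorithm_output" where
  "read_output st =
    \<lparr>gens = map (\<lambda>i. (mem st GenDeg i, mem st GenX i, mem st GenY i)) [0..<regs st numGen],
     rels = map (\<lambda>i. (mem st RelDeg i, mem st RelX i, mem st RelY i)) [0..<regs st numRel],
     p1 = read_matrix st P1Ptr P1Row (regs st numRel),
     f0 = read_matrix st F0Ptr F0Row (regs st numGen),
     f1 = read_matrix st F1Ptr F1Row (regs st numRel),
     h0 = read_matrix st H0Ptr H0Row (regs st numGen)\<rparr>"


section \<open>The path algorithm\<close>

text \<open>Maximum and minimum are expressed by truncated subtraction.\<close>

definition emax :: "exp \<Rightarrow> exp \<Rightarrow> exp" where
  "emax a b = a .+ (b .- a)"

definition emin :: "exp \<Rightarrow> exp \<Rightarrow> exp" where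
  "emin a b = a .- (a .- b)"

text \<open>Generators are numbered by the position of their grade in the input. \<open>Own\<close> maps a generator to
  its simplex, and \<open>RelOf\<close> maps a generator to the relation between it and the next generator.\<close>

definition step1 :: com where
  "step1 =
     numGen \<leftarrow> N 0;;
     numRel \<leftarrow> N 0;;
     P1Ptr\<langle>N 0\<rangle> \<Leftarrow> N 0;;
     FOR simp FROM N 0 TO V numSimp DO
       FOR pos FROM N 0 TO GLen\<langle>V simp\<rangle> DO (
         gen \<leftarrow> GPtr\<langle>V simp\<rangle> .+ V pos;;
         GenDeg\<langle>V gen\<rangle> \<Leftarrow> SDim\<langle>V simp\<rangle>;;
         GenX\<langle>V gen\<rangle> \<Leftarrow> GX\<langle>V gen\<rangle>;;
         GenY\<langle>V gen\<rangle> \<Leftarrow> GY\<langle>V gen\<rangle>;;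
         Own\<langle>V gen\<rangle> \<Leftarrow> V simp;;
         numGen \<leftarrow> V numGen .+ N 1;;
         IF V pos .+ N 1 .< GLen\<langle>V simp\<rangle> THEN (
           RelDeg\<langle>V numRel\<rangle> \<Leftarrow> SDim\<langle>V simp\<rangle>;;
           RelX\<langle>V numRel\<rangle> \<Leftarrow> emax (GX\<langle>V gen\<rangle>) (GX\<langle>V gen .+ N 1\<rangle>);;
           RelY\<langle>V numRel\<rangle> \<Leftarrow> emax (GY\<langle>V gen\<rangle>) (GY\<langle>V gen .+ N 1\<rangle>);;
           P1Row\<langle>N 2 .* V numRel\<rangle> \<Leftarrow> V gen;;
           P1Row\<langle>N 2 .* V numRel .+ N 1\<rangle> \<Leftarrow> V gen .+ N 1;;
           P1Ptr\<langle>V numRel .+ N 1\<rangle> \<Leftarrow> N 2 .* V numRel .+ N 2;;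
           RelOf\<langle>V gen\<rangle> \<Leftarrow> V numRel;;
           numRel \<leftarrow> V numRel .+ N 1)
         ELSE SKIP)"

text \<open>The columns of \<open>f0\<close> have one entry per facet, so their positions are known in advance.\<close>

definition f0_columns :: com where
  "f0_columns =
     F0Ptr\<langle>N 0\<rangle> \<Leftarrow> N 0;;
     FOR gen FROM N 0 TO V numGen DO
       F0Ptr\<langle>V gen .+ N 1\<rangle> \<Leftarrow> F0Ptr\<langle>V gen\<rangle> .+ FLen\<langle>Own\<langle>V gen\<rangle>\<rangle>"

text \<open>A stable counting sort of \<open>Order\<close> with respect to a key of the generator in register \<open>gen\<close>; keys
  are smaller than the content of \<open>radix\<close>.\<close>

definition counting_sort :: "exp \<Rightarrow> com" where
  "counting_sort key =
     FOR bucket FROM N 0 TO V radix .+ N 1 DO Count\<langle>V bucket\<rangle> \<Leftarrow> N 0;;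
     FOR idx FROM N 0 TO V numGen DO (
       gen \<leftarrow> Order\<langle>V idx\<rangle>;;
       Count\<langle>key .+ N 1\<rangle> \<Leftarrow> Count\<langle>key .+ N 1\<rangle> .+ N 1);;
     FOR bucket FROM N 0 TO V radix DO
       Count\<langle>V bucket .+ N 1\<rangle> \<Leftarrow> Count\<langle>V bucket .+ N 1\<rangle> .+ Count\<langle>V bucket\<rangle>;;
     FOR idx FROM N 0 TO V numGen DO (
       gen \<leftarrow> Order\<langle>V idx\<rangle>;;
       Temp\<langle>Count\<langle>key\<rangle>\<rangle> \<Leftarrow> V gen;;
       Count\<langle>key\<rangle> \<Leftarrow> Count\<langle>key\<rangle> .+ N 1);;
     FOR idx FROM N 0 TO V numGen DO Order\<langle>V idx\<rangle> \<Leftarrow> Temp\<langle>V idx\<rangle>"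

text \<open>Radix sort of all generators by first coordinate, ties broken by dimension. In this order, the
  last generator of a facet \<open>\<tau>\<close> seen before a generator of grade \<open>x\<close> is the one with the largest first
  coordinate not exceeding that of \<open>x\<close>, hence with the smallest second coordinate among these.\<close>

definition find_by_sweep :: com where
  "find_by_sweep =
     FOR idx FROM N 0 TO V numGen DO Order\<langle>V idx\<rangle> \<Leftarrow> V idx;;
     counting_sort (GenDeg\<langle>V gen\<rangle>);;
     power \<leftarrow> N 1;;
     FOR pass FROM N 0 TO V digits DO (
       counting_sort (GenX\<langle>V gen\<rangle> ./ V power .% V radix);;
       power \<leftarrow> V power .* V radix);;
     FOR idx FROM N 0 TO V numGen DO (
       gen \<leftarrow> Order\<langle>V idx\<rangle>;;
       simp \<leftarrow> Own\<langle>V gen\<rangle>;;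
       Last\<langle>V simp\<rangle> \<Leftarrow> V gen;;
       FOR pos FROM N 0 TO FLen\<langle>V simp\<rangle> DO
         F0Row\<langle>F0Ptr\<langle>V gen\<rangle> .+ V pos\<rangle> \<Leftarrow> Last\<langle>Fac\<langle>FPtr\<langle>V simp\<rangle> .+ V pos\<rangle>\<rangle>)"

definition find_by_scan :: com where
  "find_by_scan =
     FOR gen FROM N 0 TO V numGen DO (
       simp \<leftarrow> Own\<langle>V gen\<rangle>;;
       FOR pos FROM N 0 TO FLen\<langle>V simp\<rangle> DO (
         fac \<leftarrow> Fac\<langle>FPtr\<langle>V simp\<rangle> .+ V pos\<rangle>;;
         FOR idx FROM GPtr\<langle>V fac\<rangle> TO GPtr\<langle>V fac\<rangle> .+ GLen\<langle>V fac\<rangle> DO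
           IF GenX\<langle>V idx\<rangle> .\<le> GenX\<langle>V gen\<rangle> .\<and> GenY\<langle>V idx\<rangle> .\<le> GenY\<langle>V gen\<rangle>
           THEN F0Row\<langle>F0Ptr\<langle>V gen\<rangle> .+ V pos\<rangle> \<Leftarrow> V idx
           ELSE SKIP))"

text \<open>The sweep takes as many sorting passes as the first coordinates have digits in base
  \<open>numGen + 1\<close>. It is used if this number does not exceed the length of the longest list of grades.\<close>

definition step2 :: com where
  "step2 =
     f0_columns;;
     maxLen \<leftarrow> N 0;;
     FOR simp FROM N 0 TO V numSimp DO maxLen \<leftarrow> emax (V maxLen) (GLen\<langle>V simp\<rangle>);;
     maxX \<leftarrow> N 0;;
     FOR gen FROM N 0 TO V numGen DO maxX \<leftarrow> emax (V maxX) (GenX\<langle>V gen\<rangle>);;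
     radix \<leftarrow> V numGen .+ N 1;;
     digits \<leftarrow> N 0;;
     power \<leftarrow> N 1;;
     FOR pass FROM N 0 TO V maxLen DO
       IF V power .\<le> V maxX
       THEN (power \<leftarrow> V power .* V radix;; digits \<leftarrow> V digits .+ N 1)
       ELSE SKIP;;
     IF V maxX .< V power THEN find_by_sweep ELSE find_by_scan"

text \<open>The product of \<open>[f0]\<close> with a column stored in the cells \<open>lo, ..., hi - 1\<close> of the array \<open>a\<close>. The
  entries are collected in \<open>Work\<close> without cancellation: equal entries form a pair whose
  connecting path is empty.\<close>

definition product_column :: "arr \<Rightarrow> exp \<Rightarrow> exp \<Rightarrow> com" where
  "product_column a lo hi =
     workLen \<leftarrow> N 0;;
     FOR idx FROM lo TO hi DO
       FOR ent FROM F0Ptr\<langle>a\<langle>V idx\<rangle>\<rangle> TO F0Ptr\<langle>a\<langle>V idx\<rangle> .+ N 1\<rangle> DO (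
         Work\<langle>V workLen\<rangle> \<Leftarrow> F0Row\<langle>V ent\<rangle>;;
         workLen \<leftarrow> V workLen .+ N 1)"

text \<open>Appends the connecting paths of the pairs in \<open>Work\<close> to the array \<open>a\<close>.\<close>

definition connect_pairs :: "arr \<Rightarrow> com" where
  "connect_pairs a =
     FOR idx FROM N 0 TO V workLen DO
       FOR ent FROM V idx .+ N 1 TO V workLen DO (
         rowA \<leftarrow> Work\<langle>V idx\<rangle>;;
         rowB \<leftarrow> Work\<langle>V ent\<rangle>;;
         IF Own\<langle>V rowA\<rangle> .= Own\<langle>V rowB\<rangle>
         THEN FOR pos FROM emin (V rowA) (V rowB) TO emax (V rowA) (V rowB) DO (
           a\<langle>V ptr\<rangle> \<Leftarrow> RelOf\<langle>V pos\<rangle>;;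
           ptr \<leftarrow> V ptr .+ N 1)
         ELSE SKIP)"

definition step3 :: com where
  "step3 =
     ptr \<leftarrow> N 0;;
     F1Ptr\<langle>N 0\<rangle> \<Leftarrow> N 0;;
     FOR gen FROM N 0 TO V numRel DO (
       product_column P1Row (P1Ptr\<langle>V gen\<rangle>) (P1Ptr\<langle>V gen .+ N 1\<rangle>);;
       connect_pairs F1Row;;
       F1Ptr\<langle>V gen .+ N 1\<rangle> \<Leftarrow> V ptr);;
     ptr \<leftarrow> N 0;;
     H0Ptr\<langle>N 0\<rangle> \<Leftarrow> N 0;;
     FOR gen FROM N 0 TO V numGen DO (
       product_column F0Row (F0Ptr\<langle>V gen\<rangle>) (F0Ptr\<langle>V gen .+ N 1\<rangle>);;
       connect_pairs H0Row;;
       H0Ptr\<langle>V gen .+ N 1\<rangle> \<Leftarrow> V ptr)"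

definition path_algorithm :: com where
  "path_algorithm = step1;; step2;; step3"

definition path_algorithm_output :: "input \<Rightarrow> algorithm_output" where
  "path_algorithm_output inp = read_output (fst (run path_algorithm (initial_state inp)))"

definition path_algorithm_time :: "input \<Rightarrow> nat" where
  "path_algorithm_time inp = snd (run path_algorithm (initial_state inp))"

end

theory Submission
  imports Defs
begin

text \<open>Correctness of the sweep: within one simplex the minimal grades increase in the first and decrease
  in the second coordinate, so the last generator of a facet seen before a generator of grade \<open>x\<close> has
  the smallest second coordinate among all generators of the facet whose first coordinate does not
  exceed that of \<open>x\<close>; one of them lies below \<open>x\<close>. Every \<open>\<tau>\<close> labels at most two entries of a product
  column, because a codimension-2 face lies in only two facets. So the paths of a column are disjoint,
  and a column is produced in time proportional to its length plus a constant that depends on the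
  dimension. A path has at most \<open>k\<close> entries, which bounds the output by \<open>O(n k)\<close>.

  Step 2 makes \<open>q\<close> passes over the generators, where \<open>q\<close> is the number of digits of the first coordinates
  or the length of the longest list of grades; \<open>q\<close> is at most \<open>k\<close> in either case, and at most \<open>e\<close> if
  the grades are smaller than \<open>(n + 1) ^ e\<close>.\<close>

section \<open>Weakest preconditions with running time\<close>

text \<open>The program knows neither \<open>k\<close> nor \<open>e\<close>. It therefore measures
  the longest list of grades, counts digits for at most that many rounds and then takes the cheaper
  method, so that one number \<open>q\<close> serves both time bounds. The cost of writing
  \<open>f1\<close> and \<open>h0\<close> is not estimated at all but charged to the entries
  written, since their number may lie far below n k. The delicate point of the sweep is a tie: a
  simplex and a facet may have generators with the same first coordinate, and the facet must come
  first. The preliminary sort by dimension ensures this, because counting sort is stable and the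
  dimension strictly drops on passing to a facet. Memory and mathematics are linked by
  \<open>offset\<close>. Bases and columns are stored block after block, so \<open>(s, j)\<close>
  sits in cell \<open>offset l s + j\<close>; the generators of a simplex are consecutive, and a
  connecting path is the image under \<open>RelOf\<close> of an interval of cells.\<close>

definition wp :: "com \<Rightarrow> (ram \<Rightarrow> nat \<Rightarrow> bool) \<Rightarrow> ram \<Rightarrow> bool" where
  "wp c Q st \<longleftrightarrow> (case run c st of (st', t) \<Rightarrow> Q st' t)"

primrec writes :: "com \<Rightarrow> arr \<Rightarrow> bool" where
  "writes SKIP b \<longleftrightarrow> False"
| "writes (Assign r e) b \<longleftrightarrow> False"
| "writes (Store a i e) b \<longleftrightarrow> b = a"
| "writes (Seq c1 c2) b \<longleftrightarrow> writes c1 b \<or> writes c2 b"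
| "writes (Cond t c1 c2) b \<longleftrightarrow> writes c1 b \<or> writes c2 b"
| "writes (For r lo hi c) b \<longleftrightarrow> writes c b"

primrec assigns :: "com \<Rightarrow> reg \<Rightarrow> bool" where
  "assigns SKIP x \<longleftrightarrow> False"
| "assigns (Assign r e) x \<longleftrightarrow> x = r"
| "assigns (Store a i e) x \<longleftrightarrow> False"
| "assigns (Seq c1 c2) x \<longleftrightarrow> assigns c1 x \<or> assigns c2 x"
| "assigns (Cond t c1 c2) x \<longleftrightarrow> assigns c1 x \<or> assigns c2 x"
| "assigns (For r lo hi c) x \<longleftrightarrow> x = r \<or> assigns c x"

text \<open>A syntactic over-approximation: whether an array or register survives a program is
  settled by simplification of the program text. Invariants then only need to mention what a loop
  changes.\<close>

definition frame :: "com \<Rightarrow> ram \<Rightarrow> ram \<Rightarrow> bool" where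
  "frame c st st' \<longleftrightarrow>
     (\<forall>a. \<not> writes c a \<longrightarrow> mem st' a = mem st a) \<and> (\<forall>r. \<not> assigns c r \<longrightarrow> regs st' r = regs st r)"

lemma frame_mem: "frame c st st' \<Longrightarrow> \<not> writes c a \<Longrightarrow> mem st' a = mem st a"
  and frame_regs: "frame c st st' \<Longrightarrow> \<not> assigns c r \<Longrightarrow> regs st' r = regs st r"
  by (auto simp: frame_def)

lemma regs_set_reg [simp]: "regs (set_reg r v st) x = (if x = r then v else regs st x)"
  and mem_set_reg [simp]: "mem (set_reg r v st) = mem st"
  and regs_set_mem [simp]: "regs (set_mem a i v st) = regs st"
  and mem_set_mem [simp]: "mem (set_mem a i v st) b = (if b = a then (mem st a)(i := v) else mem st b)"
  by (auto simp: set_reg_def set_mem_def)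

lemma wp_SKIP [simp]: "wp SKIP Q st \<longleftrightarrow> Q st 1"
  and wp_Assign [simp]: "wp (Assign r e) Q st \<longleftrightarrow> Q (set_reg r (eval e st) st) (eval_time e + 1)"
  and wp_Store [simp]:
    "wp (Store a i e) Q st \<longleftrightarrow> Q (set_mem a (eval i st) (eval e st) st) (eval_time i + eval_time e + 1)"
  and wp_Seq: "wp (Seq c1 c2) Q st \<longleftrightarrow> wp c1 (\<lambda>st1 t1. wp c2 (\<lambda>st2 t2. Q st2 (t1 + t2)) st1) st"
  and wp_Cond: "wp (Cond b c1 c2) Q st \<longleftrightarrow>
    (if holds b st then wp c1 (\<lambda>st' t. Q st' (test_time b + t + 1)) st
     else wp c2 (\<lambda>st' t. Q st' (test_time b + t + 1)) st)"
  by (auto simp: wp_def split: prod.splits)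

lemma fold_invariant:
  assumes "\<And>x s. P s \<Longrightarrow> P (f x s)" and "P s"
  shows "P (fold f xs s)"
  using assms(2) by (induction xs arbitrary: s) (auto simp: assms(1))

lemma frame_run: "frame c st (fst (run c st))"
proof (induction c arbitrary: st)
  case (Seq c1 c2)
  show ?case
    using Seq(1)[of st] Seq(2)[of "fst (run c1 st)"] by (auto simp: frame_def split: prod.splits)
next
  case (Cond b c1 c2)
  show ?case
    using Cond(1)[of st] Cond(2)[of st] by (auto simp: frame_def split: prod.splits)
next
  case (For r lo hi c)
  have step: "frame (For r lo hi c) st (fst (run c (set_reg r i st1)))"
    if "frame (For r lo hi c) st st1" for i st1
    using For[of "set_reg r i st1"] that by (auto simp: frame_def)
  have "frame (For r lo hi c) st (fst (fold (\<lambda>i (st1, t1).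
      case run c (set_reg r i st1) of (st2, t2) \<Rightarrow> (st2, t1 + t2 + 1)) is (st, t)))" for "is" t
    by (rule fold_invariant[where P = "\<lambda>p. frame (For r lo hi c) st (fst p)"])
      (simp add: case_prod_beta step, simp add: frame_def)
  then show ?case by simp
qed (auto simp: frame_def)

text \<open>Besides weakening the postcondition, it hands the frame of \<open>c\<close> to the
  continuation, which is why the specifications below rarely list unchanged state.\<close>

lemma wp_conseq:
  assumes "wp c Q st" and "\<And>st' t. Q st' t \<Longrightarrow> frame c st st' \<Longrightarrow> Q' st' t"
  shows "wp c Q' st"
  using assms frame_run[of c st] by (auto simp: wp_def split: prod.splits)

lemma wp_SeqI:
  assumes "wp c1 Q st"
    and "\<And>st1 t1. Q st1 t1 \<Longrightarrow> frame c1 st st1 \<Longrightarrow> wp c2 (\<lambda>st2 t2. Q' st2 (t1 + t2)) st1"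
  shows "wp (c1;; c2) Q' st"
  unfolding wp_Seq using wp_conseq[OF assms] .

text \<open>\<open>Inv i st t\<close> describes the state before round \<open>i\<close> together
  with all time spent so far, including the evaluation of the bounds. The final index is a maximum
  because an empty range leaves the invariant at the lower bound.\<close>

lemma wp_For:
  assumes init: "Inv (eval lo st) st (eval_time lo + eval_time hi + 1)"
    and step: "\<And>i st' t. eval lo st \<le> i \<Longrightarrow> i < eval hi st \<Longrightarrow> Inv i st' t \<Longrightarrow>
      frame (For r lo hi c) st st' \<Longrightarrow> wp c (\<lambda>st'' t'. Inv (Suc i) st'' (t + t' + 1)) (set_reg r i st')"
    and final: "\<And>st' t. Inv (max (eval lo st) (eval hi st)) st' t \<Longrightarrow>
      frame (For r lo hi c) st st' \<Longrightarrow> Q st' t"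
  shows "wp (For r lo hi c) Q st"
proof -
  define f where "f = (\<lambda>i (st1, t1). case run c (set_reg r i st1) of (st2, t2) \<Rightarrow> (st2, t1 + t2 + 1::nat))"
  \<comment> \<open>The induction runs over every \<open>h\<close> up to the upper bound; below the
    lower bound the list of rounds is empty, and the maximum keeps the claim at its initial
    instance.\<close>
  have inv: "Inv (max (eval lo st) h) (fst p) (snd p) \<and> frame (For r lo hi c) st (fst p)"
    if "h \<le> eval hi st" "p = fold f [eval lo st..<h] (st, eval_time lo + eval_time hi + 1)" for h p
    using that
  proof (induction h arbitrary: p)
    case 0
    then show ?case using init by (auto simp: frame_def)
  next
    case (Suc h)
    show ?case
    proof (cases "eval lo st \<le> h")
      case False
      then show ?thesis using Suc.prems init by (auto simp: frame_def max_def not_le less_eq_Suc_le le_antisym)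
    next
      case True
      define q where "q = fold f [eval lo st..<h] (st, eval_time lo + eval_time hi + 1)"
      have q: "Inv h (fst q) (snd q)" "frame (For r lo hi c) st (fst q)"
        using Suc.IH[of q] Suc.prems(1) True by (auto simp: q_def max_def)
      have p: "p = f h q" using Suc.prems(2) True by (simp add: q_def)
      obtain st2 t2 where run: "run c (set_reg r h (fst q)) = (st2, t2)" by fastforce
      have p': "p = (st2, snd q + t2 + 1)" using p run by (simp add: f_def split: prod.splits)
      have "Inv (Suc h) st2 (snd q + t2 + 1)"
        using step[of h "fst q" "snd q"] True Suc.prems(1) q run by (simp add: wp_def)
      moreover have "frame (For r lo hi c) st st2"
        using frame_run[of c "set_reg r h (fst q)"] q(2) run by (auto simp: frame_def)
      ultimately show ?thesis using p' True by (simp add: max_def)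
    qed
  qed
  have "run (For r lo hi c) st = fold f [eval lo st..<eval hi st] (st, eval_time lo + eval_time hi + 1)"
    by (simp add: f_def)
  then show ?thesis
    using inv[of "eval hi st", OF order_refl refl] final unfolding wp_def by (metis case_prodI2 fst_conv snd_conv)
qed


section \<open>Positions in concatenated lists\<close>

text \<open>The position at which block \<open>i\<close> of a concatenation starts. Block lengths
  \<open>glen\<close>, \<open>rlen\<close>, \<open>flen\<close> and the column lengths of matrices
  give all memory layouts that occur.\<close>

definition offset :: "(nat \<Rightarrow> nat) \<Rightarrow> nat \<Rightarrow> nat" where
  "offset l i = (\<Sum>j<i. l j)"

lemma offset_0 [simp]: "offset l 0 = 0"
  and offset_Suc [simp]: "offset l (Suc i) = offset l i + l i"
  by (simp_all add: offset_def)

lemma offset_mono: "i \<le> j \<Longrightarrow> offset l i \<le> offset l j"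
  by (auto simp: offset_def intro!: sum_mono2)

lemma offset_add_less: "s < t \<Longrightarrow> j < l s \<Longrightarrow> offset l s + j < offset l t"
  using offset_mono[of "Suc s" t l] by simp

lemma offset_eq_iff:
  assumes "j < l s" and "j' < l s'"
  shows "offset l s + j = offset l s' + j' \<longleftrightarrow> s = s' \<and> j = j'"
  using offset_add_less[of s s' j l] offset_add_less[of s' s j' l] assms
  by (cases s s' rule: linorder_cases) auto

lemma offset_cases:
  assumes "g < offset l m"
  obtains s j where "s < m" "j < l s" "g = offset l s + j"
proof -
  have "\<exists>s<m. \<exists>j<l s. g = offset l s + j"
    using assms
  proof (induction m)
    case (Suc m)
    show ?case
    proof (cases "g < offset l m")
      case False
      then have "g - offset l m < l m" "g = offset l m + (g - offset l m)"
        using Suc.prems by auto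
      then show ?thesis by (metis lessI)
    qed (use Suc.IH less_SucI in blast)
  qed simp
  then show ?thesis using that by blast
qed

lemma offset_cong: "(\<And>i. i < n \<Longrightarrow> l i = l' i) \<Longrightarrow> offset l n = offset l' n"
  by (simp add: offset_def)

lemma length_concat_offset: "length (concat xss) = offset (\<lambda>i. length (xss ! i)) (length xss)"
  by (simp add: offset_def length_concat sum_list_sum_nth atLeast0LessThan)

lemma starts_eq_offset:
  assumes "i \<le> length xss"
  shows "starts xss i = offset (\<lambda>i. length (xss ! i)) i"
proof -
  have "starts xss i = offset (\<lambda>j. length (take i xss ! j)) i"
    unfolding starts_def length_concat_offset using assms by (simp add: min_def)
  also have "\<dots> = offset (\<lambda>j. length (xss ! j)) i" by (rule offset_cong) simp
  finally show ?thesis .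
qed

lemma nth_concat_offset:
  assumes "s < length xss" and "j < length (xss ! s)"
  shows "concat xss ! (offset (\<lambda>i. length (xss ! i)) s + j) = xss ! s ! j"
proof -
  have "concat xss = concat (take s xss) @ xss ! s @ concat (drop (Suc s) xss)"
    using id_take_nth_drop[OF assms(1)] by (metis concat.simps(2) concat_append)
  moreover have "length (concat (take s xss)) = offset (\<lambda>i. length (xss ! i)) s"
    using starts_eq_offset[of s xss] assms(1) by (simp add: starts_def)
  ultimately show ?thesis using assms(2) by (simp add: nth_append)
qed

text \<open>The common form of \<open>generators\<close> (block lengths \<open>glen\<close>) and
  \<open>relations\<close> (block lengths \<open>rlen\<close>).\<close>

definition pairs :: "(nat \<Rightarrow> nat) \<Rightarrow> nat \<Rightarrow> (nat \<times> nat) list" where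
  "pairs l m = concat (map (\<lambda>s. map (Pair s) [0..<l s]) [0..<m])"

lemma length_pairs [simp]: "length (pairs l m) = offset l m"
  unfolding pairs_def length_concat_offset by (auto intro: offset_cong)

lemma nth_pairs:
  assumes "s < m" and "j < l s"
  shows "pairs l m ! (offset l s + j) = (s, j)"
proof -
  have "offset (\<lambda>i. length (map (\<lambda>s. map (Pair s) [0..<l s]) [0..<m] ! i)) s = offset l s"
    using assms(1) by (intro offset_cong) simp
  then show ?thesis
    using nth_concat_offset[of s "map (\<lambda>s. map (Pair s) [0..<l s]) [0..<m]" j] assms
    by (simp add: pairs_def)
qed


section \<open>Inputs of the path algorithm\<close>

text \<open>All that the proof uses of an encoded bifiltration once simplices are mere indices.
  \<open>D\<close> bounds the number of facets; \<open>sdim_facet\<close> decides ties in the sweep,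
  \<open>codim2_face\<close> keeps the paths of a column disjoint, and \<open>sdim_le\<close> makes
  the dimension an admissible key for a counting sort with \<open>nG + 1\<close> buckets.\<close>

locale path_input =
  fixes inp :: input and D :: nat
  assumes grades_nonempty: "s < length inp \<Longrightarrow> grades (inp ! s) \<noteq> []"
    and grades_antichain: "s < length inp \<Longrightarrow> i < j \<Longrightarrow> j < length (grades (inp ! s)) \<Longrightarrow>
      fst (grades (inp ! s) ! i) < fst (grades (inp ! s) ! j) \<and>
      snd (grades (inp ! s) ! j) < snd (grades (inp ! s) ! i)"
    and distinct_facets: "s < length inp \<Longrightarrow> distinct (facets (inp ! s))"
    and facets_less: "s < length inp \<Longrightarrow> \<tau> \<in> set (facets (inp ! s)) \<Longrightarrow> \<tau> < length inp"
    and length_facets_le: "s < length inp \<Longrightarrow> length (facets (inp ! s)) \<le> D"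
    and sdim_facet: "s < length inp \<Longrightarrow> \<tau> \<in> set (facets (inp ! s)) \<Longrightarrow> sdim (inp ! \<tau>) < sdim (inp ! s)"
    and facet_grade: "s < length inp \<Longrightarrow> \<tau> \<in> set (facets (inp ! s)) \<Longrightarrow>
      j < length (grades (inp ! s)) \<Longrightarrow>
      \<exists>i<length (grades (inp ! \<tau>)). grades (inp ! \<tau>) ! i \<le> grades (inp ! s) ! j"
    and codim2_face: "s < length inp \<Longrightarrow> {\<tau>1, \<tau>2, \<tau>3} \<subseteq> set (facets (inp ! s)) \<Longrightarrow>
      \<tau> \<in> set (facets (inp ! \<tau>1)) \<inter> set (facets (inp ! \<tau>2)) \<inter> set (facets (inp ! \<tau>3)) \<Longrightarrow>
      \<tau>1 = \<tau>2 \<or> \<tau>1 = \<tau>3 \<or> \<tau>2 = \<tau>3"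
    and sdim_le: "s < length inp \<Longrightarrow> sdim (inp ! s) \<le> (\<Sum>i<length inp. length (grades (inp ! i)))"
begin

abbreviation m :: nat where "m \<equiv> length inp"
abbreviation glen :: "nat \<Rightarrow> nat" where "glen s \<equiv> length (grades (inp ! s))"
abbreviation flen :: "nat \<Rightarrow> nat" where "flen s \<equiv> length (facets (inp ! s))"
abbreviation rlen :: "nat \<Rightarrow> nat" where "rlen s \<equiv> glen s - Suc 0"
abbreviation gix :: "nat \<Rightarrow> nat \<Rightarrow> nat" where "gix s j \<equiv> offset glen s + j"
abbreviation rix :: "nat \<Rightarrow> nat \<Rightarrow> nat" where "rix s j \<equiv> offset rlen s + j"
abbreviation nG :: nat where "nG \<equiv> offset glen m"
abbreviation nR :: nat where "nR \<equiv> offset rlen m"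

definition own :: "nat \<Rightarrow> nat" where "own g = fst (pairs glen m ! g)"
definition grd :: "nat \<Rightarrow> grade" where "grd g = grades (inp ! own g) ! snd (pairs glen m ! g)"

text \<open>A relation joins two consecutive generators of one simplex. This is the position of the
  first of them, so that \<open>Suc (lower r)\<close> is the second.\<close>

definition lower :: "nat \<Rightarrow> nat" where
  "lower r = (case pairs rlen m ! r of (s, j) \<Rightarrow> gix s j)"

lemma generators_eq: "generators inp = pairs glen m"
  and relations_eq: "relations inp = pairs rlen m"
  by (simp_all add: generators_def relations_def pairs_def)

lemma glen_pos: "s < m \<Longrightarrow> 0 < glen s"
  using grades_nonempty by simp

lemma gix_less: "s < m \<Longrightarrow> j < glen s \<Longrightarrow> gix s j < nG"
  and rix_less: "s < m \<Longrightarrow> j < rlen s \<Longrightarrow> rix s j < nR"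
  by (simp_all add: offset_add_less)

lemma own_gix [simp]: "s < m \<Longrightarrow> j < glen s \<Longrightarrow> own (gix s j) = s"
  and grd_gix [simp]: "s < m \<Longrightarrow> j < glen s \<Longrightarrow> grd (gix s j) = grades (inp ! s) ! j"
  and lower_rix [simp]: "s < m \<Longrightarrow> j < rlen s \<Longrightarrow> lower (rix s j) = gix s j"
  by (simp_all add: own_def grd_def lower_def nth_pairs)

lemma gen_cases:
  assumes "g < nG"
  obtains s j where "s < m" "j < glen s" "g = gix s j"
  using offset_cases[OF assms] .

lemma rel_cases:
  assumes "r < nR"
  obtains s j where "s < m" "j < rlen s" "r = rix s j"
  using offset_cases[OF assms] .

lemma own_less: "g < nG \<Longrightarrow> own g < m"
  by (metis gen_cases own_gix)

lemma m_le_nG: "m \<le> nG"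
proof -
  have "(\<Sum>s<m. 1) \<le> (\<Sum>s<m. glen s)"
    using glen_pos by (intro sum_mono) (simp add: Suc_leI)
  then show ?thesis by (simp add: offset_def)
qed

lemma nR_le_nG: "nR \<le> nG"
  by (auto simp: offset_def intro: sum_mono)

definition input_state :: "ram \<Rightarrow> bool" where
  "input_state st \<longleftrightarrow> regs st numSimp = m \<and>
     (\<forall>s<m. mem st SDim s = sdim (inp ! s) \<and> mem st GPtr s = offset glen s \<and> mem st GLen s = glen s \<and>
        mem st FPtr s = offset flen s \<and> mem st FLen s = flen s \<and>
        (\<forall>p<flen s. mem st Fac (offset flen s + p) = facets (inp ! s) ! p)) \<and>
     (\<forall>g<nG. mem st GX g = fst (grd g) \<and> mem st GY g = snd (grd g))"

lemma input_state_initial: "input_state (initial_state inp)"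
proof -
  have "starts (map grades inp) s = offset glen s" "starts (map facets inp) s = offset flen s"
    if "s < m" for s
    using that by (auto simp: starts_eq_offset intro!: offset_cong)
  moreover have "concat (map facets inp) ! (offset flen s + p) = facets (inp ! s) ! p \<and>
      offset flen s + p < length (concat (map facets inp))"
    if "s < m" "p < flen s" for s p
  proof -
    have *: "offset (\<lambda>i. length (map facets inp ! i)) n = offset flen n" if "n \<le> m" for n
      using that by (intro offset_cong) simp
    show ?thesis
      using nth_concat_offset[of s "map facets inp" p] that *[of s] *[of m] offset_add_less[of s m p flen]
      unfolding length_concat_offset by simp
  qed
  moreover have "concat (map grades inp) ! g = grd g \<and> g < length (concat (map grades inp))"
    if "g < nG" for g
  proof -
    obtain s j where g: "s < m" "j < glen s" "g = gix s j" using gen_cases[OF \<open>g < nG\<close>] .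
    have *: "offset (\<lambda>i. length (map grades inp ! i)) n = offset glen n" if "n \<le> m" for n
      using that by (intro offset_cong) simp
    show ?thesis
      using nth_concat_offset[of s "map grades inp" j] g *[of s] *[of m] \<open>g < nG\<close>
      unfolding length_concat_offset by simp
  qed
  ultimately show ?thesis
    by (auto simp: input_state_def initial_state_def cells_def)
qed

lemma input_state_frame:
  assumes "input_state st" and "frame c st st'" and "\<not> assigns c numSimp"
    and "\<not> writes c SDim" "\<not> writes c GPtr" "\<not> writes c GLen" "\<not> writes c GX" "\<not> writes c GY"
      "\<not> writes c FPtr" "\<not> writes c FLen" "\<not> writes c Fac"
  shows "input_state st'"
  using assms(1) unfolding input_state_def
  by (simp add: assms(3-) frame_mem[OF assms(2)] frame_regs[OF assms(2)])

text \<open>Different relations start at different generators, so a new entry of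
  \<open>RelOf\<close>, stored at \<open>lower r\<close>, overwrites no earlier one.\<close>

lemma lower_strict_mono:
  assumes "r < r'" and "r' < nR"
  shows "lower r < lower r'"
proof -
  obtain s j where r: "s < m" "j < rlen s" "r = rix s j" using rel_cases[of r] assms by auto
  obtain s' j' where r': "s' < m" "j' < rlen s'" "r' = rix s' j'" using rel_cases[of r'] assms by auto
  have "\<not> s' < s" using offset_add_less[of s' s j' rlen] r r' assms(1) by auto
  then consider "s = s'" "j < j'" | "s < s'" using r r' assms(1) by force
  then show ?thesis
  proof cases
    case 2
    then have "gix s j < offset glen s'" using r by (intro offset_add_less) auto
    then show ?thesis using r r' by simp
  qed (use r r' in simp)
qed

lemma lower_less:
  assumes "r < nR"
  shows "Suc (lower r) < nG" and "own (Suc (lower r)) = own (lower r)"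
proof -
  obtain s j where r: "s < m" "j < rlen s" "r = rix s j" using rel_cases assms by auto
  have *: "Suc (gix s j) = gix s (Suc j)" by simp
  show "Suc (lower r) < nG" "own (Suc (lower r)) = own (lower r)"
    using r gix_less[of s "Suc j"] own_gix[of s "Suc j"] by (simp_all del: own_gix) simp_all
qed


section \<open>Step 1\<close>

text \<open>The parameter, here and in \<open>rels_done\<close>, counts the basis elements already
  written, so the same predicate serves as loop invariant and as final specification.\<close>

definition gens_done :: "nat \<Rightarrow> ram \<Rightarrow> bool" where
  "gens_done a st \<longleftrightarrow> regs st numGen = a \<and>
     (\<forall>g<a. mem st GenDeg g = sdim (inp ! own g) \<and> mem st GenX g = fst (grd g) \<and>
        mem st GenY g = snd (grd g) \<and> mem st Own g = own g)"

definition rels_done :: "nat \<Rightarrow> ram \<Rightarrow> bool" where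
  "rels_done b st \<longleftrightarrow> regs st numRel = b \<and>
     (\<forall>r<b. mem st RelDeg r = sdim (inp ! own (lower r)) \<and>
        (mem st RelX r, mem st RelY r) = sup (grd (lower r)) (grd (Suc (lower r))) \<and>
        mem st P1Row (2 * r) = lower r \<and> mem st P1Row (Suc (2 * r)) = Suc (lower r) \<and>
        mem st RelOf (lower r) = r) \<and>
     (\<forall>r\<le>b. mem st P1Ptr r = 2 * r)"

lemma step1_correct:
  assumes "input_state st"
  shows "wp step1 (\<lambda>st' t. gens_done nG st' \<and> rels_done nR st' \<and> t \<le> 200 * (nG + 1)) st"
proof -
  define body where "body =
    (gen \<leftarrow> GPtr\<langle>V simp\<rangle> .+ V pos;;
         GenDeg\<langle>V gen\<rangle> \<Leftarrow> SDim\<langle>V simp\<rangle>;;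
         GenX\<langle>V gen\<rangle> \<Leftarrow> GX\<langle>V gen\<rangle>;;
         GenY\<langle>V gen\<rangle> \<Leftarrow> GY\<langle>V gen\<rangle>;;
         Own\<langle>V gen\<rangle> \<Leftarrow> V simp;;
         numGen \<leftarrow> V numGen .+ N 1;;
         IF V pos .+ N 1 .< GLen\<langle>V simp\<rangle> THEN (
           RelDeg\<langle>V numRel\<rangle> \<Leftarrow> SDim\<langle>V simp\<rangle>;;
           RelX\<langle>V numRel\<rangle> \<Leftarrow> emax (GX\<langle>V gen\<rangle>) (GX\<langle>V gen .+ N 1\<rangle>);;
           RelY\<langle>V numRel\<rangle> \<Leftarrow> emax (GY\<langle>V gen\<rangle>) (GY\<langle>V gen .+ N 1\<rangle>);;
           P1Row\<langle>N 2 .* V numRel\<rangle> \<Leftarrow> V gen;;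
           P1Row\<langle>N 2 .* V numRel .+ N 1\<rangle> \<Leftarrow> V gen .+ N 1;;
           P1Ptr\<langle>V numRel .+ N 1\<rangle> \<Leftarrow> N 2 .* V numRel .+ N 2;;
           RelOf\<langle>V gen\<rangle> \<Leftarrow> V numRel;;
           numRel \<leftarrow> V numRel .+ N 1)
         ELSE SKIP)"
  \<comment> \<open>After \<open>j\<close> grades of a simplex there are
    \<open>min j (rlen s)\<close> relations: every grade except the last opens one.\<close>
  define inv where "inv s j st1 \<longleftrightarrow> input_state st1 \<and> gens_done (gix s j) st1 \<and>
    rels_done (offset rlen s + min j (rlen s)) st1" for s j st1
  have body: "wp body (\<lambda>st2 t. inv s (Suc j) st2 \<and> t \<le> 100) st1"
    if s: "s < m" and j: "j < glen s" and inv: "inv s j st1"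
      and regs: "regs st1 simp = s" "regs st1 pos = j" for s j st1
  proof -
    have inp: "mem st1 SDim s = sdim (inp ! s)" "mem st1 GPtr s = offset glen s" "mem st1 GLen s = glen s"
      using inv s by (auto simp: inv_def input_state_def)
    have grd: "mem st1 GX g = fst (grd g)" "mem st1 GY g = snd (grd g)" if "g < nG" for g
      using inv that by (auto simp: inv_def input_state_def)
    have g: "gix s j < nG" using gix_less s j .
    have ng: "gens_done (gix s j) st1" and nr: "rels_done (rix s j) st1"
      using inv j by (auto simp: inv_def min_absorb1)
    have pres: "input_state st2" if "frame body st1 st2" for st2
      using inv that by (intro input_state_frame[of st1 body st2]) (auto simp: inv_def body_def)
    show ?thesis
    proof (cases "Suc j < glen s")
      case True
      have r: "rix s j < nR" "lower (rix s j) = gix s j" using s True rix_less[of s j] by auto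
      have gS: "Suc (gix s j) < nG" using lower_less(1)[OF r(1)] r(2) by simp
      have lt: "lower r < gix s j" if "r < rix s j" for r
        using lower_strict_mono[OF that r(1)] r(2) by simp
      have "wp body (\<lambda>st2 t. gens_done (Suc (gix s j)) st2 \<and> rels_done (Suc (rix s j)) st2 \<and> t \<le> 100) st1"
        using True
      proof (simp add: body_def wp_Seq wp_Cond regs inp emax_def cong del: if_weak_cong, intro conjI,
          goal_cases)
        case 1
        then show ?case using ng g s j by (auto simp: gens_done_def less_Suc_eq grd)
      next
        case 2
        have sup: "sup (grd (gix s j)) (grd (Suc (gix s j))) =
          (mem st1 GX (gix s j) + (mem st1 GX (Suc (gix s j)) - mem st1 GX (gix s j)),
           mem st1 GY (gix s j) + (mem st1 GY (Suc (gix s j)) - mem st1 GY (gix s j)))"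
          using g gS by (auto simp: grd prod_eq_iff fst_sup snd_sup sup_max max_def)
        \<comment> \<open>The two entries of a column of \<open>p1\<close> go to an even and the
          following odd cell. This parity fact, in the form in which the simplifier leaves the
          indices, shows that the stores do not collide.\<close>
        have odd: "Suc (2 * r) \<noteq> 2 * a + 2 * b" for r a b :: nat by presburger
        show ?case
          unfolding rels_done_def
        proof (intro conjI allI impI, goal_cases)
          case (2 q) then show ?case using nr s j r by (auto simp: rels_done_def less_Suc_eq)
        next
          case (3 q) then show ?case using nr sup r by (auto simp: rels_done_def less_Suc_eq)
        next
          case (6 q) then show ?case using nr r lt[of q] by (auto simp: rels_done_def less_Suc_eq)
        qed (use nr r odd in \<open>auto simp: rels_done_def less_Suc_eq le_Suc_eq\<close>)
      qed
      then show ?thesis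
        by (rule wp_conseq) (use True in \<open>auto simp: inv_def intro: pres\<close>)
    next
      case False
      have "wp body (\<lambda>st2 t. gens_done (Suc (gix s j)) st2 \<and> rels_done (rix s j) st2 \<and> t \<le> 100) st1"
        using False
      proof (simp add: body_def wp_Seq wp_Cond regs inp emax_def cong del: if_weak_cong, intro conjI,
          goal_cases)
        case 1
        then show ?case using ng g s j by (auto simp: gens_done_def less_Suc_eq grd)
      next
        case 2
        then show ?case using nr by (auto simp: rels_done_def)
      qed
      moreover have "min (Suc j) (rlen s) = j" using False j by simp
      ultimately show ?thesis
        by (auto elim!: wp_conseq intro: pres simp: inv_def)
    qed
  qed
  have inner: "wp (FOR pos FROM N 0 TO GLen\<langle>V simp\<rangle> DO body)
      (\<lambda>st2 t. inv s (glen s) st2 \<and> t \<le> 101 * glen s + 5) st1"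
    if s: "s < m" and "inv s 0 st1" "regs st1 simp = s" for s st1
  proof -
    have *: "mem st1 GLen s = glen s" using that by (auto simp: inv_def input_state_def)
    show ?thesis
    proof (rule wp_For[where Inv = "\<lambda>j st2 t. inv s j st2 \<and> t \<le> 101 * j + 5"], goal_cases)
      case 1
      then show ?case using that by simp
    next
      case (2 j st2 t)
      have "inv s j (set_reg pos j st2)"
        using 2 by (auto simp: inv_def input_state_def gens_done_def rels_done_def)
      moreover have "regs st2 simp = s"
        using that frame_regs[OF 2(4), of simp] by (simp add: body_def)
      ultimately show ?case
        using 2 * that by (intro wp_conseq[OF body[of s j]]) auto
    qed (use that * in auto)
  qed
  have fold_body: "step1 = (numGen \<leftarrow> N 0;; numRel \<leftarrow> N 0;; P1Ptr\<langle>N 0\<rangle> \<Leftarrow> N 0;;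
     FOR simp FROM N 0 TO V numSimp DO FOR pos FROM N 0 TO GLen\<langle>V simp\<rangle> DO body)"
    by (simp add: step1_def body_def)
  have outer: "wp (FOR simp FROM N 0 TO V numSimp DO FOR pos FROM N 0 TO GLen\<langle>V simp\<rangle> DO body)
      (\<lambda>st2 t. gens_done nG st2 \<and> rels_done nR st2 \<and> t \<le> 101 * nG + 6 * m + 5) st1"
    if "inv 0 0 st1" for st1
  proof -
    have *: "regs st1 numSimp = m" using that by (auto simp: inv_def input_state_def)
    show ?thesis
    proof (rule wp_For[where Inv = "\<lambda>s st2 t. inv s 0 st2 \<and> t \<le> 101 * offset glen s + 6 * s + 5"],
        goal_cases)
      case (2 s st2 t)
      have "inv s 0 (set_reg simp s st2)"
        using 2 by (auto simp: inv_def input_state_def gens_done_def rels_done_def)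
      then show ?case
        using 2 * glen_pos[of s]
        by (intro wp_conseq[OF inner[of s]]) (auto simp: inv_def min_absorb2)
    qed (use that * in \<open>auto simp: inv_def\<close>)
  qed
  have "inv 0 0 (set_mem P1Ptr 0 0 (set_reg numRel 0 (set_reg numGen 0 st)))"
    using assms by (auto simp: inv_def input_state_def gens_done_def rels_done_def)
  from outer[OF this] show ?thesis
    unfolding fold_body wp_Seq using m_le_nG by (auto elim!: wp_conseq)
qed

end


section \<open>Counting sort\<close>

text \<open>The target of item \<open>l\<close> in a stable sort of \<open>n\<close> items by the
  key \<open>k\<close>: smaller keys come before it, and so do equal keys that appear
  earlier.\<close>

definition rank :: "nat \<Rightarrow> (nat \<Rightarrow> nat) \<Rightarrow> nat \<Rightarrow> nat" where
  "rank n k l = card {i. i < n \<and> k i < k l} + card {i. i < l \<and> k i = k l}"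

lemma card_less_Suc_filter:
  "card {i. i < Suc n \<and> P i} = card {i. i < n \<and> P i} + (if P n then 1 else 0)"
proof -
  have "{i. i < Suc n \<and> P i} = (if P n then insert n {i. i < n \<and> P i} else {i. i < n \<and> P i})"
    by (auto simp: less_Suc_eq)
  then show ?thesis by simp
qed

lemma card_key_less_Suc:
  fixes k :: "nat \<Rightarrow> nat"
  shows "card {i. i < n \<and> k i < Suc b} = card {i. i < n \<and> k i < b} + card {i. i < n \<and> k i = b}"
  by (subst card_Un_disjoint[symmetric]) (auto simp: less_Suc_eq intro: arg_cong[where f = card])

lemma rank_less_card_le:
  assumes "l < n"
  shows "rank n k l < card {i. i < n \<and> k i < Suc (k l)}"
proof -
  have "card {i. i < l \<and> k i = k l} < card {i. i < n \<and> k i = k l}"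
    by (rule psubset_card_mono) (use assms in auto)
  then show ?thesis by (simp add: rank_def card_key_less_Suc)
qed

lemma rank_less:
  assumes "l < n" "k l < k l' \<or> k l = k l' \<and> l < l'"
  shows "rank n k l < rank n k l'"
proof (cases "k l < k l'")
  case True
  have "card {i. i < n \<and> k i < Suc (k l)} \<le> card {i. i < n \<and> k i < k l'}"
    by (rule card_mono) (use True in auto)
  then show ?thesis using rank_less_card_le[OF assms(1), of k] by (simp add: rank_def)
next
  case False
  then have "card {i. i < l \<and> k i = k l} < card {i. i < l' \<and> k i = k l'}"
    by (intro psubset_card_mono) (use assms in auto)
  then show ?thesis using False assms by (auto simp: rank_def)
qed

lemma rank_less_iff:
  assumes "l < n" "l' < n"
  shows "rank n k l < rank n k l' \<longleftrightarrow> k l < k l' \<or> k l = k l' \<and> l < l'"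
  using rank_less[of l n k l'] rank_less[of l' n k l] assms
  by (cases "k l" "k l'" rule: linorder_cases; cases l l' rule: linorder_cases; auto)

lemma bij_betw_rank: "bij_betw (rank n k) {..<n} {..<n}"
proof -
  have "inj_on (rank n k) {..<n}"
  proof (rule inj_onI)
    fix l l' assume "l \<in> {..<n}" "l' \<in> {..<n}" "rank n k l = rank n k l'"
    then show "l = l'"
      using rank_less[of l n k l'] rank_less[of l' n k l]
      by (metis lessThan_iff less_irrefl linorder_neqE_nat)
  qed
  moreover have "rank n k ` {..<n} \<subseteq> {..<n}"
  proof (rule image_subsetI)
    fix l assume "l \<in> {..<n}"
    then have "rank n k l < card {i. i < n \<and> k i < Suc (k l)}" by (simp add: rank_less_card_le)
    also have "\<dots> \<le> card {..<n}" by (rule card_mono) auto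
    finally show "rank n k l \<in> {..<n}" by simp
  qed
  ultimately show ?thesis
    by (simp add: bij_betw_def endo_inj_surj)
qed

text \<open>Agreement outside the arrays and registers that the sort itself changes. A key has to
  evaluate correctly in exactly such states, since it is read while the sort is running.\<close>

definition key_env :: "ram \<Rightarrow> ram \<Rightarrow> bool" where
  "key_env st st' \<longleftrightarrow> (\<forall>a. a \<notin> {Count, Temp, Order} \<longrightarrow> mem st' a = mem st a) \<and>
     (\<forall>r. r \<notin> {bucket, idx, gen} \<longrightarrow> regs st' r = regs st r)"

lemma key_env_set_reg [simp]: "r \<in> {bucket, idx, gen} \<Longrightarrow> key_env st (set_reg r v st') = key_env st st'"
  by (auto simp: key_env_def)

lemma key_env_set_mem [simp]: "a \<in> {Count, Temp, Order} \<Longrightarrow> key_env st (set_mem a i v st') = key_env st st'"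
  by (auto simp: key_env_def)

text \<open>Once the prefix sums are formed, \<open>Count b\<close> is the first position for key
  \<open>b\<close>, and placing an item advances it; hence item \<open>l\<close> finds
  \<open>rank n k l\<close> there. The bound 6 is the evaluation time of a radix digit, the most
  expensive key in use.\<close>

lemma counting_sort_correct:
  assumes n: "regs st numGen = n" and R: "regs st radix = R" and key_time: "eval_time key \<le> 6"
    and key: "\<And>st' l. key_env st st' \<Longrightarrow> l < n \<Longrightarrow> regs st' gen = mem st Order l \<Longrightarrow> eval key st' = k l"
    and key_less: "\<And>l. l < n \<Longrightarrow> k l < R"
  shows "wp (counting_sort key) (\<lambda>st' t. (\<forall>l<n. mem st' Order (rank n k l) = mem st Order l) \<and>
    t \<le> 100 * (n + R + 1)) st"
proof -
  have env: "regs st' numGen = n" "regs st' radix = R" if "key_env st st'" for st'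
    using that n R by (auto simp: key_env_def)
  have loop1: "wp (FOR bucket FROM N 0 TO V radix .+ N 1 DO Count\<langle>V bucket\<rangle> \<Leftarrow> N 0)
      (\<lambda>st2 t. key_env st st2 \<and> mem st2 Order = mem st Order \<and> (\<forall>b<Suc R. mem st2 Count b = 0) \<and>
        t \<le> 10 * R + 20) st1"
    if "key_env st st1" "mem st1 Order = mem st Order" for st1
    by (rule wp_For[where Inv = "\<lambda>i st2 t. key_env st st2 \<and> mem st2 Order = mem st Order \<and>
        (\<forall>b<i. mem st2 Count b = 0) \<and> t \<le> 10 * i + 10"])
      (use that env in \<open>auto simp: less_Suc_eq\<close>)
  \<comment> \<open>The histogram is shifted by one cell and cell 0 stays 0. The prefix sums
    therefore count the keys strictly below \<open>b\<close>, which is the start of bucket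
    \<open>b\<close>.\<close>
  have loop2: "wp (FOR idx FROM N 0 TO V numGen DO (
       gen \<leftarrow> Order\<langle>V idx\<rangle>;;
       Count\<langle>key .+ N 1\<rangle> \<Leftarrow> Count\<langle>key .+ N 1\<rangle> .+ N 1))
      (\<lambda>st2 t. key_env st st2 \<and> mem st2 Order = mem st Order \<and> mem st2 Count 0 = 0 \<and>
        (\<forall>b<R. mem st2 Count (Suc b) = card {l. l < n \<and> k l = b}) \<and> t \<le> 30 * n + 10) st1"
    if "key_env st st1" "mem st1 Order = mem st Order" "\<forall>b<Suc R. mem st1 Count b = 0" for st1
    by (rule wp_For[where Inv = "\<lambda>i st2 t. key_env st st2 \<and> mem st2 Order = mem st Order \<and>
        mem st2 Count 0 = 0 \<and>
        (\<forall>b<R. mem st2 Count (Suc b) = card {l. l < i \<and> k l = b}) \<and> t \<le> 30 * i + 10"])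
      (use that env key_time in \<open>auto simp: card_less_Suc_filter wp_Seq key\<close>)
  have loop3: "wp (FOR bucket FROM N 0 TO V radix DO
       Count\<langle>V bucket .+ N 1\<rangle> \<Leftarrow> Count\<langle>V bucket .+ N 1\<rangle> .+ Count\<langle>V bucket\<rangle>)
      (\<lambda>st2 t. key_env st st2 \<and> mem st2 Order = mem st Order \<and>
        (\<forall>b\<le>R. mem st2 Count b = card {l. l < n \<and> k l < b}) \<and> t \<le> 20 * R + 10) st1"
    if "key_env st st1" "mem st1 Order = mem st Order" "mem st1 Count 0 = 0"
      "\<forall>b<R. mem st1 Count (Suc b) = card {l. l < n \<and> k l = b}" for st1
    \<comment> \<open>Cells up to \<open>i\<close> already hold prefix sums, while the later ones
      still hold the shifted histogram.\<close>
    by (rule wp_For[where Inv = "\<lambda>i st2 t. key_env st st2 \<and> mem st2 Order = mem st Order \<and>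
        (\<forall>b\<le>i. mem st2 Count b = card {l. l < n \<and> k l < b}) \<and>
        (\<forall>b\<ge>i. b < R \<longrightarrow> mem st2 Count (Suc b) = card {l. l < n \<and> k l = b}) \<and> t \<le> 20 * i + 10"])
      (use that env in \<open>auto simp: card_key_less_Suc le_Suc_eq\<close>)
  have loop4: "wp (FOR idx FROM N 0 TO V numGen DO (
       gen \<leftarrow> Order\<langle>V idx\<rangle>;;
       Temp\<langle>Count\<langle>key\<rangle>\<rangle> \<Leftarrow> V gen;;
       Count\<langle>key\<rangle> \<Leftarrow> Count\<langle>key\<rangle> .+ N 1))
      (\<lambda>st2 t. key_env st st2 \<and> (\<forall>l<n. mem st2 Temp (rank n k l) = mem st Order l) \<and>
        t \<le> 40 * n + 10) st1"
    if "key_env st st1" "mem st1 Order = mem st Order"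
      "\<forall>b\<le>R. mem st1 Count b = card {l. l < n \<and> k l < b}" for st1
  \<comment> \<open>\<open>Count b\<close> is the start of bucket \<open>b\<close> plus the number
    of items already placed in it. For the next item this sum is its rank by definition, and ranks
    are distinct, so no cell of \<open>Temp\<close> is written twice.\<close>
  proof (rule wp_For[where Inv = "\<lambda>i st2 t. key_env st st2 \<and> mem st2 Order = mem st Order \<and>
        (\<forall>b<R. mem st2 Count b = card {l. l < n \<and> k l < b} + card {l. l < i \<and> k l = b}) \<and>
        (\<forall>l<i. mem st2 Temp (rank n k l) = mem st Order l) \<and> t \<le> 40 * i + 10"], goal_cases)
    case (2 i st2 t)
    then have i: "i < n" using env that by simp
    have "mem st2 Count (k i) = rank n k i"
      using 2 key_less[OF i] by (simp add: rank_def)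
    moreover have "rank n k l \<noteq> rank n k i" if "l < i" for l
      using that i rank_less_iff[of l n i k] rank_less_iff[of i n l k] by auto
    ultimately show ?case
      using 2 i key_time key_less[OF i]
      by (auto simp: card_less_Suc_filter wp_Seq key All_less_Suc)
  qed (use that env in auto)
  have loop5: "wp (FOR idx FROM N 0 TO V numGen DO Order\<langle>V idx\<rangle> \<Leftarrow> Temp\<langle>V idx\<rangle>)
      (\<lambda>st2 t. (\<forall>l<n. mem st2 Order (rank n k l) = mem st Order l) \<and> t \<le> 10 * n + 10) st1"
    if "key_env st st1" "\<forall>l<n. mem st1 Temp (rank n k l) = mem st Order l" for st1
    by (rule wp_For[where Inv = "\<lambda>i st2 t. mem st2 Temp = mem st1 Temp \<and>
        (\<forall>q<i. mem st2 Order q = mem st1 Temp q) \<and> t \<le> 10 * i + 10"])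
      (use that env bij_betwE[OF bij_betw_rank[of n k]] in \<open>auto simp: less_Suc_eq\<close>)
  show ?thesis
    unfolding counting_sort_def
    apply (rule wp_SeqI[OF loop1])
      apply (simp add: key_env_def)
     apply simp
    apply (rule wp_SeqI[OF loop2], (auto)[3])
    apply (rule wp_SeqI[OF loop3], (auto)[4])
    apply (rule wp_SeqI[OF loop4], (auto)[3])
    apply (rule wp_conseq[OF loop5], auto)
    done
qed

lemma bij_betw_reorder:
  assumes "bij_betw f {..<n} A" and "\<forall>l<n. g (rank n k l) = f l"
  shows "bij_betw g {..<n} A"
proof -
  have "bij_betw (g \<circ> rank n k) {..<n} A"
    using assms by (subst bij_betw_cong[where g = f]) auto
  then show ?thesis using bij_betw_comp_iff[OF bij_betw_rank] by blast
qed

text \<open>Stability: whatever held between earlier and later items survives as the tie-break of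
  the new key. This is the induction step of radix sort.\<close>

lemma sorted_reorder:
  assumes "\<forall>l<n. g (rank n k l) = f l" and "\<And>i j. i < j \<Longrightarrow> j < n \<Longrightarrow> P (f i) (f j)"
    and "\<And>l. l < n \<Longrightarrow> k l = \<kappa> (f l)" and "i < j" and "j < n"
  shows "\<kappa> (g i) < \<kappa> (g j) \<or> \<kappa> (g i) = \<kappa> (g j) \<and> P (g i) (g j)"
proof -
  obtain l l' where l: "l < n" "l' < n" "i = rank n k l" "j = rank n k l'"
    using bij_betw_imp_surj_on[OF bij_betw_rank[of n k]] assms(4,5)
    by (metis imageE lessThan_iff less_trans)
  then show ?thesis using assms rank_less_iff[of l n l' k] by auto
qed


section \<open>Step 2\<close>

context path_input
begin

text \<open>The facts established by the end of Step 1 on which the rest relies; none of the arrays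
  and registers involved is written afterwards.\<close>

definition ready :: "ram \<Rightarrow> bool" where
  "ready st \<longleftrightarrow> input_state st \<and> gens_done nG st"

lemma ready_frame:
  assumes "ready st" and "frame c st st'" and "\<not> assigns c numSimp" "\<not> assigns c numGen"
    and "\<not> writes c SDim" "\<not> writes c GPtr" "\<not> writes c GLen" "\<not> writes c GX" "\<not> writes c GY"
      "\<not> writes c FPtr" "\<not> writes c FLen" "\<not> writes c Fac"
      "\<not> writes c GenDeg" "\<not> writes c GenX" "\<not> writes c GenY" "\<not> writes c Own"
  shows "ready st'"
proof -
  have "input_state st'" using assms by (auto simp: ready_def intro: input_state_frame)
  then show ?thesis
    using assms(1) unfolding ready_def gens_done_def
    by (simp add: assms(3-) frame_mem[OF assms(2)] frame_regs[OF assms(2)])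
qed

lemma ready_set_reg [simp]: "r \<notin> {numSimp, numGen} \<Longrightarrow> ready (set_reg r v st) = ready st"
  by (auto simp: ready_def input_state_def gens_done_def)

lemma ready_set_mem [simp]:
  "a \<notin> {SDim, GPtr, GLen, GX, GY, FPtr, FLen, Fac, GenDeg, GenX, GenY, Own} \<Longrightarrow>
    ready (set_mem a i v st) = ready st"
  by (auto simp: ready_def input_state_def gens_done_def)

lemma ready_regs:
  assumes "ready st"
  shows "regs st numSimp = m" "regs st numGen = nG"
  using assms by (auto simp: ready_def input_state_def gens_done_def)

lemma ready_simplex:
  assumes "ready st" and "s < m"
  shows "mem st SDim s = sdim (inp ! s)" "mem st GPtr s = offset glen s" "mem st GLen s = glen s"
    "mem st FPtr s = offset flen s" "mem st FLen s = flen s"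
    "p < flen s \<Longrightarrow> mem st Fac (offset flen s + p) = facets (inp ! s) ! p"
  using assms by (auto simp: ready_def input_state_def gens_done_def)

lemma ready_gen:
  assumes "ready st" and "g < nG"
  shows "mem st GenDeg g = sdim (inp ! own g)" "mem st GenX g = fst (grd g)"
    "mem st GenY g = snd (grd g)" "mem st Own g = own g"
  using assms by (auto simp: ready_def input_state_def gens_done_def)

abbreviation f0off :: "nat \<Rightarrow> nat" where "f0off \<equiv> offset (\<lambda>g. flen (own g))"

definition columns_ready :: "ram \<Rightarrow> bool" where
  "columns_ready st \<longleftrightarrow> ready st \<and> (\<forall>g\<le>nG. mem st F0Ptr g = f0off g)"

lemma f0_columns_correct:
  assumes "ready st"
  shows "wp f0_columns (\<lambda>st' t. columns_ready st' \<and> t \<le> 20 * nG + 20) st"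
proof -
  have "wp (FOR gen FROM N 0 TO V numGen DO
       F0Ptr\<langle>V gen .+ N 1\<rangle> \<Leftarrow> F0Ptr\<langle>V gen\<rangle> .+ FLen\<langle>Own\<langle>V gen\<rangle>\<rangle>)
     (\<lambda>st' t. columns_ready st' \<and> t \<le> 20 * nG + 10) st1"
    if "ready st1" "mem st1 F0Ptr 0 = 0" for st1
    by (rule wp_For[where Inv = "\<lambda>i st2 t. ready st2 \<and> (\<forall>g\<le>i. mem st2 F0Ptr g = f0off g) \<and> t \<le> 20 * i + 10"])
      (use that in \<open>auto simp: ready_regs ready_gen ready_simplex own_less le_Suc_eq columns_ready_def\<close>)
  from this[of "set_mem F0Ptr 0 0 st"] show ?thesis
    using assms by (auto simp: f0_columns_def wp_Seq elim!: wp_conseq)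
qed

text \<open>It demands a valid choice but no particular one, since sweep and scan may pick different
  grades. Entry \<open>p\<close> belongs to facet \<open>p\<close>, and this alignment later allows
  the choice function to be read off from memory.\<close>

definition column_done :: "ram \<Rightarrow> nat \<Rightarrow> bool" where
  "column_done st g \<longleftrightarrow> (\<forall>p<flen (own g). mem st F0Row (f0off g + p) < nG \<and>
     own (mem st F0Row (f0off g + p)) = facets (inp ! own g) ! p \<and>
     grd (mem st F0Row (f0off g + p)) \<le> grd g)"

lemma f0off_other:
  assumes "g \<noteq> g'" and "p < flen (own g')"
  shows "f0off g' + p < f0off g \<or> f0off g + flen (own g) \<le> f0off g' + p"
proof (cases "g < g'")
  case True
  then show ?thesis using offset_mono[of "Suc g" g' "\<lambda>g. flen (own g)"] by simp
next
  case False
  then show ?thesis using offset_add_less[of g' g p "\<lambda>g. flen (own g)"] assms by simp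
qed

lemma column_done_other:
  assumes "column_done st g'" and "g \<noteq> g'"
    and "\<And>q. q < f0off g \<or> f0off g + flen (own g) \<le> q \<Longrightarrow> mem st' F0Row q = mem st F0Row q"
  shows "column_done st' g'"
  using assms(1) f0off_other[OF assms(2)] assms(3) by (simp add: column_done_def)

lemma facet_gen:
  assumes "g < nG" and "\<tau> \<in> set (facets (inp ! own g))"
  obtains w where "w < nG" "own w = \<tau>" "grd w \<le> grd g"
proof -
  obtain s j where g: "s < m" "j < glen s" "g = gix s j" using gen_cases[OF assms(1)] .
  then obtain i where "i < glen \<tau>" "grades (inp ! \<tau>) ! i \<le> grades (inp ! s) ! j"
    using facet_grade[of s \<tau> j] assms by auto
  moreover have "\<tau> < m" using facets_less g assms by simp
  ultimately show ?thesis using that[of "gix \<tau> i"] g gix_less by simp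
qed

lemma grd_antichain:
  assumes "w < nG" "z < nG" "own w = own z" and "fst (grd z) \<le> fst (grd w)"
  shows "snd (grd w) \<le> snd (grd z)"
proof -
  obtain s j where w: "s < m" "j < glen s" "w = gix s j" using gen_cases[OF assms(1)] .
  obtain s' j' where z: "s' < m" "j' < glen s'" "z = gix s' j'" using gen_cases[OF assms(2)] .
  have s: "s' = s" using w z assms(3) by simp
  show ?thesis
    using grades_antichain[of s j j'] grades_antichain[of s j' j] w z s assms(4)
    by (cases j j' rule: linorder_cases) auto
qed


subsection \<open>Sweep\<close>

definition sweep_order :: "ram \<Rightarrow> bool" where
  "sweep_order st \<longleftrightarrow> bij_betw (mem st Order) {..<nG} {..<nG} \<and>
     (\<forall>j<nG. \<forall>i<j. fst (grd (mem st Order i)) < fst (grd (mem st Order j)) \<or>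
        fst (grd (mem st Order i)) = fst (grd (mem st Order j)) \<and>
        sdim (inp ! own (mem st Order i)) \<le> sdim (inp ! own (mem st Order j)))"

text \<open>The sort restated for a permutation of the generators, with \<open>P\<close> as the
  order reached so far. The bound on \<open>R\<close> makes every pass cost a multiple of
  \<open>nG + 1\<close>.\<close>

lemma counting_sort_order:
  assumes "ready st" and bij: "bij_betw (mem st Order) {..<nG} {..<nG}"
    and R: "regs st radix = R" "R \<le> nG + 1" and key_time: "eval_time key \<le> 6"
    and key: "\<And>st'. key_env st st' \<Longrightarrow> regs st' gen < nG \<Longrightarrow> eval key st' = \<kappa> (regs st' gen)"
    and key_less: "\<And>g. g < nG \<Longrightarrow> \<kappa> g < R"
    and P: "\<And>i j. i < j \<Longrightarrow> j < nG \<Longrightarrow> P (mem st Order i) (mem st Order j)"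
  shows "wp (counting_sort key) (\<lambda>st' t. bij_betw (mem st' Order) {..<nG} {..<nG} \<and>
    (\<forall>j<nG. \<forall>i<j. \<kappa> (mem st' Order i) < \<kappa> (mem st' Order j) \<or>
       \<kappa> (mem st' Order i) = \<kappa> (mem st' Order j) \<and> P (mem st' Order i) (mem st' Order j)) \<and>
    t \<le> 200 * (nG + 1)) st"
proof -
  define k where "k l = \<kappa> (mem st Order l)" for l
  have "wp (counting_sort key) (\<lambda>st' t. (\<forall>l<nG. mem st' Order (rank nG k l) = mem st Order l) \<and>
    t \<le> 100 * (nG + R + 1)) st"
    using assms(1) R key_time key key_less bij_betwE[OF bij]
    by (intro counting_sort_correct) (auto simp: ready_regs k_def)
  then show ?thesis
  proof (rule wp_conseq)
    fix st' t
    assume *: "(\<forall>l<nG. mem st' Order (rank nG k l) = mem st Order l) \<and> t \<le> 100 * (nG + R + 1)"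
    have "\<kappa> (mem st' Order i) < \<kappa> (mem st' Order j) \<or>
         \<kappa> (mem st' Order i) = \<kappa> (mem st' Order j) \<and> P (mem st' Order i) (mem st' Order j)"
      if "i < j" "j < nG" for i j
      by (rule sorted_reorder[where n = nG and k = k and f = "mem st Order"])
        (use * P that in \<open>auto simp: k_def\<close>)
    moreover have "bij_betw (mem st' Order) {..<nG} {..<nG}"
      using bij_betw_reorder[OF bij] * by blast
    ultimately show "bij_betw (mem st' Order) {..<nG} {..<nG} \<and>
      (\<forall>j<nG. \<forall>i<j. \<kappa> (mem st' Order i) < \<kappa> (mem st' Order j) \<or>
         \<kappa> (mem st' Order i) = \<kappa> (mem st' Order j) \<and> P (mem st' Order i) (mem st' Order j)) \<and>
      t \<le> 200 * (nG + 1)"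
      using * R(2) by auto
  qed
qed

text \<open>Some generator \<open>z\<close> of the facet lies below \<open>g\<close>, and
  \<open>z\<close> precedes \<open>g\<close> even if their first coordinates agree, because then the
  smaller dimension wins. Hence \<open>w\<close> comes at or after \<open>z\<close> and before
  \<open>g\<close>; its first coordinate lies between theirs, and the antichain property pushes its
  second coordinate down to at most that of \<open>z\<close>. The hypothesis \<open>last\<close>
  says that \<open>w\<close> is the latest generator of the facet without naming a maximal
  position.\<close>

lemma sweep_choice:
  assumes "ready st" "sweep_order st" and i: "i < nG" "mem st Order i = g"
    and \<tau>: "\<tau> \<in> set (facets (inp ! own g))"
    and last: "\<forall>l<i. own (mem st Order l) = \<tau> \<longrightarrow>
      (\<exists>l'<i. l \<le> l' \<and> own (mem st Order l') = \<tau> \<and> w = mem st Order l')"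
  shows "w < nG \<and> own w = \<tau> \<and> grd w \<le> grd g"
proof -
  define ord where "ord = mem st Order"
  have bij: "bij_betw ord {..<nG} {..<nG}" using assms(2) by (simp add: sweep_order_def ord_def)
  have so: "\<forall>j<nG. \<forall>i<j. fst (grd (ord i)) < fst (grd (ord j)) \<or>
      fst (grd (ord i)) = fst (grd (ord j)) \<and> sdim (inp ! own (ord i)) \<le> sdim (inp ! own (ord j))"
    using assms(2) unfolding sweep_order_def ord_def by (rule conjunct2)
  have sorted: "fst (grd (ord i)) < fst (grd (ord j)) \<or>
      fst (grd (ord i)) = fst (grd (ord j)) \<and> sdim (inp ! own (ord i)) \<le> sdim (inp ! own (ord j))"
    if "i < j" "j < nG" for i j
    using so that by blast
  have less: "ord j < nG" if "j < nG" for j using bij_betwE[OF bij] that by simp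
  have g: "g < nG" "ord i = g" using less i by (auto simp: ord_def)
  obtain z where z: "z < nG" "own z = \<tau>" "grd z \<le> grd g" using facet_gen[OF g(1) \<tau>] .
  have "z \<in> ord ` {..<nG}" using z(1) bij_betw_imp_surj_on[OF bij] by simp
  then obtain l where l: "l < nG" "ord l = z" by auto
  have deg: "sdim (inp ! \<tau>) < sdim (inp ! own g)"
    using sdim_facet \<tau> own_less g(1) by blast
  have "l < i"
  proof (rule ccontr)
    assume "\<not> l < i"
    then have "i < l" using deg z l g by (metis linorder_neqE_nat less_irrefl)
    from sorted[OF this l(1)] show False
      using deg z l g by (auto simp: less_eq_prod_def)
  qed
  then obtain l' where l': "l' < i" "l \<le> l'" "own (ord l') = \<tau>" "w = ord l'"
    using last l z by (auto simp: ord_def)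
  have "fst (grd w) \<le> fst (grd g)" using sorted[of l' i] l' i g by auto
  moreover have "fst (grd z) \<le> fst (grd w)" using sorted[of l l'] l l' i by (cases "l = l'") auto
  moreover have w: "w < nG" "own w = \<tau>" using less l' i by auto
  ultimately show ?thesis
    using grd_antichain[of w z] z by (auto simp: less_eq_prod_def)
qed

text \<open>Least significant digit first: after \<open>p\<close> passes the order is by first
  coordinate modulo \<open>(nG + 1) ^ p\<close>, with ties broken by dimension. For
  \<open>p = 0\<close> only the dimension counts, and after \<open>dg\<close> passes the modulus
  exceeds all coordinates.\<close>

lemma radix_sort_correct:
  assumes "ready st" "regs st radix = nG + 1" "regs st digits = dg"
    and dg: "\<And>g. g < nG \<Longrightarrow> fst (grd g) < (nG + 1) ^ dg"
  shows "wp (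
     FOR idx FROM N 0 TO V numGen DO Order\<langle>V idx\<rangle> \<Leftarrow> V idx;;
     counting_sort (GenDeg\<langle>V gen\<rangle>);;
     power \<leftarrow> N 1;;
     FOR pass FROM N 0 TO V digits DO (
       counting_sort (GenX\<langle>V gen\<rangle> ./ V power .% V radix);;
       power \<leftarrow> V power .* V radix))
    (\<lambda>st' t. sweep_order st' \<and> t \<le> 300 * (nG + 1) * (dg + 1)) st"
proof -
  define deg where "deg g = sdim (inp ! own g)" for g
  have loop1: "wp (FOR idx FROM N 0 TO V numGen DO Order\<langle>V idx\<rangle> \<Leftarrow> V idx)
      (\<lambda>st' t. ready st' \<and> bij_betw (mem st' Order) {..<nG} {..<nG} \<and> regs st' radix = nG + 1 \<and>
        regs st' digits = dg \<and> t \<le> 10 * nG + 10) st"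
  proof (rule wp_For[where Inv = "\<lambda>i st2 t. ready st2 \<and> (\<forall>q<i. mem st2 Order q = q) \<and>
        t \<le> 10 * i + 10"], goal_cases)
    case (3 st' t)
    have "bij_betw (mem st' Order) {..<nG} {..<nG}"
      using 3 assms(1) by (subst bij_betw_cong[where g = id]) (auto simp: ready_regs)
    then show ?case
      using 3 assms by (auto simp: ready_regs frame_regs[OF 3(2)])
  qed (use assms in \<open>auto simp: less_Suc_eq ready_regs\<close>)
  have deg_sort: "wp (counting_sort (GenDeg\<langle>V gen\<rangle>))
      (\<lambda>st' t. ready st' \<and> bij_betw (mem st' Order) {..<nG} {..<nG} \<and> regs st' radix = nG + 1 \<and>
        regs st' digits = dg \<and> (\<forall>j<nG. \<forall>i<j. deg (mem st' Order i) \<le> deg (mem st' Order j)) \<and>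
        t \<le> 200 * (nG + 1)) st1"
    if st1: "ready st1" "bij_betw (mem st1 Order) {..<nG} {..<nG}" "regs st1 radix = nG + 1"
      "regs st1 digits = dg" for st1
  proof (rule wp_conseq[OF counting_sort_order[where \<kappa> = deg and R = "nG + 1" and P = "\<lambda>_ _. True"]], goal_cases)
    case (6 st')
    then show ?case using ready_gen[OF st1(1)] by (auto simp: key_env_def deg_def)
  next
    case (7 g)
    \<comment> \<open>Dimensions are at most \<open>nG\<close>, so they fit into the
      \<open>nG + 1\<close> buckets used for the digits.\<close>
    then show ?case using sdim_le[OF own_less, of g] by (auto simp: deg_def offset_def)
  next
    case (9 st' t)
    have "ready st'" using st1(1) by (rule ready_frame[OF _ 9(2)]) (auto simp: counting_sort_def)
    moreover have "regs st' radix = regs st1 radix" "regs st' digits = regs st1 digits"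
      by (rule frame_regs[OF 9(2)]; simp add: counting_sort_def)+
    ultimately show ?case using 9(1) st1 by (auto simp: le_less)
  qed (use st1 in auto)
  have pass_loop: "wp (FOR pass FROM N 0 TO V digits DO (
       counting_sort (GenX\<langle>V gen\<rangle> ./ V power .% V radix);;
       power \<leftarrow> V power .* V radix))
    (\<lambda>st' t. sweep_order st' \<and> t \<le> 210 * (nG + 1) * dg + 10) st1"
    if st1: "ready st1" "bij_betw (mem st1 Order) {..<nG} {..<nG}" "regs st1 radix = nG + 1"
      "regs st1 digits = dg" "\<forall>j<nG. \<forall>i<j. deg (mem st1 Order i) \<le> deg (mem st1 Order j)"
      "regs st1 power = 1" for st1
  proof (rule wp_For[where Inv = "\<lambda>p st2 t. ready st2 \<and> bij_betw (mem st2 Order) {..<nG} {..<nG} \<and>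
      regs st2 radix = nG + 1 \<and> regs st2 power = (nG + 1) ^ p \<and>
      (\<forall>j<nG. \<forall>i<j. fst (grd (mem st2 Order i)) mod (nG + 1) ^ p < fst (grd (mem st2 Order j)) mod (nG + 1) ^ p \<or>
        fst (grd (mem st2 Order i)) mod (nG + 1) ^ p = fst (grd (mem st2 Order j)) mod (nG + 1) ^ p \<and>
        deg (mem st2 Order i) \<le> deg (mem st2 Order j)) \<and> t \<le> 210 * (nG + 1) * p + 10"], goal_cases)
    case (2 p st2 t)
    define X where "X g = fst (grd g)" for g
    have sort: "wp (counting_sort (GenX\<langle>V gen\<rangle> ./ V power .% V radix))
      (\<lambda>st' t. (bij_betw (mem st' Order) {..<nG} {..<nG} \<and>
       (\<forall>j<nG. \<forall>i<j. X (mem st' Order i) div (nG + 1) ^ p mod (nG + 1) < X (mem st' Order j) div (nG + 1) ^ p mod (nG + 1) \<or>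
       X (mem st' Order i) div (nG + 1) ^ p mod (nG + 1) = X (mem st' Order j) div (nG + 1) ^ p mod (nG + 1) \<and>
       (X (mem st' Order i) mod (nG + 1) ^ p < X (mem st' Order j) mod (nG + 1) ^ p \<or>
        X (mem st' Order i) mod (nG + 1) ^ p = X (mem st' Order j) mod (nG + 1) ^ p \<and>
        deg (mem st' Order i) \<le> deg (mem st' Order j))) \<and>
       t \<le> 200 * (nG + 1))) (set_reg pass p st2)"
    proof (rule counting_sort_order[where R = "nG + 1"], goal_cases)
      case (6 st')
      then show ?case using 2 ready_gen[of st2 "regs st' gen"] by (auto simp: key_env_def X_def)
    next
      case (8 i j)
      then show ?case using 2 by (auto simp: X_def)
    qed (use 2 in auto)
    show ?case
    proof (rule wp_SeqI[OF sort], goal_cases)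
      case (1 st3 t3)
      have "ready st3" using 2 by (intro ready_frame[OF _ 1(2)]) (auto simp: counting_sort_def)
      moreover have "regs st3 radix = nG + 1" "regs st3 power = (nG + 1) ^ p"
        using 2 by (simp_all add: frame_regs[OF 1(2)] counting_sort_def)
      moreover have lex: "X a mod (nG + 1) ^ Suc p < X b mod (nG + 1) ^ Suc p \<or>
          X a mod (nG + 1) ^ Suc p = X b mod (nG + 1) ^ Suc p \<and> deg a \<le> deg b"
        if "X a div (nG + 1) ^ p mod (nG + 1) < X b div (nG + 1) ^ p mod (nG + 1) \<or>
          X a div (nG + 1) ^ p mod (nG + 1) = X b div (nG + 1) ^ p mod (nG + 1) \<and>
          (X a mod (nG + 1) ^ p < X b mod (nG + 1) ^ p \<or>
           X a mod (nG + 1) ^ p = X b mod (nG + 1) ^ p \<and> deg a \<le> deg b)" for a b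
      proof -
        define B where "B = (nG + 1) ^ p"
        have B: "0 < B" by (simp add: B_def)
        have mod_eq: "X g mod (nG + 1) ^ Suc p = B * (X g div B mod (nG + 1)) + X g mod B" for g
          using mod_mult2_eq[of "X g" B "nG + 1"] by (simp only: B_def power_Suc mult.commute)
        \<comment> \<open>The new digit dominates: remainders below \<open>B\<close> cannot make up
          for a difference of one in the digit.\<close>
        have "B * u + X a mod B < B * v + X b mod B" if "u < v" for u v
        proof -
          have "B * u + X a mod B < B * Suc u" using B by simp
          also have "\<dots> \<le> B * v" using that by (intro mult_le_mono) auto
          finally show ?thesis by simp
        qed
        then show ?thesis using that unfolding mod_eq B_def[symmetric] by force
      qed
      ultimately show ?case using 1(1) 2(3) unfolding X_def by (auto simp: algebra_simps)
    qed
  next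
    case (3 st' t)
    then show ?case
      using st1 dg bij_betwE[of "mem st' Order" "{..<nG}" "{..<nG}"]
      by (simp add: sweep_order_def deg_def)
  qed (use st1 in auto)
  show ?thesis
    apply (rule wp_SeqI[OF loop1])
    apply (rule wp_SeqI[OF deg_sort], (auto)[4])
    apply (simp add: wp_Seq)
    apply (rule wp_conseq[OF pass_loop], auto simp: algebra_simps)
    done
qed

lemma find_by_sweep_correct:
  assumes "columns_ready st" "regs st radix = nG + 1" "regs st digits = dg"
    and dg: "\<And>g. g < nG \<Longrightarrow> fst (grd g) < (nG + 1) ^ dg"
  shows "wp find_by_sweep (\<lambda>st' t. (\<forall>g<nG. column_done st' g) \<and>
    t \<le> 400 * (nG + 1) * (D + 1) * (dg + 1)) st"
proof -
  define inner where "inner = (FOR pos FROM N 0 TO FLen\<langle>V simp\<rangle> DO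
         F0Row\<langle>F0Ptr\<langle>V gen\<rangle> .+ V pos\<rangle> \<Leftarrow> Last\<langle>Fac\<langle>FPtr\<langle>V simp\<rangle> .+ V pos\<rangle>\<rangle>)"
  have inner: "wp inner (\<lambda>st2 t. columns_ready st2 \<and>
      (\<forall>p<flen (own g). mem st2 F0Row (f0off g + p) = mem st1 Last (facets (inp ! own g) ! p)) \<and>
      (\<forall>q. q < f0off g \<or> f0off g + flen (own g) \<le> q \<longrightarrow> mem st2 F0Row q = mem st1 F0Row q) \<and>
      t \<le> 20 * D + 10) st1"
    if st1: "columns_ready st1" "g < nG" "regs st1 simp = own g" "regs st1 gen = g" for st1 g
  proof -
    have r: "ready st1" "\<And>st2. columns_ready st2 \<Longrightarrow> ready st2" using st1 by (auto simp: columns_ready_def)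
    have s: "own g < m" using own_less st1 by auto
    show ?thesis
      unfolding inner_def
    proof (rule wp_For[where Inv = "\<lambda>i st2 t. columns_ready st2 \<and> regs st2 simp = own g \<and> regs st2 gen = g \<and>
        mem st2 Last = mem st1 Last \<and>
        (\<forall>p<i. mem st2 F0Row (f0off g + p) = mem st1 Last (facets (inp ! own g) ! p)) \<and>
        (\<forall>q. q < f0off g \<or> f0off g + flen (own g) \<le> q \<longrightarrow> mem st2 F0Row q = mem st1 F0Row q) \<and>
        t \<le> 20 * i + 10"], goal_cases)
      case (2 i st2 t)
      then have "i < flen (own g)" "ready st2" using r st1 s by (auto simp: ready_simplex)
      then show ?case
        using 2 s st1(2) by (auto simp: ready_simplex All_less_Suc columns_ready_def)
    next
      case (3 st2 t)
      then show ?case using st1 s r(1) length_facets_le[OF s] by (auto simp: ready_simplex)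
    qed (use st1 in auto)
  qed
  have loop: "wp (FOR idx FROM N 0 TO V numGen DO (
       gen \<leftarrow> Order\<langle>V idx\<rangle>;;
       simp \<leftarrow> Own\<langle>V gen\<rangle>;;
       Last\<langle>V simp\<rangle> \<Leftarrow> V gen;;
       inner)) (\<lambda>st' t. (\<forall>g<nG. column_done st' g) \<and> t \<le> (20 * D + 40) * nG + 10) st1"
    if st1: "columns_ready st1" "sweep_order st1" for st1
  proof -
    define ord where "ord = mem st1 Order"
    have bij: "bij_betw ord {..<nG} {..<nG}" using st1 by (simp add: sweep_order_def ord_def)
    have less: "ord j < nG" if "j < nG" for j using bij_betwE[OF bij] that by simp
    have r: "ready st1" "\<And>st2. columns_ready st2 \<Longrightarrow> ready st2" using st1 by (auto simp: columns_ready_def)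
    show ?thesis
    proof (rule wp_For[where Inv = "\<lambda>i st2 t. columns_ready st2 \<and> mem st2 Order = ord \<and>
        (\<forall>\<tau>. \<forall>l<i. own (ord l) = \<tau> \<longrightarrow>
           (\<exists>l'<i. l \<le> l' \<and> own (ord l') = \<tau> \<and> mem st2 Last \<tau> = ord l')) \<and>
        (\<forall>l<i. column_done st2 (ord l)) \<and> t \<le> (20 * D + 40) * i + 10"], goal_cases)
      case (2 i st2 t)
      define g where "g = ord i"
      have i: "i < nG" using 2 r(1) by (simp add: ready_regs)
      have g: "g < nG" using less i g_def by simp
      have rdy: "ready st2" using 2 r by blast
      define st3 where "st3 = set_mem Last (own g) g (set_reg simp (own g) (set_reg gen g (set_reg idx i st2)))"
      have st3: "columns_ready st3" using 2 by (simp add: st3_def columns_ready_def)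
      have body: "wp inner (\<lambda>st4 t'. columns_ready st4 \<and> mem st4 Order = ord \<and>
        (\<forall>\<tau>. \<forall>l<Suc i. own (ord l) = \<tau> \<longrightarrow>
           (\<exists>l'<Suc i. l \<le> l' \<and> own (ord l') = \<tau> \<and> mem st4 Last \<tau> = ord l')) \<and>
        (\<forall>l<Suc i. column_done st4 (ord l)) \<and> t' \<le> 20 * D + 10) st3"
      proof (rule wp_conseq[OF inner[of st3 g]], goal_cases)
        case (5 st4 t4)
        have last: "mem st4 Last = mem st3 Last" "mem st4 Order = mem st3 Order"
          by (rule frame_mem[OF 5(2)]; simp add: inner_def)+
        \<comment> \<open>\<open>Last\<close> is updated for the simplex of \<open>g\<close> before
          its facets are looked up. No simplex is its own facet, so those lookups still see the
          earlier contents.\<close>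
        have neq: "\<tau> \<noteq> own g" if "\<tau> \<in> set (facets (inp ! own g))" for \<tau>
          using sdim_facet[OF own_less[OF g] that] by auto
        have "column_done st4 g"
          unfolding column_done_def
        proof (intro allI impI)
          fix p assume p: "p < flen (own g)"
          define \<tau> where "\<tau> = facets (inp ! own g) ! p"
          have \<tau>: "\<tau> \<in> set (facets (inp ! own g))" using p by (simp add: \<tau>_def)
          have "mem st4 F0Row (f0off g + p) = mem st2 Last \<tau>"
            using 5 p neq[OF \<tau>] by (simp add: \<tau>_def st3_def)
          moreover have "mem st2 Last \<tau> < nG \<and> own (mem st2 Last \<tau>) = \<tau> \<and> grd (mem st2 Last \<tau>) \<le> grd g"
            using 2(3) i g_def \<tau> st1 r(1) by (intro sweep_choice[of st1 i]) (auto simp: ord_def)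
          ultimately show "mem st4 F0Row (f0off g + p) < nG \<and>
            own (mem st4 F0Row (f0off g + p)) = facets (inp ! own g) ! p \<and>
            grd (mem st4 F0Row (f0off g + p)) \<le> grd g" by (simp add: \<tau>_def)
        qed
        moreover have "column_done st4 (ord l)" if "l < i" for l
        proof (rule column_done_other[of st2 _ g])
          show "g \<noteq> ord l"
            using that i inj_onD[OF bij_betw_imp_inj_on[OF bij], of i l] by (auto simp: g_def)
        qed (use 2 5 that in \<open>auto simp: st3_def\<close>)
        ultimately have cols: "\<forall>l<Suc i. column_done st4 (ord l)" by (auto simp: less_Suc_eq g_def)
        have "\<exists>l'<Suc i. l \<le> l' \<and> own (ord l') = \<tau> \<and> mem st4 Last \<tau> = ord l'"
          if l: "l < Suc i" "own (ord l) = \<tau>" for l \<tau>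
        proof (cases "own g = \<tau>")
          case True
          then show ?thesis using l by (auto simp: last st3_def g_def intro!: exI[of _ i])
        next
          case False
          then have "l < i" using l by (auto simp: less_Suc_eq g_def)
          then obtain l' where "l' < i" "l \<le> l'" "own (ord l') = \<tau>" "mem st2 Last \<tau> = ord l'"
            using 2 l by blast
          then show ?thesis using False by (auto simp: last st3_def intro!: exI[of _ l'])
        qed
        then show ?case using 5 cols 2 by (auto simp: last st3_def)
      qed (use st3 g in \<open>simp_all add: st3_def\<close>)
      show ?case
        using 2 g ready_gen(4)[OF rdy g] wp_conseq[OF body]
        by (auto simp: wp_Seq st3_def[symmetric] g_def[symmetric] algebra_simps elim!: wp_conseq)
    next
      case (3 st2 t)
      have "column_done st2 g" if "g < nG" for g
      proof -
        have "g \<in> ord ` {..<nG}" using that bij_betw_imp_surj_on[OF bij] by simp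
        then show ?thesis using 3 r(1) by (auto simp: ready_regs)
      qed
      then show ?case using 3 r(1) by (simp add: ready_regs)
    qed (use st1 in \<open>auto simp: ord_def\<close>)
  qed
  have "wp ((FOR idx FROM N 0 TO V numGen DO Order\<langle>V idx\<rangle> \<Leftarrow> V idx;;
     counting_sort (GenDeg\<langle>V gen\<rangle>);;
     power \<leftarrow> N 1;;
     FOR pass FROM N 0 TO V digits DO (
       counting_sort (GenX\<langle>V gen\<rangle> ./ V power .% V radix);;
       power \<leftarrow> V power .* V radix));;
    FOR idx FROM N 0 TO V numGen DO (
       gen \<leftarrow> Order\<langle>V idx\<rangle>;;
       simp \<leftarrow> Own\<langle>V gen\<rangle>;;
       Last\<langle>V simp\<rangle> \<Leftarrow> V gen;;
       inner)) (\<lambda>st' t. (\<forall>g<nG. column_done st' g) \<and>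
    t \<le> 400 * (nG + 1) * (D + 1) * (dg + 1)) st"
  proof (rule wp_SeqI[OF radix_sort_correct[OF _ assms(2,3) dg]], goal_cases)
    case (3 st1 t1)
    have "ready st1"
      by (rule ready_frame[OF _ 3(2)])
        (use assms(1) in \<open>simp_all add: columns_ready_def counting_sort_def\<close>)
    moreover have "mem st1 F0Ptr = mem st F0Ptr"
      by (rule frame_mem[OF 3(2)]) (simp add: counting_sort_def)
    ultimately have "columns_ready st1" using assms(1) by (simp add: columns_ready_def)
    from wp_conseq[OF loop[OF this]] 3(1) show ?case
      by (auto elim!: wp_conseq simp: algebra_simps)
  qed (use assms(1) in \<open>simp add: columns_ready_def\<close>)
  then show ?thesis
    by (simp only: find_by_sweep_def inner_def wp_Seq add.assoc)
qed

subsection \<open>Scan\<close>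

text \<open>The scan has no early exit: every hit is valid and overwrites the previous one, and
  \<open>facet_gen\<close> guarantees at least one hit. A generator costs at most \<open>D\<close>
  lists of length \<open>L\<close>.\<close>

lemma find_by_scan_correct:
  assumes "columns_ready st" and L: "\<And>s. s < m \<Longrightarrow> glen s \<le> L"
  shows "wp find_by_scan (\<lambda>st' t. (\<forall>g<nG. column_done st' g) \<and>
    t \<le> 400 * (nG + 1) * (D + 1) * (L + 1)) st"
proof -
  define scan where "scan = (FOR idx FROM GPtr\<langle>V fac\<rangle> TO GPtr\<langle>V fac\<rangle> .+ GLen\<langle>V fac\<rangle> DO
           IF GenX\<langle>V idx\<rangle> .\<le> GenX\<langle>V gen\<rangle> .\<and> GenY\<langle>V idx\<rangle> .\<le> GenY\<langle>V gen\<rangle>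
           THEN F0Row\<langle>F0Ptr\<langle>V gen\<rangle> .+ V pos\<rangle> \<Leftarrow> V idx
           ELSE SKIP)"
  define inner where "inner = (FOR pos FROM N 0 TO FLen\<langle>V simp\<rangle> DO (
         fac \<leftarrow> Fac\<langle>FPtr\<langle>V simp\<rangle> .+ V pos\<rangle>;;
         scan))"
  have scan: "wp scan (\<lambda>st2 t. columns_ready st2 \<and> mem st2 F0Row c < nG \<and> own (mem st2 F0Row c) = \<tau> \<and>
      grd (mem st2 F0Row c) \<le> grd g \<and> (\<forall>q. q \<noteq> c \<longrightarrow> mem st2 F0Row q = mem st1 F0Row q) \<and>
      t \<le> 40 * L + 10) st1"
    if st1: "columns_ready st1" "regs st1 fac = \<tau>" "regs st1 gen = g" "regs st1 pos = p"
      and g: "g < nG" "c = f0off g + p" and \<tau>: "\<tau> \<in> set (facets (inp ! own g))" for st1 \<tau> g p c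
  proof -
    have r: "ready st1" "\<And>st2. columns_ready st2 \<Longrightarrow> ready st2" using st1 by (auto simp: columns_ready_def)
    have \<tau>m: "\<tau> < m" using facets_less \<tau> own_less g(1) by blast
    have ptr: "mem st2 F0Ptr g = f0off g" if "columns_ready st2" for st2
      using that g by (simp add: columns_ready_def)
    define good where "good w \<longleftrightarrow> w < nG \<and> own w = \<tau> \<and> grd w \<le> grd g" for w
    have good_iff: "good w \<longleftrightarrow> fst (grd w) \<le> fst (grd g) \<and> snd (grd w) \<le> snd (grd g)"
      if w: "offset glen \<tau> \<le> w" "w < offset glen \<tau> + glen \<tau>" for w
    proof -
      have "w = gix \<tau> (w - offset glen \<tau>)" "w - offset glen \<tau> < glen \<tau>" using w by auto
      then have "own w = \<tau>" "w < nG" using \<tau>m own_gix gix_less by metis+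
      then show ?thesis by (auto simp: good_def less_eq_prod_def)
    qed
    obtain z where z: "good z" using facet_gen[OF g(1) \<tau>] by (auto simp: good_def)
    obtain j where "j < glen \<tau>" "z = gix \<tau> j" using z unfolding good_def by (metis gen_cases own_gix)
    then have z': "offset glen \<tau> \<le> z" "z < offset glen \<tau> + glen \<tau>" by auto
    have "wp scan (\<lambda>st2 t. columns_ready st2 \<and> good (mem st2 F0Row c) \<and>
        (\<forall>q. q \<noteq> c \<longrightarrow> mem st2 F0Row q = mem st1 F0Row q) \<and> t \<le> 40 * L + 10) st1"
      unfolding scan_def
    \<comment> \<open>The claim about cell \<open>c\<close> is conditional, because before the first
      hit the cell may contain anything.\<close>
    proof (rule wp_For[where Inv = "\<lambda>i st2 t. columns_ready st2 \<and> regs st2 gen = g \<and> regs st2 pos = p \<and>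
        ((\<exists>w\<ge>offset glen \<tau>. w < i \<and> good w) \<longrightarrow> good (mem st2 F0Row c)) \<and>
        (\<forall>q. q \<noteq> c \<longrightarrow> mem st2 F0Row q = mem st1 F0Row q) \<and> t \<le> 40 * (i - offset glen \<tau>) + 10"],
        goal_cases)
      case (2 i st2 t)
      then have i: "offset glen \<tau> \<le> i" "i < offset glen \<tau> + glen \<tau>"
        using st1 r(1) \<tau>m by (auto simp: ready_simplex)
      have iG: "i < nG" using i offset_mono[of "Suc \<tau>" m glen] \<tau>m by simp
      have rdy: "ready st2" using 2 r by blast
      show ?case
      proof (cases "good i")
        case True
        then show ?thesis
          using 2 i iG g rdy good_iff[OF i]
          by (auto simp: wp_Cond ready_gen ptr columns_ready_def)
      next
        case False
        then have "\<And>w. w < Suc i \<and> good w \<longleftrightarrow> w < i \<and> good w" by (auto simp: less_Suc_eq)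
        then show ?thesis
          using 2 i iG g rdy good_iff[OF i] False
          by (auto simp: wp_Cond ready_gen ptr columns_ready_def)
      qed
    next
      case (3 st2 t)
      have "\<exists>w\<ge>offset glen \<tau>. w < offset glen \<tau> + glen \<tau> \<and> good w" using z z' by blast
      then show ?case
        using 3 st1 r(1) \<tau>m L[OF \<tau>m] by (auto simp: ready_simplex max_def)
    qed (use st1 r(1) \<tau>m in \<open>auto simp: ready_simplex\<close>)
    then show ?thesis unfolding good_def by (auto elim!: wp_conseq)
  qed
  have inner: "wp inner (\<lambda>st2 t. columns_ready st2 \<and> column_done st2 g \<and>
      (\<forall>q. q < f0off g \<or> f0off g + flen (own g) \<le> q \<longrightarrow> mem st2 F0Row q = mem st1 F0Row q) \<and>
      t \<le> (40 * L + 30) * D + 10) st1"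
    if st1: "columns_ready st1" "g < nG" "regs st1 simp = own g" "regs st1 gen = g" for st1 g
  proof -
    have r: "ready st1" "\<And>st2. columns_ready st2 \<Longrightarrow> ready st2" using st1 by (auto simp: columns_ready_def)
    have s: "own g < m" using own_less st1 by auto
    have bound: "(40 * L + 30) * flen (own g) \<le> (40 * L + 30) * D"
      using length_facets_le[OF s] by simp
    show ?thesis
      unfolding inner_def
    proof (rule wp_For[where Inv = "\<lambda>i st2 t. columns_ready st2 \<and> regs st2 simp = own g \<and> regs st2 gen = g \<and>
        (\<forall>p<i. mem st2 F0Row (f0off g + p) < nG \<and>
          own (mem st2 F0Row (f0off g + p)) = facets (inp ! own g) ! p \<and>
          grd (mem st2 F0Row (f0off g + p)) \<le> grd g) \<and>
        (\<forall>q. q < f0off g \<or> f0off g + flen (own g) \<le> q \<longrightarrow> mem st2 F0Row q = mem st1 F0Row q) \<and>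
        t \<le> (40 * L + 30) * i + 10"], goal_cases)
      case (2 i st2 t)
      then have i: "i < flen (own g)" "ready st2" using r st1 s by (auto simp: ready_simplex)
      define st3 where "st3 = set_reg fac (facets (inp ! own g) ! i) (set_reg pos i st2)"
      have "wp scan (\<lambda>st4 t'. columns_ready st4 \<and> regs st4 simp = own g \<and> regs st4 gen = g \<and>
        (\<forall>p<Suc i. mem st4 F0Row (f0off g + p) < nG \<and>
          own (mem st4 F0Row (f0off g + p)) = facets (inp ! own g) ! p \<and>
          grd (mem st4 F0Row (f0off g + p)) \<le> grd g) \<and>
        (\<forall>q. q < f0off g \<or> f0off g + flen (own g) \<le> q \<longrightarrow> mem st4 F0Row q = mem st1 F0Row q) \<and>
        t' \<le> 40 * L + 10) st3"
      proof (rule wp_conseq[OF scan[of st3 "facets (inp ! own g) ! i" g i "f0off g + i"]], goal_cases)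
        case (8 st4 t4)
        have "regs st4 simp = regs st3 simp" "regs st4 gen = regs st3 gen"
          by (rule frame_regs[OF 8(2)]; simp add: scan_def)+
        then show ?case using 8(1) 2 i by (auto simp: st3_def All_less_Suc)
      qed (use 2 i st1 in \<open>auto simp: st3_def columns_ready_def\<close>)
      then show ?case
        using 2 i s by (auto simp: wp_Seq ready_simplex st3_def elim!: wp_conseq)
    next
      case (3 st2 t)
      then have "t \<le> (40 * L + 30) * flen (own g) + 10" using st1 s r(1) by (simp add: ready_simplex)
      then have "t \<le> (40 * L + 30) * D + 10" using bound by linarith
      then show ?case using 3 st1 s r(1) by (auto simp: ready_simplex column_done_def)
    qed (use st1 in auto)
  qed
  have "wp (FOR gen FROM N 0 TO V numGen DO (simp \<leftarrow> Own\<langle>V gen\<rangle>;; inner))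
     (\<lambda>st' t. (\<forall>g<nG. column_done st' g) \<and> t \<le> ((40 * L + 30) * D + 20) * nG + 10) st"
  proof (rule wp_For[where Inv = "\<lambda>i st2 t. columns_ready st2 \<and> (\<forall>g<i. column_done st2 g) \<and>
      t \<le> ((40 * L + 30) * D + 20) * i + 10"], goal_cases)
    case (2 g st2 t)
    then have g: "g < nG" "ready st2" using assms(1) by (auto simp: columns_ready_def ready_regs)
    define st3 where "st3 = set_reg simp (own g) (set_reg gen g st2)"
    have "wp inner (\<lambda>st4 t'. columns_ready st4 \<and> (\<forall>h<Suc g. column_done st4 h) \<and>
        t' \<le> (40 * L + 30) * D + 10) st3"
    proof (rule wp_conseq[OF inner[of st3 g]], goal_cases)
      case (5 st4 t4)
      have "column_done st4 g'" if "g' < g" for g'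
        by (rule column_done_other[of st2 _ g]) (use 2 5 that in \<open>auto simp: st3_def\<close>)
      then show ?case using 5 by (auto simp: less_Suc_eq)
    qed (use 2 g in \<open>auto simp: st3_def columns_ready_def\<close>)
    then show ?case
      using 2 g ready_gen(4)[OF g(2,1)]
      by (auto simp: wp_Seq st3_def algebra_simps elim!: wp_conseq)
  qed (use assms in \<open>auto simp: columns_ready_def ready_regs\<close>)
  then show ?thesis
    unfolding find_by_scan_def inner_def scan_def
    by (rule wp_conseq) (auto simp: algebra_simps)
qed


subsection \<open>Choice of the method\<close>

text \<open>A stand-in for the minimum of the longest list length and the number of digits. Only
  upper bounds on \<open>q\<close> matter: the first clause is applied with \<open>k\<close>, the
  second with the exponent \<open>e\<close> of the word length convention.\<close>

definition passes :: "nat \<Rightarrow> bool" where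
  "passes q \<longleftrightarrow> (\<forall>b. (\<forall>s<m. glen s \<le> b) \<longrightarrow> q \<le> b) \<and>
     (\<forall>a. (\<forall>g<nG. fst (grd g) < (nG + 1) ^ a) \<longrightarrow> q \<le> a)"

text \<open>Digit counting stops after \<open>maxLen\<close> rounds. Either all digits were found,
  and the sweep needs \<open>dg\<close> \<le> \<open>maxLen\<close> passes, or the coordinates have
  more than \<open>maxLen\<close> digits, and a scan with lists of length \<open>maxLen\<close> is
  no more expensive. In both cases the number reported satisfies \<open>passes\<close>.\<close>

lemma step2_correct:
  assumes "ready st"
  shows "wp step2 (\<lambda>st' t. columns_ready st' \<and> (\<forall>g<nG. column_done st' g) \<and>
    (\<exists>q. passes q \<and> t \<le> 700 * (nG + 1) * (D + 1) * (q + 1))) st"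
proof -
  have max_len: "wp (FOR simp FROM N 0 TO V numSimp DO maxLen \<leftarrow> emax (V maxLen) (GLen\<langle>V simp\<rangle>))
      (\<lambda>st2 t. columns_ready st2 \<and> (\<forall>s<m. glen s \<le> regs st2 maxLen) \<and>
        (\<forall>b. (\<forall>s<m. glen s \<le> b) \<longrightarrow> regs st2 maxLen \<le> b) \<and> t \<le> 20 * m + 10) st1"
    if "columns_ready st1" "regs st1 maxLen = 0" for st1
  proof (rule wp_For[where Inv = "\<lambda>i st2 t. columns_ready st2 \<and> (\<forall>s<i. glen s \<le> regs st2 maxLen) \<and>
        (\<forall>b. (\<forall>s<i. glen s \<le> b) \<longrightarrow> regs st2 maxLen \<le> b) \<and> t \<le> 20 * i + 10"], goal_cases)
    case (2 i st2 t)
    then have i: "i < m" "ready st2" using that by (auto simp: columns_ready_def ready_regs)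
    then show ?case
      using 2 by (auto simp: ready_simplex emax_def All_less_Suc columns_ready_def less_imp_le_nat le_diff_conv
          intro: le_trans)
  qed (use that in \<open>auto simp: columns_ready_def ready_regs\<close>)
  have max_x: "wp (FOR gen FROM N 0 TO V numGen DO maxX \<leftarrow> emax (V maxX) (GenX\<langle>V gen\<rangle>))
      (\<lambda>st2 t. columns_ready st2 \<and> (\<forall>g<nG. fst (grd g) \<le> regs st2 maxX) \<and>
        (\<forall>b. (\<forall>g<nG. fst (grd g) \<le> b) \<longrightarrow> regs st2 maxX \<le> b) \<and> t \<le> 20 * nG + 10) st1"
    if "columns_ready st1" "regs st1 maxX = 0" for st1
  proof (rule wp_For[where Inv = "\<lambda>i st2 t. columns_ready st2 \<and> (\<forall>g<i. fst (grd g) \<le> regs st2 maxX) \<and>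
        (\<forall>b. (\<forall>g<i. fst (grd g) \<le> b) \<longrightarrow> regs st2 maxX \<le> b) \<and> t \<le> 20 * i + 10"], goal_cases)
    case (2 i st2 t)
    then have i: "i < nG" "ready st2" using that by (auto simp: columns_ready_def ready_regs)
    then show ?case
      using 2 by (auto simp: ready_gen emax_def All_less_Suc columns_ready_def less_imp_le_nat le_diff_conv
          intro: le_trans)
  qed (use that in \<open>auto simp: columns_ready_def ready_regs\<close>)
  have count_digits: "wp (FOR pass FROM N 0 TO V maxLen DO
       IF V power .\<le> V maxX
       THEN (power \<leftarrow> V power .* V radix;; digits \<leftarrow> V digits .+ N 1)
       ELSE SKIP)
      (\<lambda>st2 t. columns_ready st2 \<and> regs st2 radix = nG + 1 \<and> regs st2 maxX = X \<and> regs st2 maxLen = M \<and>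
        (\<exists>dg\<le>M. regs st2 digits = dg \<and> regs st2 power = (nG + 1) ^ dg \<and> (\<forall>a<dg. (nG + 1) ^ a \<le> X) \<and>
          (dg < M \<longrightarrow> X < (nG + 1) ^ dg)) \<and> t \<le> 30 * M + 10) st1"
    if "columns_ready st1" "regs st1 maxX = X" "regs st1 maxLen = M" "regs st1 radix = nG + 1"
      "regs st1 digits = 0" "regs st1 power = 1" for st1 X M
    \<comment> \<open>The count \<open>dg\<close> falls behind the round number only after the power
      has exceeded \<open>X\<close>; from then on it stays fixed.\<close>
    by (rule wp_For[where Inv = "\<lambda>i st2 t. columns_ready st2 \<and> regs st2 radix = nG + 1 \<and>
        regs st2 maxX = X \<and> regs st2 maxLen = M \<and>
        (\<exists>dg\<le>i. regs st2 digits = dg \<and> regs st2 power = (nG + 1) ^ dg \<and> (\<forall>a<dg. (nG + 1) ^ a \<le> X) \<and>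
          (dg < i \<longrightarrow> X < (nG + 1) ^ dg)) \<and> t \<le> 30 * i + 10"])
      (use that in \<open>auto simp: columns_ready_def wp_Cond wp_Seq All_less_Suc not_le mult.commute\<close>)
  have choose: "wp (IF V maxX .< V power THEN find_by_sweep ELSE find_by_scan)
      (\<lambda>st2 t. columns_ready st2 \<and> (\<forall>g<nG. column_done st2 g) \<and>
        (\<exists>q. passes q \<and> t \<le> 400 * (nG + 1) * (D + 1) * (q + 1) + 10)) st1"
    if st1: "columns_ready st1" "regs st1 radix = nG + 1" "regs st1 maxX = X" "regs st1 maxLen = M"
      "dg \<le> M" "regs st1 digits = dg" "regs st1 power = (nG + 1) ^ dg" "\<forall>a<dg. (nG + 1) ^ a \<le> X"
      "dg < M \<longrightarrow> X < (nG + 1) ^ dg"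
      and M: "\<forall>s<m. glen s \<le> M" "\<forall>b. (\<forall>s<m. glen s \<le> b) \<longrightarrow> M \<le> b"
      and X: "\<forall>g<nG. fst (grd g) \<le> X" "\<forall>b. (\<forall>g<nG. fst (grd g) \<le> b) \<longrightarrow> X \<le> b" for st1 X M dg
  proof -
    \<comment> \<open>\<open>X\<close> is known as the least upper bound of the first coordinates,
      so it is compared with the upper bound \<open>(nG + 1) ^ a - 1\<close>. This needs no
      generator that attains the maximum.\<close>
    have X_less: "X < (nG + 1) ^ a" if "\<forall>g<nG. fst (grd g) < (nG + 1) ^ a" for a
    proof -
      have "X \<le> (nG + 1) ^ a - 1" using X(2) that by (intro X(2)[rule_format]) force
      moreover have "0 < (nG + 1) ^ a" by simp
      ultimately show ?thesis by linarith
    qed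
    show ?thesis
    proof (cases "X < (nG + 1) ^ dg")
      case True
      have "dg \<le> a" if "\<forall>g<nG. fst (grd g) < (nG + 1) ^ a" for a
        using X_less[OF that] st1(8) by (meson leD leI)
      then have q: "passes dg" using M(2) st1(5) le_trans unfolding passes_def by blast
      have "wp find_by_sweep (\<lambda>st' t. (\<forall>g<nG. column_done st' g) \<and>
          t \<le> 400 * (nG + 1) * (D + 1) * (dg + 1)) st1"
        using st1 True X(1) by (intro find_by_sweep_correct) (auto intro: le_less_trans)
      then have "wp find_by_sweep (\<lambda>st' t. columns_ready st' \<and> (\<forall>g<nG. column_done st' g) \<and>
          t \<le> 400 * (nG + 1) * (D + 1) * (dg + 1)) st1"
      proof (rule wp_conseq, goal_cases)
        case (1 st' t)
        have "ready st'"
          by (rule ready_frame[OF _ 1(2)])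
            (use st1(1) in \<open>simp_all add: columns_ready_def find_by_sweep_def counting_sort_def\<close>)
        moreover have "mem st' F0Ptr = mem st1 F0Ptr"
          by (rule frame_mem[OF 1(2)]) (simp add: find_by_sweep_def counting_sort_def)
        ultimately show ?case using 1(1) st1(1) by (simp add: columns_ready_def)
      qed
      then show ?thesis
        using True st1 q by (auto simp: wp_Cond elim!: wp_conseq intro!: exI[of _ dg])
    next
      case False
      then have dg: "dg = M" using st1 by simp
      have "M \<le> a" if "\<forall>g<nG. fst (grd g) < (nG + 1) ^ a" for a
        using X_less[OF that] st1(8) False dg by (meson leD leI)
      then have q: "passes M" using M(2) unfolding passes_def by blast
      have "wp find_by_scan (\<lambda>st' t. (\<forall>g<nG. column_done st' g) \<and>
          t \<le> 400 * (nG + 1) * (D + 1) * (M + 1)) st1"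
        using st1(1) M(1) by (intro find_by_scan_correct) auto
      then have "wp find_by_scan (\<lambda>st' t. columns_ready st' \<and> (\<forall>g<nG. column_done st' g) \<and>
          t \<le> 400 * (nG + 1) * (D + 1) * (M + 1)) st1"
      proof (rule wp_conseq, goal_cases)
        case (1 st' t)
        have "ready st'"
          by (rule ready_frame[OF _ 1(2)]) (use st1(1) in \<open>simp_all add: columns_ready_def find_by_scan_def\<close>)
        moreover have "mem st' F0Ptr = mem st1 F0Ptr"
          by (rule frame_mem[OF 1(2)]) (simp add: find_by_scan_def)
        ultimately show ?case using 1(1) st1(1) by (simp add: columns_ready_def)
      qed
      then show ?thesis
        using False st1 q by (auto simp: wp_Cond elim!: wp_conseq intro!: exI[of _ M])
    qed
  qed
  show ?thesis
    unfolding step2_def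
  proof (rule wp_SeqI[OF f0_columns_correct[OF assms]], goal_cases)
    case (1 st1 t1)
    have set_reg: "columns_ready (set_reg r v st2) = columns_ready st2" if "r \<notin> {numSimp, numGen}" for r v st2
      using that by (simp add: columns_ready_def)
    show ?case
      unfolding wp_Seq wp_Assign
    proof (rule wp_conseq[OF max_len], goal_cases)
      case (3 st2 t2)
      note len = 3
      show ?case
      proof (rule wp_conseq[OF max_x], goal_cases)
        case (3 st3 t3)
        have maxLen: "regs st3 maxLen = regs st2 maxLen" using frame_regs[OF 3(2), of maxLen] by simp
        show ?case
        proof (rule wp_conseq[OF count_digits[where X = "regs st3 maxX" and M = "regs st3 maxLen"]], goal_cases)
          case 4
          then show ?case using 3 by (simp add: columns_ready_def ready_regs)
        next
          case (7 st4 t4)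
          then obtain dg where dg: "columns_ready st4" "regs st4 radix = nG + 1"
            "regs st4 maxX = regs st3 maxX" "regs st4 maxLen = regs st3 maxLen"
            "dg \<le> regs st3 maxLen" "regs st4 digits = dg" "regs st4 power = (nG + 1) ^ dg"
            "\<forall>a<dg. (nG + 1) ^ a \<le> regs st3 maxX"
            "dg < regs st3 maxLen \<longrightarrow> regs st3 maxX < (nG + 1) ^ dg" "t4 \<le> 30 * regs st3 maxLen + 10"
            by blast
          \<comment> \<open>One list is no longer than all lists together, so the digit count costs
            O(\<open>nG\<close>) and needs no separate term.\<close>
          have "\<forall>s<m. glen s \<le> nG"
          proof (intro allI impI)
            fix s assume "s < m"
            then show "glen s \<le> nG" using offset_mono[of "Suc s" m glen] by simp
          qed
          then have "regs st3 maxLen \<le> nG" using len maxLen by simp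
          then have t4: "t4 \<le> 30 * nG + 10" using dg(10) by linarith
          have time: "t1 + (eval_time (N 0) + 1 + (t2 + (eval_time (N 0) + 1 + (t3 +
              (eval_time (V numGen .+ N 1) + 1 + (eval_time (N 0) + 1 + (eval_time (N 1) + 1 + (t4 + t5)))))))) \<le>
              700 * (nG + 1) * (D + 1) * (q + 1)"
            if t5: "t5 \<le> 400 * (nG + 1) * (D + 1) * (q + 1) + 10" for t5 q
          proof -
            \<comment> \<open>Naming the product turns the estimate into linear arithmetic.
              Everything except the chosen method is O(\<open>nG\<close>) and fits into the gap
              between 400 and 700.\<close>
            define Z where "Z = (nG + 1) * (D + 1) * (q + 1)"
            have "nG + 1 \<le> Z" by (simp add: Z_def)
            moreover have "t5 \<le> 400 * Z + 10" using t5 by (simp only: Z_def mult.assoc)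
            moreover have "700 * (nG + 1) * (D + 1) * (q + 1) = 700 * Z" by (simp only: Z_def mult.assoc)
            moreover have "t1 \<le> 20 * nG + 20" "t2 \<le> 20 * m + 10" "t3 \<le> 20 * nG + 10"
              using 1(1) 3(1) len(1) by blast+
            ultimately show ?thesis using t4 m_le_nG by simp
          qed
          show ?case
            by (rule wp_conseq[OF choose[OF dg(1-9)]])
              (use 3(1) len(1) maxLen time in auto)
        qed (use 3 in \<open>auto simp: set_reg\<close>)
      qed (use len in \<open>auto simp: set_reg\<close>)
    qed (use 1 in \<open>auto simp: set_reg\<close>)
  qed
qed

end


section \<open>Step 3\<close>

text \<open>An array seen as a list under construction, with its current length in a register:
  \<open>Work\<close> with \<open>workLen\<close>, and the row arrays of \<open>f1\<close> and
  \<open>h0\<close> with \<open>ptr\<close>.\<close>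

definition contents :: "arr \<Rightarrow> reg \<Rightarrow> ram \<Rightarrow> nat list" where
  "contents a r st = map (mem st a) [0..<regs st r]"

lemma length_concat_map_upt: "length (concat (map c [0..<n])) = offset (\<lambda>i. length (c i)) n"
  by (induction n) simp_all

lemma contents_set_reg [simp]: "r \<noteq> x \<Longrightarrow> contents a x (set_reg r v st) = contents a x st"
  by (simp add: contents_def)

lemma read_matrix_concat:
  assumes "\<forall>i\<le>n. mem st p i = offset (\<lambda>i. length (c i)) i"
    and "map (mem st a) [0..<offset (\<lambda>i. length (c i)) n] = concat (map c [0..<n])"
  shows "read_matrix st p a n = map c [0..<n]"
proof -
  have "map (mem st a) [mem st p i..<mem st p (Suc i)] = c i" if "i < n" for i
  proof (rule nth_equalityI)
    show "length (map (mem st a) [mem st p i..<mem st p (Suc i)]) = length (c i)"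
      using assms(1) that by simp
    fix j assume "j < length (map (mem st a) [mem st p i..<mem st p (Suc i)])"
    then have j: "j < length (c i)" using assms(1) that by simp
    let ?off = "offset (\<lambda>i. length (c i))"
    have "map (mem st a) [mem st p i..<mem st p (Suc i)] ! j = mem st a (?off i + j)"
      using j assms(1) that by simp
    also have "\<dots> = map (mem st a) [0..<?off n] ! (?off i + j)"
      using offset_add_less[OF that, of j "\<lambda>i. length (c i)"] j by simp
    also have "\<dots> = concat (map c [0..<n]) ! (offset (\<lambda>q. length (map c [0..<n] ! q)) i + j)"
      unfolding assms(2) using that by (intro arg_cong[where f = "\<lambda>x. _ ! (x + j)"] offset_cong) simp
    also have "\<dots> = c i ! j" using nth_concat_offset[of i "map c [0..<n]" j] that j by simp
    finally show "map (mem st a) [mem st p i..<mem st p (Suc i)] ! j = c i ! j" .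
  qed
  then show ?thesis by (simp add: read_matrix_def)
qed

text \<open>Except for the buffer \<open>Work\<close>, Step 3 reads only arrays that it never
  writes. All invariants can therefore refer to the fixed state \<open>st0\<close> in which it
  starts.\<close>

definition env3 :: "ram \<Rightarrow> ram \<Rightarrow> bool" where
  "env3 st0 st \<longleftrightarrow> (\<forall>b. b \<notin> {Work, F1Row, F1Ptr, H0Row, H0Ptr} \<longrightarrow> mem st b = mem st0 b) \<and>
     regs st numGen = regs st0 numGen \<and> regs st numRel = regs st0 numRel"

lemma env3_set_reg [simp]: "r \<notin> {numGen, numRel} \<Longrightarrow> env3 st0 (set_reg r v st) = env3 st0 st"
  by (auto simp: env3_def)

lemma env3_set_mem [simp]:
  "a \<in> {Work, F1Row, F1Ptr, H0Row, H0Ptr} \<Longrightarrow> env3 st0 (set_mem a i v st) = env3 st0 st"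
  by (auto simp: env3_def)

section \<open>Column loops of Step 3 and their functional model\<close>

context path_input
begin

definition f0_column :: "(nat \<Rightarrow> nat) \<Rightarrow> nat \<Rightarrow> nat list" where
  "f0_column row g = map row [f0off g..<f0off (Suc g)]"

definition path :: "(nat \<Rightarrow> nat) \<Rightarrow> nat \<Rightarrow> nat \<Rightarrow> nat list" where
  "path rel w v = (if own w = own v then map rel [min w v..<max w v] else [])"

text \<open>It runs over all pairs of positions in the work list. This is quadratic, but the length
  of a work list is bounded in terms of the dimension alone.\<close>

definition path_column :: "(nat \<Rightarrow> nat) \<Rightarrow> nat list \<Rightarrow> nat list" where
  "path_column rel W = concat (map (\<lambda>i. concat (map (\<lambda>e. path rel (W ! i) (W ! e))
     [Suc i..<length W])) [0..<length W])"

text \<open>The bounds \<open>lo\<close> and \<open>hi\<close> must not depend on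
  \<open>workLen\<close>, because the program resets this register before it evaluates them.\<close>

lemma product_column_correct:
  assumes st0: "columns_ready st0" and st: "env3 st0 st" and a: "a \<in> {P1Row, F0Row}"
    and lo: "\<And>v. eval lo (set_reg workLen v st) = l" and hi: "\<And>v. eval hi (set_reg workLen v st) = h"
    and lohi: "l \<le> h" "eval_time lo + eval_time hi \<le> 6"
    and less: "\<And>i. l \<le> i \<Longrightarrow> i < h \<Longrightarrow> mem st0 a i < nG"
    and W: "W = concat (map (\<lambda>i. f0_column (mem st0 F0Row) (mem st0 a i)) [l..<h])"
  shows "wp (product_column a lo hi) (\<lambda>st' t. env3 st0 st' \<and> contents Work workLen st' = W \<and>
    regs st' workLen = length W \<and> t \<le> 40 * (h - l) + 20 * length W + 20) st"
proof -
  define F where "F = f0_column (mem st0 F0Row)"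
  have ptr: "mem st1 F0Ptr g = f0off g" if "env3 st0 st1" "g \<le> nG" for st1 g
    using that st0 by (simp add: env3_def columns_ready_def)
  have row: "mem st1 F0Row = mem st0 F0Row" "mem st1 a = mem st0 a" if "env3 st0 st1" for st1
    using that a by (auto simp: env3_def)
  have inner: "wp (FOR ent FROM F0Ptr\<langle>a\<langle>V idx\<rangle>\<rangle> TO F0Ptr\<langle>a\<langle>V idx\<rangle> .+ N 1\<rangle> DO (
         Work\<langle>V workLen\<rangle> \<Leftarrow> F0Row\<langle>V ent\<rangle>;;
         workLen \<leftarrow> V workLen .+ N 1))
      (\<lambda>st2 t. env3 st0 st2 \<and> contents Work workLen st2 = W1 @ F g \<and> t \<le> 20 * length (F g) + 15) st1"
    if "env3 st0 st1" "contents Work workLen st1 = W1" "mem st0 a (regs st1 idx) = g" "g < nG" for st1 W1 g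
    by (rule wp_For[where Inv = "\<lambda>i st2 t. env3 st0 st2 \<and>
        contents Work workLen st2 = W1 @ map (mem st0 F0Row) [f0off g..<i] \<and> t \<le> 20 * (i - f0off g) + 15"])
      (use that in \<open>auto simp: ptr row wp_Seq contents_def F_def f0_column_def Suc_diff_le\<close>)
  have "wp (FOR idx FROM lo TO hi DO
       FOR ent FROM F0Ptr\<langle>a\<langle>V idx\<rangle>\<rangle> TO F0Ptr\<langle>a\<langle>V idx\<rangle> .+ N 1\<rangle> DO (
         Work\<langle>V workLen\<rangle> \<Leftarrow> F0Row\<langle>V ent\<rangle>;;
         workLen \<leftarrow> V workLen .+ N 1)) (\<lambda>st2 t. env3 st0 st2 \<and> contents Work workLen st2 = W \<and>
        t \<le> 40 * (h - l) + 20 * length W + 10) (set_reg workLen 0 st)"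
  proof (rule wp_For[where Inv = "\<lambda>i st2 t. env3 st0 st2 \<and>
      contents Work workLen st2 = concat (map (\<lambda>i. F (mem st0 a i)) [l..<i]) \<and>
      t \<le> 40 * (i - l) + 20 * length (concat (map (\<lambda>i. F (mem st0 a i)) [l..<i])) + 10"], goal_cases)
    case (2 i st2 t)
    show ?case
      by (rule wp_conseq[OF inner[of _ "concat (map (\<lambda>i. F (mem st0 a i)) [l..<i])" "mem st0 a i"]])
        (use 2 less lo hi in \<open>auto simp: contents_def Suc_diff_le\<close>)
  qed (use st lo hi lohi W in \<open>auto simp: contents_def F_def max_absorb2\<close>)
  then show ?thesis
    by (auto simp: product_column_def wp_Seq contents_def elim!: wp_conseq)
qed

text \<open>The time separates into a quadratic part for comparing pairs, harmless in constant
  dimension, and a part proportional to the entries appended. The second part is what the output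
  pays for.\<close>

lemma connect_pairs_correct:
  assumes st0: "columns_ready st0" and st: "env3 st0 st" and a: "a \<in> {F1Row, H0Row}"
    and W: "contents Work workLen st = W" and less: "\<And>w. w \<in> set W \<Longrightarrow> w < nG"
  shows "wp (connect_pairs a) (\<lambda>st' t. env3 st0 st' \<and>
    contents a ptr st' = contents a ptr st @ path_column (mem st0 RelOf) W \<and>
    t \<le> 60 * length W * length W + 20 * length W + 20 * length (path_column (mem st0 RelOf) W) + 20) st"
proof -
  define L where "L = length W"
  define P where "P i e = path (mem st0 RelOf) (W ! i) (W ! e)" for i e
  define Q where "Q i = concat (map (P i) [Suc i..<L])" for i
  have L: "regs st workLen = L" using W by (auto simp: L_def contents_def)
  have Wi: "mem st Work i = W ! i" if "i < L" for i
    using W that by (auto simp: L_def contents_def)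
  have nG: "W ! i < nG" if "i < L" for i using less that by (simp add: L_def)
  have aW: "a \<noteq> Work" "a \<notin> {Own, RelOf}" using a by auto
  have own: "mem st1 Own w = own w" "mem st1 RelOf = mem st0 RelOf"
    if "env3 st0 st1" "w < nG" for st1 w
    using that st0 by (auto simp: env3_def columns_ready_def ready_gen)
  have body: "wp (rowA \<leftarrow> Work\<langle>V idx\<rangle>;;
         rowB \<leftarrow> Work\<langle>V ent\<rangle>;;
         IF Own\<langle>V rowA\<rangle> .= Own\<langle>V rowB\<rangle>
         THEN FOR pos FROM emin (V rowA) (V rowB) TO emax (V rowA) (V rowB) DO (
           a\<langle>V ptr\<rangle> \<Leftarrow> RelOf\<langle>V pos\<rangle>;;
           ptr \<leftarrow> V ptr .+ N 1)
         ELSE SKIP)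
      (\<lambda>st2 t. env3 st0 st2 \<and> contents a ptr st2 = contents a ptr st1 @ P i e \<and>
        t \<le> 20 * length (P i e) + 40) st1"
    if st1: "env3 st0 st1" "mem st1 Work = mem st Work" "regs st1 idx = i" "regs st1 ent = e"
      and ie: "i < L" "e < L" for st1 i e
  proof -
    define st3 where "st3 = set_reg rowB (W ! e) (set_reg rowA (W ! i) st1)"
    have "wp (FOR pos FROM emin (V rowA) (V rowB) TO emax (V rowA) (V rowB) DO (
           a\<langle>V ptr\<rangle> \<Leftarrow> RelOf\<langle>V pos\<rangle>;;
           ptr \<leftarrow> V ptr .+ N 1))
      (\<lambda>st2 t. env3 st0 st2 \<and>
        contents a ptr st2 = contents a ptr st1 @ map (mem st0 RelOf) [min (W ! i) (W ! e)..<max (W ! i) (W ! e)] \<and>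
        t \<le> 20 * (max (W ! i) (W ! e) - min (W ! i) (W ! e)) + 20) st3"
    proof (rule wp_For[where Inv = "\<lambda>q st2 t. env3 st0 st2 \<and>
        contents a ptr st2 = contents a ptr st1 @ map (mem st0 RelOf) [min (W ! i) (W ! e)..<q] \<and>
        t \<le> 20 * (q - min (W ! i) (W ! e)) + 20"], goal_cases)
      case 1
      then show ?case
        using st1 by (auto simp: st3_def emin_def emax_def min_def max_def contents_def)
    next
      case (2 q st2 t)
      have "min (W ! i) (W ! e) \<le> q" using 2 by (simp add: st3_def emin_def min_def split: if_splits)
      then show ?case
        using 2 aW a own(2)[of _ "W ! i"] nG[OF ie(1)] by (auto simp: wp_Seq contents_def Suc_diff_le)
    next
      case (3 st2 t)
      have "max (eval (emin (V rowA) (V rowB)) st3) (eval (emax (V rowA) (V rowB)) st3) = max (W ! i) (W ! e)"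
        by (auto simp: st3_def emin_def emax_def)
      then show ?case using 3 by simp
    qed
    then show ?thesis
      using st1 ie nG own[OF st1(1)]
      by (auto simp: wp_Seq wp_Cond Wi st3_def P_def path_def elim!: wp_conseq)
  qed
  have inner: "wp (FOR ent FROM V idx .+ N 1 TO V workLen DO (
         rowA \<leftarrow> Work\<langle>V idx\<rangle>;;
         rowB \<leftarrow> Work\<langle>V ent\<rangle>;;
         IF Own\<langle>V rowA\<rangle> .= Own\<langle>V rowB\<rangle>
         THEN FOR pos FROM emin (V rowA) (V rowB) TO emax (V rowA) (V rowB) DO (
           a\<langle>V ptr\<rangle> \<Leftarrow> RelOf\<langle>V pos\<rangle>;;
           ptr \<leftarrow> V ptr .+ N 1)
         ELSE SKIP))
      (\<lambda>st2 t. env3 st0 st2 \<and> contents a ptr st2 = contents a ptr st1 @ Q i \<and>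
        t \<le> 20 * length (Q i) + 50 * L + 10) st1"
    if st1: "env3 st0 st1" "mem st1 Work = mem st Work" "regs st1 idx = i" "regs st1 workLen = L"
      and i: "i < L" for st1 i
  proof (rule wp_For[where Inv = "\<lambda>e st2 t. env3 st0 st2 \<and> mem st2 Work = mem st Work \<and>
      contents a ptr st2 = contents a ptr st1 @ concat (map (P i) [Suc i..<e]) \<and>
      t \<le> 20 * length (concat (map (P i) [Suc i..<e])) + 50 * e + 10"], goal_cases)
    case (2 e st2 t)
    have e: "Suc i \<le> e" "e < L" "regs st2 idx = i"
      using 2 st1 frame_regs[OF 2(4), of idx] by auto
    show ?case
    proof (rule wp_conseq[OF body[of "set_reg ent e st2" i e]], goal_cases)
      case (7 st3 t3)
      have "mem st3 Work = mem st2 Work" using frame_mem[OF 7(2), of Work] aW(1) by simp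
      then show ?case using 7 2 e by (auto simp: contents_def)
    qed (use 2 e i in auto)
  next
    case (3 st2 t)
    then show ?case using st1 i by (simp add: Q_def)
  qed (use st1 in auto)
  have "wp (connect_pairs a) (\<lambda>st2 t. env3 st0 st2 \<and>
      contents a ptr st2 = contents a ptr st @ concat (map Q [0..<L]) \<and>
      t \<le> 20 * length (concat (map Q [0..<L])) + (50 * L + 20) * L + 10) st"
    unfolding connect_pairs_def
  proof (rule wp_For[where Inv = "\<lambda>i st2 t. env3 st0 st2 \<and> mem st2 Work = mem st Work \<and>
      contents a ptr st2 = contents a ptr st @ concat (map Q [0..<i]) \<and>
      t \<le> 20 * length (concat (map Q [0..<i])) + (50 * L + 20) * i + 10"], goal_cases)
    case (2 i st2 t)
    have i: "i < L" using 2 L by simp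
    show ?case
    proof (rule wp_conseq[OF inner[of "set_reg idx i st2" i]], goal_cases)
      case (6 st3 t3)
      have "mem st3 Work = mem st2 Work" using frame_mem[OF 6(2), of Work] aW(1) by simp
      then show ?case using 6 2 by (auto simp: contents_def algebra_simps)
    next
      case 4
      then show ?case using frame_regs[OF 2(4), of workLen] L by simp
    qed (use 2 i in auto)
  next
    case (3 st2 t)
    then show ?case using L by simp
  qed (use st in \<open>auto simp: contents_def\<close>)
  moreover have "concat (map Q [0..<L]) = path_column (mem st0 RelOf) W"
    by (simp add: path_column_def Q_def[abs_def] P_def[abs_def] L_def)
  ultimately show ?thesis
    by (auto simp: L_def algebra_simps elim!: wp_conseq)
qed

text \<open>One argument for both matrices: \<open>src\<close> and \<open>sp\<close> hold the matrix
  to be multiplied by \<open>f0\<close>, \<open>a\<close> and \<open>p\<close> the result.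
  \<open>B\<close> bounds the source columns as well as the work lists, so that each column costs a
  function of \<open>B\<close> plus its own length.\<close>

lemma columns_correct:
  assumes st0: "columns_ready st0" and st: "env3 st0 st" and ap: "(a, p) \<in> {(F1Row, F1Ptr), (H0Row, H0Ptr)}"
    and src: "(src, sp) \<in> {(P1Row, P1Ptr), (F0Row, F0Ptr)}" and cnt: "cnt \<in> {numGen, numRel}"
    and n: "regs st0 cnt = n"
    and sp: "\<And>i. i < n \<Longrightarrow> mem st0 sp i \<le> mem st0 sp (Suc i)"
      "\<And>i. i < n \<Longrightarrow> mem st0 sp (Suc i) - mem st0 sp i \<le> B"
    and less: "\<And>i j. i < n \<Longrightarrow> mem st0 sp i \<le> j \<Longrightarrow> j < mem st0 sp (Suc i) \<Longrightarrow> mem st0 src j < nG"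
    and W: "\<And>i. i < n \<Longrightarrow> W i =
      concat (map (\<lambda>j. f0_column (mem st0 F0Row) (mem st0 src j)) [mem st0 sp i..<mem st0 sp (Suc i)])"
      "\<And>i w. i < n \<Longrightarrow> w \<in> set (W i) \<Longrightarrow> w < nG" "\<And>i. i < n \<Longrightarrow> length (W i) \<le> B"
    and c: "\<And>i. c i = path_column (mem st0 RelOf) (W i)"
  shows "wp (ptr \<leftarrow> N 0;; p\<langle>N 0\<rangle> \<Leftarrow> N 0;;
     FOR gen FROM N 0 TO V cnt DO (
       product_column src (sp\<langle>V gen\<rangle>) (sp\<langle>V gen .+ N 1\<rangle>);;
       connect_pairs a;;
       p\<langle>V gen .+ N 1\<rangle> \<Leftarrow> V ptr)) (\<lambda>st' t. env3 st0 st' \<and> read_matrix st' p a n = map c [0..<n] \<and>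
    t \<le> 20 * offset (\<lambda>i. length (c i)) n + (60 * B * B + 80 * B + 60) * n + 20) st"
proof -
  have neq: "a \<noteq> Work" "p \<noteq> Work" "p \<noteq> a" "src \<noteq> a" "sp \<noteq> a" "a \<noteq> p"
    and a: "a \<in> {F1Row, H0Row}" "p \<in> {Work, F1Row, F1Ptr, H0Row, H0Ptr}"
      "src \<in> {P1Row, F0Row}" "cnt \<noteq> ptr" "cnt \<noteq> gen"
    using ap src cnt by auto
  have sp_eq: "mem st1 sp = mem st0 sp" "regs st1 cnt = n" if "env3 st0 st1" for st1
    using that src cnt n by (auto simp: env3_def)
  have loop: "wp (FOR gen FROM N 0 TO V cnt DO (
       product_column src (sp\<langle>V gen\<rangle>) (sp\<langle>V gen .+ N 1\<rangle>);;
       connect_pairs a;;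
       p\<langle>V gen .+ N 1\<rangle> \<Leftarrow> V ptr)) (\<lambda>st' t. env3 st0 st' \<and> contents a ptr st' = concat (map c [0..<n]) \<and>
         (\<forall>q\<le>n. mem st' p q = offset (\<lambda>i. length (c i)) q) \<and>
         t \<le> 20 * offset (\<lambda>i. length (c i)) n + (60 * B * B + 80 * B + 60) * n + 10) st1"
    if st1: "env3 st0 st1" "regs st1 ptr = 0" "mem st1 p 0 = 0" for st1
  proof (rule wp_For[where Inv = "\<lambda>i st' t. env3 st0 st' \<and> contents a ptr st' = concat (map c [0..<i]) \<and>
         (\<forall>q\<le>i. mem st' p q = offset (\<lambda>i. length (c i)) q) \<and>
         t \<le> 20 * offset (\<lambda>i. length (c i)) i + (60 * B * B + 80 * B + 60) * i + 10"], goal_cases)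
    case (2 i st2 t)
    have i: "i < n" using 2 st1 sp_eq by simp
    have st2: "env3 st0 st2" using 2 by blast
    show ?case
      unfolding wp_Seq
    proof (rule wp_conseq[OF product_column_correct[OF st0, where W = "W i" and l = "mem st0 sp i"
              and h = "mem st0 sp (Suc i)"]], goal_cases)
      case (9 st3 t3)
      have ptr3: "contents a ptr st3 = contents a ptr st2" "mem st3 p = mem st2 p" "regs st3 gen = i"
        using frame_mem[OF 9(2), of a] frame_mem[OF 9(2), of p] frame_regs[OF 9(2), of ptr]
          frame_regs[OF 9(2), of gen] neq by (auto simp: contents_def product_column_def)
      show ?case
      proof (rule wp_conseq[OF connect_pairs_correct[OF st0, where W = "W i"]], goal_cases)
        case (5 st4 t4)
        have st4: "mem st4 p = mem st3 p" "regs st4 gen = regs st3 gen"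
          using frame_mem[OF 5(2), of p] frame_regs[OF 5(2), of gen] neq by (auto simp: connect_pairs_def)
        have "length (W i) * length (W i) \<le> B * B" using W(3)[OF i] by (intro mult_le_mono) auto
        then have t4: "t4 \<le> 60 * (B * B) + 20 * B + 20 * length (c i) + 20"
          using 5(1) W(3)[OF i] by (simp add: c)
        have t3: "t3 \<le> 60 * B + 20" using 9(1) sp(2)[OF i] W(3)[OF i] by linarith
        have cont: "contents a ptr st4 = concat (map c [0..<Suc i])"
          using 5(1) ptr3 2(3) by (simp add: c)
        then have "regs st4 ptr = length (concat (map c [0..<Suc i]))"
          unfolding contents_def by (metis diff_zero length_map length_upt)
        also have "\<dots> = offset (\<lambda>i. length (c i)) (Suc i)"
          by (rule length_concat_map_upt)
        finally have ptr4: "regs st4 ptr = offset (\<lambda>i. length (c i)) (Suc i)" .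
        show ?case
          using 5(1) 2(3) cont ptr4 st4 ptr3 t3 t4 a neq
          by (auto simp: contents_def le_Suc_eq algebra_simps)
      qed (use 9 a i W(2) in auto)
    qed (use st2 a sp_eq[OF st2] less i sp W(1) in auto)
  next
    case (3 st' t)
    then show ?case using st1 sp_eq by simp
  qed (use st1 in \<open>auto simp: contents_def\<close>)
  have "wp (FOR gen FROM N 0 TO V cnt DO (
       product_column src (sp\<langle>V gen\<rangle>) (sp\<langle>V gen .+ N 1\<rangle>);;
       connect_pairs a;;
       p\<langle>V gen .+ N 1\<rangle> \<Leftarrow> V ptr)) (\<lambda>st' t. env3 st0 st' \<and> read_matrix st' p a n = map c [0..<n] \<and>
         t \<le> 20 * offset (\<lambda>i. length (c i)) n + (60 * B * B + 80 * B + 60) * n + 10) st1"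
    if st1: "env3 st0 st1" "regs st1 ptr = 0" "mem st1 p 0 = 0" for st1
  proof (rule wp_conseq[OF loop[OF st1]], goal_cases)
    case (1 st' t)
    then have cont: "contents a ptr st' = concat (map c [0..<n])" by blast
    then have "regs st' ptr = length (concat (map c [0..<n]))"
      unfolding contents_def by (metis diff_zero length_map length_upt)
    also have "\<dots> = offset (\<lambda>i. length (c i)) n"
      by (rule length_concat_map_upt)
    finally show ?case using 1 cont by (auto simp: contents_def intro!: read_matrix_concat)
  qed
  from this[of "set_mem p 0 0 (set_reg ptr 0 st)"] show ?thesis
    using st a by (auto simp: wp_Seq elim!: wp_conseq)
qed

end

lemma distinct_concat_map:
  assumes "distinct xs" and "\<And>x. x \<in> set xs \<Longrightarrow> distinct (f x)"
    and "\<And>x y. x \<in> set xs \<Longrightarrow> y \<in> set xs \<Longrightarrow> x \<noteq> y \<Longrightarrow> set (f x) \<inter> set (f y) = {}"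
  shows "distinct (concat (map f xs))"
  using assms
proof (induction xs)
  case (Cons x xs)
  have "set (f x) \<inter> set (f y) = {}" if "y \<in> set xs" for y
    using that Cons.prems(1) by (intro Cons.prems(3)) auto
  then show ?case using Cons by auto
qed simp

lemma map_plus_upt: "map ((+) c) [a..<b] = [c + a..<c + b]"
  for c :: nat
  by (rule nth_equalityI) auto

lemma length_concat_le:
  assumes "\<And>x. x \<in> set xs \<Longrightarrow> length (f x) \<le> b"
  shows "length (concat (map f xs)) \<le> length xs * b"
  using assms by (induction xs) (auto intro: add_mono)

section \<open>From stored rows to the chosen grades and disjoint connecting paths\<close>

context path_input
begin

lemma length_f0_column [simp]: "length (f0_column row g) = flen (own g)"
  by (simp add: f0_column_def)

lemma f0_column_less:
  assumes "column_done st g" and "w \<in> set (f0_column (mem st F0Row) g)"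
  shows "w < nG"
proof -
  obtain q where q: "f0off g \<le> q" "q < f0off g + flen (own g)" "w = mem st F0Row q"
    using assms(2) by (auto simp: f0_column_def)
  then show ?thesis
    using assms(1)[unfolded column_done_def, rule_format, of "q - f0off g"] by simp
qed

text \<open>\<open>z\<close> is the witness that \<open>path_output\<close> asks for; the second
  conjunct ties it to the columns of \<open>f0\<close> actually stored.\<close>

definition choice_of :: "(nat \<Rightarrow> nat) \<Rightarrow> (nat \<Rightarrow> nat \<Rightarrow> nat \<Rightarrow> nat) \<Rightarrow> bool" where
  "choice_of row z \<longleftrightarrow> (\<forall>s<m. \<forall>j<glen s.
     (\<forall>\<tau>\<in>set (facets (inp ! s)). z s j \<tau> < glen \<tau> \<and> grades (inp ! \<tau>) ! z s j \<tau> \<le> grades (inp ! s) ! j) \<and>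
     f0_column row (gix s j) = map (\<lambda>\<tau>. gix \<tau> (z s j \<tau>)) (facets (inp ! s)))"

lemma ex_choice_of:
  assumes "\<forall>g<nG. column_done st g"
  shows "\<exists>z. choice_of (mem st F0Row) z"
proof -
  \<comment> \<open>Memory indexes the choice by the position in the facet list,
    \<open>path_output\<close> by the facet itself. \<open>ix\<close> converts one into the other,
    which is unambiguous since the list is distinct; subtracting the block start then leaves the
    position of the grade.\<close>
  define ix where "ix s \<tau> = (SOME p. p < flen s \<and> facets (inp ! s) ! p = \<tau>)" for s \<tau>
  define z where "z s j \<tau> = mem st F0Row (f0off (gix s j) + ix s \<tau>) - offset glen \<tau>" for s j \<tau>
  have ix: "ix s (facets (inp ! s) ! p) = p" if "s < m" "p < flen s" for s p
    unfolding ix_def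
    by (rule some_equality) (use that distinct_facets in \<open>auto simp: nth_eq_iff_index_eq\<close>)
  have z: "z s j \<tau> < glen \<tau> \<and> grades (inp ! \<tau>) ! z s j \<tau> \<le> grades (inp ! s) ! j \<and>
      mem st F0Row (f0off (gix s j) + p) = gix \<tau> (z s j \<tau>)"
    if s: "s < m" "j < glen s" and p: "p < flen s" "\<tau> = facets (inp ! s) ! p" for s j p \<tau>
  proof -
    define w where "w = mem st F0Row (f0off (gix s j) + p)"
    have w: "w < nG" "own w = \<tau>" "grd w \<le> grades (inp ! s) ! j"
      using assms[rule_format, OF gix_less[OF s]] s p by (auto simp: column_done_def w_def)
    obtain s' i where i: "s' < m" "i < glen s'" "w = gix s' i" using gen_cases[OF w(1)] .
    then have "s' = \<tau>" using w(2) by simp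
    moreover have "z s j \<tau> = w - offset glen \<tau>" using ix[OF s(1) p(1)] by (simp add: z_def w_def p(2))
    ultimately show ?thesis using w i by (simp add: w_def)
  qed
  have "choice_of (mem st F0Row) z"
    unfolding choice_of_def
  proof (intro allI impI conjI ballI)
    fix s j assume s: "s < m" "j < glen s"
    fix \<tau> assume "\<tau> \<in> set (facets (inp ! s))"
    then obtain p where "p < flen s" "\<tau> = facets (inp ! s) ! p" by (metis in_set_conv_nth)
    from z[OF s this]
    show "z s j \<tau> < glen \<tau>" "grades (inp ! \<tau>) ! z s j \<tau> \<le> grades (inp ! s) ! j" by blast+
  next
    fix s j assume s: "s < m" "j < glen s"
    show "f0_column (mem st F0Row) (gix s j) = map (\<lambda>\<tau>. gix \<tau> (z s j \<tau>)) (facets (inp ! s))"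
      by (rule nth_equalityI) (use s z[OF s] in \<open>auto simp: f0_column_def\<close>)
  qed
  then show ?thesis by blast
qed

lemma sparse_column_f0:
  assumes "choice_of row z" and "s < m" "j < glen s"
  shows "sparse_column (generators inp) {(\<tau>, z s j \<tau>) |\<tau>. \<tau> \<in> set (facets (inp ! s))}
    (f0_column row (gix s j))"
proof -
  have \<tau>: "\<tau> < m" "z s j \<tau> < glen \<tau>" if "\<tau> \<in> set (facets (inp ! s))" for \<tau>
    using assms facets_less[OF _ that] that by (auto simp: choice_of_def)
  have "inj_on (\<lambda>\<tau>. gix \<tau> (z s j \<tau>)) (set (facets (inp ! s)))"
    by (rule inj_onI) (metis \<tau> own_gix)
  moreover have "f0_column row (gix s j) = map (\<lambda>\<tau>. gix \<tau> (z s j \<tau>)) (facets (inp ! s))"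
    using assms by (simp add: choice_of_def)
  ultimately show ?thesis
    using \<tau> distinct_facets[OF assms(2)]
    by (auto simp: sparse_column_def generators_eq distinct_map gix_less nth_pairs image_image
        intro!: image_eqI)
qed

text \<open>An entry of a product column is labelled by its simplex \<open>\<tau>\<close> and by the \<open>x\<close> that it comes from:
  the grade \<open>j\<close> or \<open>j + 1\<close> in case of \<open>f1\<close>, and the intermediate facet in case of \<open>h0\<close>.\<close>

lemma path_column_labelled:
  assumes rel: "\<And>s j. s < m \<Longrightarrow> j < rlen s \<Longrightarrow> rel (gix s j) = rix s j"
    and "distinct lb" and lb: "\<And>x \<tau>. (x, \<tau>) \<in> set lb \<Longrightarrow> \<tau> < m \<and> \<zeta> x \<tau> < glen \<tau>"
    and two: "\<And>x y u \<tau>. {(x, \<tau>), (y, \<tau>), (u, \<tau>)} \<subseteq> set lb \<Longrightarrow> x = y \<or> x = u \<or> y = u"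
    and W: "W = map (\<lambda>(x, \<tau>). gix \<tau> (\<zeta> x \<tau>)) lb"
  shows "sparse_column (relations inp)
      (\<Union>{connecting_path \<tau> (\<zeta> x \<tau>) (\<zeta> y \<tau>) |\<tau> x y. x \<noteq> y \<and> (x, \<tau>) \<in> set lb \<and> (y, \<tau>) \<in> set lb})
      (path_column rel W)"
    and "(\<And>s. s < m \<Longrightarrow> glen s \<le> k) \<Longrightarrow> length (path_column rel W) \<le> length lb * length lb * k"
proof -
  define L where "L = length lb"
  have LW: "length W = L" by (simp add: W L_def)
  define X where "X i = fst (lb ! i)" for i
  define T where "T i = snd (lb ! i)" for i
  define Z where "Z i = \<zeta> (X i) (T i)" for i
  have T: "T i < m" "Z i < glen (T i)" "(X i, T i) \<in> set lb" "W ! i = gix (T i) (Z i)" if "i < L" for i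
    using lb[of "X i" "T i"] that by (auto simp: L_def X_def T_def Z_def W case_prod_beta)
  have piece: "path rel (W ! i) (W ! e) =
      (if T i = T e then map (rix (T i)) [min (Z i) (Z e)..<max (Z i) (Z e)] else [])"
    if "i < L" "e < L" for i e
  proof (cases "T i = T e")
    case True
    have "[min (W ! i) (W ! e)..<max (W ! i) (W ! e)] =
        map (gix (T i)) [min (Z i) (Z e)..<max (Z i) (Z e)]"
      unfolding map_plus_upt using T[OF that(1)] T[OF that(2)] True by (simp add: min_add_distrib_right max_add_distrib_right)
    moreover have "rel (gix (T i) q) = rix (T i) q" if q: "q < max (Z i) (Z e)" for q
      using rel[of "T i" q] T[OF \<open>i < L\<close>] T[OF \<open>e < L\<close>] True q by (auto simp: max_def split: if_splits)
    ultimately show ?thesis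
      using T[OF that(1)] T[OF that(2)] True by (auto simp: path_def)
  next
    case False
    then show ?thesis using T[OF that(1)] T[OF that(2)] by (simp add: path_def)
  qed
  have mem_piece: "\<exists>q<rlen (T i). r = rix (T i) q \<and> T i = T e \<and> q \<in> {min (Z i) (Z e)..<max (Z i) (Z e)}"
    if "r \<in> set (path rel (W ! i) (W ! e))" "i < L" "e < L" for r i e
  proof -
    have eq: "T i = T e" using that(1) piece[OF that(2,3)] by (metis empty_iff list.set(1))
    then have "r \<in> rix (T i) ` {min (Z i) (Z e)..<max (Z i) (Z e)}"
      using that(1) piece[OF that(2,3)] by (metis set_map set_upt)
    then obtain q where q: "r = rix (T i) q" "q \<in> {min (Z i) (Z e)..<max (Z i) (Z e)}" by blast
    moreover have "q < rlen (T i)"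
      using q(2) eq T[OF that(2)] T[OF that(3)] by (auto simp: max_def split: if_splits)
    ultimately show ?thesis using eq by blast
  qed
  have X_inj: "a = b" if "X a = X b" "a < L" "b < L" "T a = T b" for a b
  proof -
    have "lb ! a = lb ! b" using that by (simp add: X_def T_def prod_eq_iff)
    then show ?thesis using that nth_eq_iff_index_eq[OF \<open>distinct lb\<close>] by (simp add: L_def)
  qed
  \<comment> \<open>A relation determines its simplex, so all four entries of two pairs sharing it
    carry the same \<tau>. By \<open>two\<close> only two different labels are available, hence both
    pairs consist of the same two positions. Disjointness of the paths follows.\<close>
  have unique: "i = i' \<and> e = e'"
    if "r \<in> set (path rel (W ! i) (W ! e))" "r \<in> set (path rel (W ! i') (W ! e'))"
      and less: "i < e" "e < L" "i' < e'" "e' < L" for r i e i' e'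
  proof -
    have L: "i < L" "e < L" "i' < L" "e' < L" using less by auto
    have "T i = T e" "T i' = T e'" "T i = T i'"
      using mem_piece[OF that(1) L(1,2)] mem_piece[OF that(2) L(3,4)] offset_eq_iff[of _ rlen "T i" _ "T i'"]
      by auto
    then have eq: "T e = T i" "T i' = T i" "T e' = T i" by auto
    have "X i = X e \<or> X i = X i' \<or> X e = X i'" "X i = X e \<or> X i = X e' \<or> X e = X e'"
      using T(3)[OF L(1)] T(3)[OF L(2)] T(3)[OF L(3)] T(3)[OF L(4)] eq
      by (auto intro!: two[of _ "T i"])
    then have "i = i' \<or> e = i'" "i = e' \<or> e = e'"
      using X_inj L eq less by (metis less_irrefl)+
    then show ?thesis using less by auto
  qed
  have col: "path_column rel W = concat (map (\<lambda>i. concat (map (\<lambda>e. path rel (W ! i) (W ! e)) [Suc i..<L])) [0..<L])"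
    by (simp add: path_column_def LW)
  have set_col: "set (path_column rel W) = (\<Union>e<L. \<Union>i<e. set (path rel (W ! i) (W ! e)))"
    unfolding col by (fastforce simp: Suc_le_eq)
  have "distinct (path_column rel W)"
    unfolding col
  proof (rule distinct_concat_map)
    fix i assume i: "i \<in> set [0..<L]"
    show "distinct (concat (map (\<lambda>e. path rel (W ! i) (W ! e)) [Suc i..<L]))"
    proof (rule distinct_concat_map)
      fix e assume "e \<in> set [Suc i..<L]"
      then show "distinct (path rel (W ! i) (W ! e))"
        using i by (subst piece) (auto simp: distinct_map inj_on_def)
    next
      fix e e' assume "e \<in> set [Suc i..<L]" "e' \<in> set [Suc i..<L]" "e \<noteq> e'"
      then show "set (path rel (W ! i) (W ! e)) \<inter> set (path rel (W ! i) (W ! e')) = {}"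
        using unique[of _ i e i e'] by auto
    qed simp
  next
    fix i i' assume "i \<in> set [0..<L]" "i' \<in> set [0..<L]" "i \<noteq> i'"
    then show "set (concat (map (\<lambda>e. path rel (W ! i) (W ! e)) [Suc i..<L])) \<inter>
        set (concat (map (\<lambda>e. path rel (W ! i') (W ! e)) [Suc i'..<L])) = {}"
      using unique[of _ i _ i'] by (fastforce simp: Suc_le_eq)
  qed simp
  moreover have "set (path_column rel W) \<subseteq> {..<length (relations inp)}"
  proof
    fix r assume "r \<in> set (path_column rel W)"
    then obtain i e where "r \<in> set (path rel (W ! i) (W ! e))" "i < e" "e < L"
      unfolding set_col by blast
    then obtain q where "q < rlen (T i)" "r = rix (T i) q" "i < L"
      using mem_piece[of r i e] by auto
    then show "r \<in> {..<length (relations inp)}"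
      using rix_less[OF T(1)] by (simp add: relations_eq)
  qed
  moreover have "(!) (relations inp) ` set (path_column rel W) =
      \<Union>{connecting_path (T i) (Z i) (Z e) |i e. i < e \<and> e < L \<and> T i = T e}"
  proof -
    have image: "(!) (relations inp) ` set (path rel (W ! i) (W ! e)) =
        (if T i = T e then connecting_path (T i) (Z i) (Z e) else {})" if "i < L" "e < L" for i e
    proof (cases "T i = T e")
      case True
      have "pairs rlen m ! rix (T i) q = (T i, q)" if "q < max (Z i) (Z e)" for q
        using nth_pairs[of "T i" m q rlen] T[OF \<open>i < L\<close>] T[OF \<open>e < L\<close>] True that
        by (auto simp: max_def split: if_splits)
      then have "(\<lambda>q. pairs rlen m ! rix (T i) q) ` {min (Z i) (Z e)..<max (Z i) (Z e)} =
          Pair (T i) ` {min (Z i) (Z e)..<max (Z i) (Z e)}"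
        by (intro image_cong) auto
      also have "\<dots> = connecting_path (T i) (Z i) (Z e)" by (auto simp: connecting_path_def)
      finally show ?thesis
        unfolding piece[OF that] if_P[OF True] by (simp only: relations_eq set_map set_upt image_image)
    qed (simp add: piece that)
    have "(!) (relations inp) ` set (path_column rel W) =
        (\<Union>e<L. \<Union>i<e. (!) (relations inp) ` set (path rel (W ! i) (W ! e)))"
      unfolding set_col by (simp only: image_UN)
    also have "\<dots> = (\<Union>e<L. \<Union>i<e. if T i = T e then connecting_path (T i) (Z i) (Z e) else {})"
      by (intro SUP_cong refl image) auto
    also have "\<dots> = \<Union>{connecting_path (T i) (Z i) (Z e) |i e. i < e \<and> e < L \<and> T i = T e}"
    proof (intro subset_antisym subsetI)
      fix x assume "x \<in> (\<Union>e<L. \<Union>i<e. if T i = T e then connecting_path (T i) (Z i) (Z e) else {})"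
      then obtain i e where "e < L" "i < e" "T i = T e" "x \<in> connecting_path (T i) (Z i) (Z e)"
        by (auto split: if_splits)
      then show "x \<in> \<Union>{connecting_path (T i) (Z i) (Z e) |i e. i < e \<and> e < L \<and> T i = T e}" by blast
    next
      fix x assume "x \<in> \<Union>{connecting_path (T i) (Z i) (Z e) |i e. i < e \<and> e < L \<and> T i = T e}"
      then obtain i e where "e < L" "i < e" "T i = T e" "x \<in> connecting_path (T i) (Z i) (Z e)"
        by blast
      then show "x \<in> (\<Union>e<L. \<Union>i<e. if T i = T e then connecting_path (T i) (Z i) (Z e) else {})"
        by (intro UN_I[of e] UN_I[of i]) auto
    qed
    finally show ?thesis .
  qed
  \<comment> \<open>The program visits position pairs with \<open>i < e\<close>, the specification
    all ordered pairs of distinct labels. The sets of paths agree because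
    \<open>connecting_path\<close> is symmetric in its ends.\<close>
  moreover have "\<dots> = \<Union>{connecting_path \<tau> (\<zeta> x \<tau>) (\<zeta> y \<tau>) |\<tau> x y. x \<noteq> y \<and> (x, \<tau>) \<in> set lb \<and> (y, \<tau>) \<in> set lb}"
    (is "\<Union>?A = \<Union>?B")
  proof -
    have "?A = ?B"
    proof (intro subset_antisym subsetI)
      fix C assume "C \<in> ?A"
      then obtain i e where ie: "C = connecting_path (T i) (Z i) (Z e)" "i < e" "e < L" "T i = T e" by auto
      then have "X i \<noteq> X e" using X_inj[of i e] by auto
      then have "C = connecting_path (T e) (\<zeta> (X i) (T e)) (\<zeta> (X e) (T e)) \<and> X i \<noteq> X e \<and>
          (X i, T e) \<in> set lb \<and> (X e, T e) \<in> set lb"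
        using T(3)[of i] T(3)[of e] ie by (auto simp: Z_def)
      then show "C \<in> ?B" by blast
    next
      fix C assume "C \<in> ?B"
      then obtain \<tau> x y where C: "C = connecting_path \<tau> (\<zeta> x \<tau>) (\<zeta> y \<tau>)" "x \<noteq> y"
        "(x, \<tau>) \<in> set lb" "(y, \<tau>) \<in> set lb" by blast
      then obtain i e where "i < L" "lb ! i = (x, \<tau>)" "e < L" "lb ! e = (y, \<tau>)"
        by (metis L_def in_set_conv_nth)
      then have ie: "i < L" "e < L" "T i = \<tau>" "T e = \<tau>" "Z i = \<zeta> x \<tau>" "Z e = \<zeta> y \<tau>" "i \<noteq> e"
        using C(2) by (auto simp: T_def X_def Z_def)
      have comm: "connecting_path \<tau> b c = connecting_path \<tau> c b" for b c
        by (simp add: connecting_path_def min.commute max.commute)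
      show "C \<in> ?A"
      proof (cases "i < e")
        case True
        then have "C = connecting_path (T i) (Z i) (Z e) \<and> i < e \<and> e < L \<and> T i = T e"
          using ie C(1) by simp
        then show ?thesis by blast
      next
        case False
        then have "C = connecting_path (T e) (Z e) (Z i) \<and> e < i \<and> i < L \<and> T e = T i"
          using ie C(1) comm[of "\<zeta> x \<tau>"] by simp
        then show ?thesis by blast
      qed
    qed
    then show ?thesis by simp
  qed
  ultimately show "sparse_column (relations inp)
      (\<Union>{connecting_path \<tau> (\<zeta> x \<tau>) (\<zeta> y \<tau>) |\<tau> x y. x \<noteq> y \<and> (x, \<tau>) \<in> set lb \<and> (y, \<tau>) \<in> set lb})
      (path_column rel W)"
    by (simp add: sparse_column_def)
  show "length (path_column rel W) \<le> length lb * length lb * k" if k: "\<And>s. s < m \<Longrightarrow> glen s \<le> k"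
  proof -
    have "length (path rel (W ! i) (W ! e)) \<le> k" if "i < L" "e < L" for i e
      unfolding piece[OF that] using T[OF that(1)] T[OF that(2)] k[of "T i"] by (auto simp: max_def min_def)
    then have "length (concat (map (\<lambda>e. path rel (W ! i) (W ! e)) [Suc i..<L])) \<le> length [Suc i..<L] * k"
      if "i < L" for i using that by (intro length_concat_le) auto
    moreover have "length [Suc i..<L] * k \<le> L * k" for i by (intro mult_le_mono1) simp
    ultimately have "length (concat (map (\<lambda>e. path rel (W ! i) (W ! e)) [Suc i..<L])) \<le> L * k"
      if "i < L" for i using that le_trans by blast
    then have "length (path_column rel W) \<le> length [0..<L] * (L * k)"
      unfolding col by (intro length_concat_le) auto
    then show ?thesis by (simp add: L_def)
  qed
qed

definition f1_work :: "(nat \<Rightarrow> nat) \<Rightarrow> nat \<Rightarrow> nat list" where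
  "f1_work row r = f0_column row (lower r) @ f0_column row (Suc (lower r))"

definition h0_work :: "(nat \<Rightarrow> nat) \<Rightarrow> nat \<Rightarrow> nat list" where
  "h0_work row g = concat (map (f0_column row) (f0_column row g))"

lemma connecting_path_commute: "connecting_path \<tau> a b = connecting_path \<tau> b a"
  by (simp add: connecting_path_def min.commute max.commute)

text \<open>The labels are \<open>j\<close> and \<open>Suc j\<close> with \<zeta> =
  \<open>z s\<close>. Three labels at the same \<tau> repeat simply because only these two values
  exist.\<close>

lemma f1_column:
  assumes z: "choice_of row z" and s: "s < m" "j < rlen s"
    and rel: "\<And>s j. s < m \<Longrightarrow> j < rlen s \<Longrightarrow> rel (gix s j) = rix s j"
  shows "sparse_column (relations inp)
      (\<Union>\<tau>\<in>set (facets (inp ! s)). connecting_path \<tau> (z s j \<tau>) (z s (Suc j) \<tau>))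
      (path_column rel (f1_work row (rix s j)))"
    and "(\<And>s. s < m \<Longrightarrow> glen s \<le> k) \<Longrightarrow> length (path_column rel (f1_work row (rix s j))) \<le> (2 * D) * (2 * D) * k"
proof -
  define lb where "lb = map (Pair j) (facets (inp ! s)) @ map (Pair (Suc j)) (facets (inp ! s))"
  have dist: "distinct lb"
    using distinct_facets[OF s(1)] by (auto simp: lb_def distinct_map inj_on_def)
  have lb: "\<tau> < m \<and> z s x \<tau> < glen \<tau>" if "(x, \<tau>) \<in> set lb" for x \<tau>
    using that s z facets_less[OF s(1)] by (auto simp: lb_def choice_of_def)
  have two: "x = y \<or> x = u \<or> y = u" if "{(x, \<tau>), (y, \<tau>), (u, \<tau>)} \<subseteq> set lb" for x y u \<tau>
    using that by (auto simp: lb_def)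
  have W: "f1_work row (rix s j) = map (\<lambda>(x, \<tau>). gix \<tau> (z s x \<tau>)) lb"
  proof -
    have "Suc (gix s j) = gix s (Suc j)" by simp
    then have "f1_work row (rix s j) = f0_column row (gix s j) @ f0_column row (gix s (Suc j))"
      using lower_rix[OF s] by (simp only: f1_work_def)
    moreover have fc: "f0_column row (gix s x) = map (\<lambda>\<tau>. gix \<tau> (z s x \<tau>)) (facets (inp ! s))"
      if "x < glen s" for x
      using that s z by (simp only: choice_of_def)
    moreover have "j < glen s" "Suc j < glen s" using s by auto
    ultimately show ?thesis by (simp only: lb_def map_append map_map comp_def prod.case fc)
  qed
  have col: "sparse_column (relations inp)
      (\<Union>{connecting_path \<tau> (z s x \<tau>) (z s y \<tau>) |\<tau> x y. x \<noteq> y \<and> (x, \<tau>) \<in> set lb \<and> (y, \<tau>) \<in> set lb})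
      (path_column rel (f1_work row (rix s j)))"
    and len: "(\<And>s. s < m \<Longrightarrow> glen s \<le> k) \<Longrightarrow>
      length (path_column rel (f1_work row (rix s j))) \<le> length lb * length lb * k"
    by (rule path_column_labelled(1)[OF rel dist lb two W], assumption+)
      (rule path_column_labelled(2)[OF rel dist lb two W])
  have "{connecting_path \<tau> (z s x \<tau>) (z s y \<tau>) |\<tau> x y. x \<noteq> y \<and> (x, \<tau>) \<in> set lb \<and> (y, \<tau>) \<in> set lb} =
      (\<lambda>\<tau>. connecting_path \<tau> (z s j \<tau>) (z s (Suc j) \<tau>)) ` set (facets (inp ! s))"
  proof (intro subset_antisym subsetI)
    fix C assume "C \<in> {connecting_path \<tau> (z s x \<tau>) (z s y \<tau>) |\<tau> x y. x \<noteq> y \<and> (x, \<tau>) \<in> set lb \<and> (y, \<tau>) \<in> set lb}"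
    then obtain \<tau> x y where C: "C = connecting_path \<tau> (z s x \<tau>) (z s y \<tau>)" "x \<noteq> y"
      "(x, \<tau>) \<in> set lb" "(y, \<tau>) \<in> set lb" by blast
    then have "\<tau> \<in> set (facets (inp ! s))" "x = j \<and> y = Suc j \<or> x = Suc j \<and> y = j"
      by (auto simp: lb_def)
    then show "C \<in> (\<lambda>\<tau>. connecting_path \<tau> (z s j \<tau>) (z s (Suc j) \<tau>)) ` set (facets (inp ! s))"
      using C(1) connecting_path_commute by auto
  next
    fix C assume "C \<in> (\<lambda>\<tau>. connecting_path \<tau> (z s j \<tau>) (z s (Suc j) \<tau>)) ` set (facets (inp ! s))"
    then obtain \<tau> where "\<tau> \<in> set (facets (inp ! s))" "C = connecting_path \<tau> (z s j \<tau>) (z s (Suc j) \<tau>)"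
      by blast
    then have "C = connecting_path \<tau> (z s j \<tau>) (z s (Suc j) \<tau>) \<and> j \<noteq> Suc j \<and>
        (j, \<tau>) \<in> set lb \<and> (Suc j, \<tau>) \<in> set lb" by (simp add: lb_def)
    then show "C \<in> {connecting_path \<tau> (z s x \<tau>) (z s y \<tau>) |\<tau> x y. x \<noteq> y \<and> (x, \<tau>) \<in> set lb \<and> (y, \<tau>) \<in> set lb}"
      by blast
  qed
  then show "sparse_column (relations inp)
      (\<Union>\<tau>\<in>set (facets (inp ! s)). connecting_path \<tau> (z s j \<tau>) (z s (Suc j) \<tau>))
      (path_column rel (f1_work row (rix s j)))"
    using col by simp
  show "length (path_column rel (f1_work row (rix s j))) \<le> (2 * D) * (2 * D) * k"
    if "\<And>s. s < m \<Longrightarrow> glen s \<le> k"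
  proof -
    have "length lb \<le> 2 * D" using length_facets_le[OF s(1)] by (simp add: lb_def)
    then have bound: "length lb * length lb * k \<le> (2 * D) * (2 * D) * k" by (intro mult_le_mono order_refl)
    show ?thesis by (rule le_trans[OF len bound]) (rule that)
  qed
qed

text \<open>Here \<zeta> follows the choice twice, from the simplex to the facet \<open>x\<close>
  and from there to \<tau>. That a face carries at most two labels is now a geometric fact,
  \<open>codim2_face\<close>.\<close>

lemma h0_column:
  assumes z: "choice_of row z" and s: "s < m" "j < glen s"
    and rel: "\<And>s j. s < m \<Longrightarrow> j < rlen s \<Longrightarrow> rel (gix s j) = rix s j"
  shows "sparse_column (relations inp)
      (\<Union>{connecting_path \<tau> (z \<tau>1 (z s j \<tau>1) \<tau>) (z \<tau>2 (z s j \<tau>2) \<tau>) |\<tau> \<tau>1 \<tau>2.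
              \<tau>1 \<in> set (facets (inp ! s)) \<and> \<tau>2 \<in> set (facets (inp ! s)) \<and> \<tau>1 \<noteq> \<tau>2 \<and>
              \<tau> \<in> set (facets (inp ! \<tau>1)) \<inter> set (facets (inp ! \<tau>2))})
      (path_column rel (h0_work row (gix s j)))"
    and "(\<And>s. s < m \<Longrightarrow> glen s \<le> k) \<Longrightarrow> length (path_column rel (h0_work row (gix s j))) \<le> (D * D) * (D * D) * k"
proof -
  define lb where "lb = concat (map (\<lambda>x. map (Pair x) (facets (inp ! x))) (facets (inp ! s)))"
  define \<zeta> where "\<zeta> x \<tau> = z x (z s j x) \<tau>" for x \<tau>
  have set_lb: "(x, \<tau>) \<in> set lb \<longleftrightarrow> x \<in> set (facets (inp ! s)) \<and> \<tau> \<in> set (facets (inp ! x))" for x \<tau>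
    by (auto simp: lb_def)
  have x: "x < m" "z s j x < glen x" if "x \<in> set (facets (inp ! s))" for x
    using that s z facets_less[OF s(1)] by (auto simp: choice_of_def)
  have dist: "distinct lb"
    unfolding lb_def
    by (rule distinct_concat_map) (use distinct_facets s x in \<open>auto simp: distinct_map inj_on_def\<close>)
  have lb: "\<tau> < m \<and> \<zeta> x \<tau> < glen \<tau>" if "(x, \<tau>) \<in> set lb" for x \<tau>
    using that x[of x] z facets_less[of x \<tau>] by (auto simp: set_lb \<zeta>_def choice_of_def)
  have two: "x = y \<or> x = u \<or> y = u" if "{(x, \<tau>), (y, \<tau>), (u, \<tau>)} \<subseteq> set lb" for x y u \<tau>
    using that codim2_face[OF s(1), of x y u \<tau>] by (simp add: set_lb)
  have W: "h0_work row (gix s j) = map (\<lambda>(x, \<tau>). gix \<tau> (\<zeta> x \<tau>)) lb"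
  proof -
    have col: "f0_column row (gix x i) = map (\<lambda>\<tau>. gix \<tau> (z x i \<tau>)) (facets (inp ! x))"
      if "x < m" "i < glen x" for x i
      using that z by (simp only: choice_of_def)
    have "h0_work row (gix s j) = concat (map (\<lambda>x. f0_column row (gix x (z s j x))) (facets (inp ! s)))"
      unfolding h0_work_def col[OF s] by (simp add: comp_def)
    also have "\<dots> = concat (map (\<lambda>x. map (\<lambda>\<tau>. gix \<tau> (\<zeta> x \<tau>)) (facets (inp ! x))) (facets (inp ! s)))"
      unfolding \<zeta>_def using col x by (intro arg_cong[where f = concat] map_cong refl) simp
    also have "\<dots> = map (\<lambda>(x, \<tau>). gix \<tau> (\<zeta> x \<tau>)) lb" by (simp add: lb_def map_concat comp_def)
    finally show ?thesis .
  qed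
  have col: "sparse_column (relations inp)
      (\<Union>{connecting_path \<tau> (\<zeta> x \<tau>) (\<zeta> y \<tau>) |\<tau> x y. x \<noteq> y \<and> (x, \<tau>) \<in> set lb \<and> (y, \<tau>) \<in> set lb})
      (path_column rel (h0_work row (gix s j)))"
    and len: "(\<And>s. s < m \<Longrightarrow> glen s \<le> k) \<Longrightarrow>
      length (path_column rel (h0_work row (gix s j))) \<le> length lb * length lb * k"
    by (rule path_column_labelled(1)[OF rel dist lb two W], assumption+)
      (rule path_column_labelled(2)[OF rel dist lb two W])
  have iff: "x \<noteq> y \<and> (x, \<tau>) \<in> set lb \<and> (y, \<tau>) \<in> set lb \<longleftrightarrow>
      x \<in> set (facets (inp ! s)) \<and> y \<in> set (facets (inp ! s)) \<and> x \<noteq> y \<and>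
      \<tau> \<in> set (facets (inp ! x)) \<inter> set (facets (inp ! y))" for x y \<tau>
    unfolding set_lb by auto
  have "{connecting_path \<tau> (\<zeta> x \<tau>) (\<zeta> y \<tau>) |\<tau> x y. x \<noteq> y \<and> (x, \<tau>) \<in> set lb \<and> (y, \<tau>) \<in> set lb} =
      {connecting_path \<tau> (z \<tau>1 (z s j \<tau>1) \<tau>) (z \<tau>2 (z s j \<tau>2) \<tau>) |\<tau> \<tau>1 \<tau>2.
              \<tau>1 \<in> set (facets (inp ! s)) \<and> \<tau>2 \<in> set (facets (inp ! s)) \<and> \<tau>1 \<noteq> \<tau>2 \<and>
              \<tau> \<in> set (facets (inp ! \<tau>1)) \<inter> set (facets (inp ! \<tau>2))}"
    unfolding iff \<zeta>_def by (rule refl)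
  then show "sparse_column (relations inp)
      (\<Union>{connecting_path \<tau> (z \<tau>1 (z s j \<tau>1) \<tau>) (z \<tau>2 (z s j \<tau>2) \<tau>) |\<tau> \<tau>1 \<tau>2.
              \<tau>1 \<in> set (facets (inp ! s)) \<and> \<tau>2 \<in> set (facets (inp ! s)) \<and> \<tau>1 \<noteq> \<tau>2 \<and>
              \<tau> \<in> set (facets (inp ! \<tau>1)) \<inter> set (facets (inp ! \<tau>2))})
      (path_column rel (h0_work row (gix s j)))"
    using col by (simp only:)
  show "length (path_column rel (h0_work row (gix s j))) \<le> (D * D) * (D * D) * k"
    if "\<And>s. s < m \<Longrightarrow> glen s \<le> k"
  proof -
    have "length lb \<le> flen s * D"
      unfolding lb_def by (rule length_concat_le) (use length_facets_le x in auto)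
    also have "\<dots> \<le> D * D" using length_facets_le[OF s(1)] by simp
    finally have bound: "length lb * length lb * k \<le> (D * D) * (D * D) * k" by (intro mult_le_mono order_refl)
    show ?thesis by (rule le_trans[OF len bound]) (rule that)
  qed
qed

text \<open>The coefficient of \<open>columns_correct\<close> for
  \<open>B = D * D + 2 * D + 2\<close>. This value covers the work lists of \<open>f1\<close> and
  \<open>h0\<close>, of lengths at most \<open>2 * D\<close> and \<open>D * D\<close>, and the
  source columns, of lengths 2 and at most \<open>D\<close>.\<close>

abbreviation step3_cost :: nat where
  "step3_cost \<equiv> 60 * (D * D + 2 * D + 2) * (D * D + 2 * D + 2) + 80 * (D * D + 2 * D + 2) + 60"

lemma step3_correct:
  assumes st: "columns_ready st" "\<forall>g<nG. column_done st g" "rels_done nR st"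
    and f1: "\<And>r. f1c r = path_column (mem st RelOf) (f1_work (mem st F0Row) r)"
    and h0: "\<And>g. h0c g = path_column (mem st RelOf) (h0_work (mem st F0Row) g)"
  shows "wp step3 (\<lambda>st' t. env3 st st' \<and> read_matrix st' F1Ptr F1Row nR = map f1c [0..<nR] \<and>
    read_matrix st' H0Ptr H0Row nG = map h0c [0..<nG] \<and>
    t \<le> 20 * (offset (\<lambda>r. length (f1c r)) nR + offset (\<lambda>g. length (h0c g)) nG) +
      step3_cost * (nR + nG) + 40) st"
proof -
  let ?row = "mem st F0Row"
  have rels: "regs st numRel = nR" "regs st numGen = nG"
    using st by (simp_all add: rels_done_def columns_ready_def ready_regs)
  have p1: "mem st P1Ptr r = 2 * r" if "r \<le> nR" for r using st(3) that by (simp add: rels_done_def)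
  have p1row: "mem st P1Row (2 * r) = lower r" "mem st P1Row (Suc (2 * r)) = Suc (lower r)" if "r < nR" for r
    using st(3) that by (auto simp: rels_done_def)
  have f0p: "mem st F0Ptr g = f0off g" if "g \<le> nG" for g using st(1) that by (simp add: columns_ready_def)
  have f0_less: "w < nG" if "g < nG" "w \<in> set (f0_column ?row g)" for g w
    using f0_column_less st(2) that by blast
  have f0_len: "flen (own g) \<le> D" if "g < nG" for g using length_facets_le[OF own_less[OF that]] .
  have two: "[2 * r..<2 * Suc r] = [2 * r, Suc (2 * r)]" for r by (simp add: upt_rec)
  have first: "wp (ptr \<leftarrow> N 0;; F1Ptr\<langle>N 0\<rangle> \<Leftarrow> N 0;;
     FOR gen FROM N 0 TO V numRel DO (
       product_column P1Row (P1Ptr\<langle>V gen\<rangle>) (P1Ptr\<langle>V gen .+ N 1\<rangle>);;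
       connect_pairs F1Row;;
       F1Ptr\<langle>V gen .+ N 1\<rangle> \<Leftarrow> V ptr)) (\<lambda>st' t. env3 st st' \<and> read_matrix st' F1Ptr F1Row nR = map f1c [0..<nR] \<and>
    t \<le> 20 * offset (\<lambda>r. length (f1c r)) nR + step3_cost * nR + 20) st"
  proof (rule columns_correct[OF st(1), where W = "f1_work ?row"], goal_cases)
    case (8 r j)
    then show ?case using lower_less(1)[OF 8(1)] p1row[OF 8(1)] p1[of r] p1[of "Suc r"]
      by (cases "j = 2 * r") (auto simp: le_Suc_eq less_Suc_eq)
  next
    case (9 r)
    then have "[mem st P1Ptr r..<mem st P1Ptr (Suc r)] = [2 * r, Suc (2 * r)]"
      using p1[of r] p1[of "Suc r"] two[of r] by simp
    then show ?case using p1row[OF 9] by (simp add: f1_work_def)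
  next
    case (10 r w)
    then show ?case using lower_less(1)[OF 10(1)] f0_less[of "lower r" w] f0_less[of "Suc (lower r)" w]
      by (auto simp: f1_work_def)
  next
    case (11 r)
    then show ?case using lower_less(1)[OF 11(1)] f0_len[of "lower r"] f0_len[of "Suc (lower r)"]
      by (auto simp: f1_work_def)
  qed (use rels p1 f1 in \<open>auto simp: env3_def\<close>)
  have second: "wp (ptr \<leftarrow> N 0;; H0Ptr\<langle>N 0\<rangle> \<Leftarrow> N 0;;
     FOR gen FROM N 0 TO V numGen DO (
       product_column F0Row (F0Ptr\<langle>V gen\<rangle>) (F0Ptr\<langle>V gen .+ N 1\<rangle>);;
       connect_pairs H0Row;;
       H0Ptr\<langle>V gen .+ N 1\<rangle> \<Leftarrow> V ptr)) (\<lambda>st' t. env3 st st' \<and> read_matrix st' H0Ptr H0Row nG = map h0c [0..<nG] \<and>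
    t \<le> 20 * offset (\<lambda>g. length (h0c g)) nG + step3_cost * nG + 20) st1" if "env3 st st1" for st1
  proof (rule columns_correct[OF st(1), where W = "h0_work ?row"], goal_cases)
    case (7 g)
    then show ?case using f0p[of g] f0p[of "Suc g"] f0_len[of g] by auto
  next
    case (8 g j)
    then have "mem st F0Row j \<in> set (f0_column ?row g)"
      using f0p[of g] f0p[of "Suc g"] by (simp add: f0_column_def)
    then show ?case using f0_less 8(1) by blast
  next
    case (9 g)
    then show ?case using f0p[of g] f0p[of "Suc g"] by (simp add: h0_work_def f0_column_def comp_def)
  next
    case (10 g w)
    then show ?case using f0_less by (auto simp: h0_work_def)
  next
    case (11 g)
    have "length (h0_work ?row g) \<le> length (f0_column ?row g) * D"
      unfolding h0_work_def by (rule length_concat_le) (use f0_len f0_less 11 in auto)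
    also have "\<dots> \<le> D * D" using f0_len[OF 11] by simp
    finally show ?case by simp
  qed (use rels f0p h0 that in auto)
  have "wp ((ptr \<leftarrow> N 0;; F1Ptr\<langle>N 0\<rangle> \<Leftarrow> N 0;;
     FOR gen FROM N 0 TO V numRel DO (
       product_column P1Row (P1Ptr\<langle>V gen\<rangle>) (P1Ptr\<langle>V gen .+ N 1\<rangle>);;
       connect_pairs F1Row;;
       F1Ptr\<langle>V gen .+ N 1\<rangle> \<Leftarrow> V ptr));;
     (ptr \<leftarrow> N 0;; H0Ptr\<langle>N 0\<rangle> \<Leftarrow> N 0;;
     FOR gen FROM N 0 TO V numGen DO (
       product_column F0Row (F0Ptr\<langle>V gen\<rangle>) (F0Ptr\<langle>V gen .+ N 1\<rangle>);;
       connect_pairs H0Row;;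
       H0Ptr\<langle>V gen .+ N 1\<rangle> \<Leftarrow> V ptr)))
    (\<lambda>st' t. env3 st st' \<and> read_matrix st' F1Ptr F1Row nR = map f1c [0..<nR] \<and>
      read_matrix st' H0Ptr H0Row nG = map h0c [0..<nG] \<and>
      t \<le> 20 * (offset (\<lambda>r. length (f1c r)) nR + offset (\<lambda>g. length (h0c g)) nG) +
        step3_cost * (nR + nG) + 40) st"
  proof (rule wp_SeqI[OF first], goal_cases)
    case (1 st1 t1)
    then have "env3 st st1" by blast
    show ?case
    proof (rule wp_conseq[OF second[OF \<open>env3 st st1\<close>]], goal_cases)
      case (1 st2 t2)
      have "mem st2 F1Ptr = mem st1 F1Ptr" "mem st2 F1Row = mem st1 F1Row"
        by (rule frame_mem[OF 1(2)]; simp add: product_column_def connect_pairs_def)+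
      then have "read_matrix st2 F1Ptr F1Row nR = read_matrix st1 F1Ptr F1Row nR"
        by (simp add: read_matrix_def)
      then show ?case
        using 1(1) \<open>_ \<and> _ \<and> t1 \<le> _\<close> by (simp add: add_mult_distrib2)
    qed
  qed
  then show ?thesis by (simp only: step3_def wp_Seq add.assoc)
qed

end


section \<open>The complete algorithm\<close>

lemma map_pairs:
  assumes "\<And>s j. s < n \<Longrightarrow> j < l s \<Longrightarrow> g (offset l s + j) = f (s, j)"
  shows "map g [0..<offset l n] = map f (pairs l n)"
proof (rule nth_equalityI)
  fix i assume "i < length (map g [0..<offset l n])"
  then have "i < offset l n" by simp
  then obtain s j where "s < n" "j < l s" "i = offset l s + j" by (rule offset_cases)
  then show "map g [0..<offset l n] ! i = map f (pairs l n) ! i"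
    using assms offset_add_less[of s n j l] by (simp add: nth_pairs)
qed simp

lemma list_all2_pairs:
  assumes "\<And>s j. s < n \<Longrightarrow> j < l s \<Longrightarrow> P (s, j) (c (offset l s + j))"
  shows "list_all2 P (pairs l n) (map c [0..<offset l n])"
proof (rule list_all2_all_nthI)
  fix i assume "i < length (pairs l n)"
  then have "i < offset l n" by simp
  then obtain s j where "s < n" "j < l s" "i = offset l s + j" by (rule offset_cases)
  then show "P (pairs l n ! i) (map c [0..<offset l n] ! i)"
    using assms offset_add_less[of s n j l] by (simp add: nth_pairs)
qed simp

lemma nonzeros_map_upt: "nonzeros (map c [0..<n]) = offset (\<lambda>i. length (c i)) n"
  by (induction n) (simp_all add: nonzeros_def)

lemma offset_le: "(\<And>i. i < n \<Longrightarrow> l i \<le> b) \<Longrightarrow> offset l n \<le> n * b"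
  using sum_bounded_above[of "{..<n}" l b] by (simp add: offset_def)

context path_input
begin

text \<open>The output as a function of the stored rows and the relation numbering, so that its
  correctness and size can be discussed without machine states.\<close>

definition output_of :: "(nat \<Rightarrow> nat) \<Rightarrow> (nat \<Rightarrow> nat) \<Rightarrow> algorithm_output" where
  "output_of row rel =
    \<lparr>gens = map (\<lambda>(s, j). (sdim (inp ! s), grades (inp ! s) ! j)) (pairs glen m),
     rels = map (\<lambda>(s, j). (sdim (inp ! s), sup (grades (inp ! s) ! j) (grades (inp ! s) ! Suc j))) (pairs rlen m),
     p1 = map (\<lambda>r. [lower r, Suc (lower r)]) [0..<nR],
     f0 = map (f0_column row) [0..<nG],
     f1 = map (\<lambda>r. path_column rel (f1_work row r)) [0..<nR],
     h0 = map (\<lambda>g. path_column rel (h0_work row g)) [0..<nG]\<rparr>"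

text \<open>The numbers of entries of \<open>f1\<close> and \<open>h0\<close> stay in the time bound
  as they are. Replacing them by a worst case here would lose linearity in the output.\<close>

lemma path_algorithm_correct:
  "\<exists>row rel z q. choice_of row z \<and>
    (\<forall>s<m. \<forall>j<rlen s. rel (gix s j) = rix s j) \<and> path_algorithm_output inp = output_of row rel \<and> passes q \<and>
    path_algorithm_time inp \<le> 200 * (nG + 1) + 700 * (nG + 1) * (D + 1) * (q + 1) +
      (20 * (nonzeros (f1 (path_algorithm_output inp)) + nonzeros (h0 (path_algorithm_output inp))) + step3_cost * (nR + nG) + 40)"
proof -
  define post where "post st' t \<longleftrightarrow> (\<exists>row rel z q. choice_of row z \<and>
    (\<forall>s<m. \<forall>j<rlen s. rel (gix s j) = rix s j) \<and> read_output st' = output_of row rel \<and> passes q \<and>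
    t \<le> 200 * (nG + 1) + 700 * (nG + 1) * (D + 1) * (q + 1) +
      (20 * (nonzeros (f1 (read_output st')) + nonzeros (h0 (read_output st'))) + step3_cost * (nR + nG) + 40))" for st' t
  have "wp path_algorithm post (initial_state inp)"
    unfolding path_algorithm_def
  proof (rule wp_SeqI[OF step1_correct[OF input_state_initial]], goal_cases)
    case (1 st1 t1)
    have "input_state st1"
      by (rule input_state_frame[OF input_state_initial 1(2)]) (simp_all add: step1_def)
    then have "ready st1" using 1 by (simp add: ready_def)
    note step1 = 1
    show ?case
    proof (rule wp_SeqI[OF step2_correct[OF \<open>ready st1\<close>]], goal_cases)
      case (1 st2 t2)
      then have st2: "columns_ready st2" "\<forall>g<nG. column_done st2 g" by blast+
      obtain q where q: "passes q" "t2 \<le> 700 * (nG + 1) * (D + 1) * (q + 1)" using 1 by blast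
      have "regs st2 numRel = regs st1 numRel"
        by (rule frame_regs[OF 1(2)])
          (simp add: step2_def f0_columns_def find_by_sweep_def find_by_scan_def counting_sort_def)
      moreover have "mem st2 RelDeg = mem st1 RelDeg" "mem st2 RelX = mem st1 RelX" "mem st2 RelY = mem st1 RelY"
        "mem st2 P1Row = mem st1 P1Row" "mem st2 P1Ptr = mem st1 P1Ptr" "mem st2 RelOf = mem st1 RelOf"
        by (rule frame_mem[OF 1(2)],
            simp add: step2_def f0_columns_def find_by_sweep_def find_by_scan_def counting_sort_def)+
      ultimately have rels: "rels_done nR st2" using step1 by (simp add: rels_done_def)
      define row where "row = mem st2 F0Row"
      define rel where "rel = mem st2 RelOf"
      obtain z where z: "choice_of row z" using ex_choice_of[OF st2(2)] by (auto simp: row_def)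
      have rel: "rel (gix s j) = rix s j" if "s < m" "j < rlen s" for s j
        using rels rix_less[OF that] lower_rix[OF that] unfolding rels_done_def rel_def by metis
      show ?case
      proof (rule wp_conseq[OF step3_correct[OF st2 rels]], (rule refl)+, goal_cases)
        case (1 st3 t3)
        then have env: "env3 st2 st3" by blast
        have ready: "ready st2" using st2 by (simp add: columns_ready_def)
        have num: "regs st3 numGen = nG" "regs st3 numRel = nR"
          using env rels ready by (simp_all add: env3_def rels_done_def ready_regs)
        have mem: "mem st3 a = mem st2 a" if "a \<notin> {Work, F1Row, F1Ptr, H0Row, H0Ptr}" for a
          using env that by (simp add: env3_def)
        have gens: "map (\<lambda>i. (mem st3 GenDeg i, mem st3 GenX i, mem st3 GenY i)) [0..<nG] =
            map (\<lambda>(s, j). (sdim (inp ! s), grades (inp ! s) ! j)) (pairs glen m)"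
          by (rule map_pairs) (use ready gix_less in \<open>simp add: mem ready_gen\<close>)
        have rels': "map (\<lambda>i. (mem st3 RelDeg i, mem st3 RelX i, mem st3 RelY i)) [0..<nR] =
            map (\<lambda>(s, j). (sdim (inp ! s), sup (grades (inp ! s) ! j) (grades (inp ! s) ! Suc j))) (pairs rlen m)"
        proof (rule map_pairs)
          fix s j assume s: "s < m" "j < rlen s"
          have "Suc (gix s j) = gix s (Suc j)" by simp
          then have "grd (Suc (gix s j)) = grades (inp ! s) ! Suc j"
            using s grd_gix[of s "Suc j"] by simp
          then show "(mem st3 RelDeg (rix s j), mem st3 RelX (rix s j), mem st3 RelY (rix s j)) =
            (case (s, j) of (s, j) \<Rightarrow> (sdim (inp ! s), sup (grades (inp ! s) ! j) (grades (inp ! s) ! Suc j)))"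
            using rels rix_less[OF s] s by (simp add: mem rels_done_def)
        qed
        have p1: "read_matrix st3 P1Ptr P1Row nR = map (\<lambda>r. [lower r, Suc (lower r)]) [0..<nR]"
        proof -
          have "[2 * r..<2 * Suc r] = [2 * r, Suc (2 * r)]" for r by (simp add: upt_rec)
          then show ?thesis using rels by (auto simp: read_matrix_def mem rels_done_def)
        qed
        have f0: "read_matrix st3 F0Ptr F0Row nG = map (f0_column row) [0..<nG]"
          using st2(1) by (simp add: read_matrix_def mem columns_ready_def f0_column_def row_def)
        have out: "read_output st3 = output_of row rel"
          unfolding read_output_def output_of_def num gens rels' p1 f0 using 1(1) by (simp add: row_def rel_def)
        have "t3 \<le> 20 * (nonzeros (f1 (read_output st3)) + nonzeros (h0 (read_output st3))) +
            step3_cost * (nR + nG) + 40"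
          using 1(1) unfolding out by (simp add: output_of_def nonzeros_map_upt row_def rel_def)
        moreover have "t1 \<le> 200 * (nG + 1)" using step1(1) by blast
        ultimately have "t1 + (t2 + t3) \<le> 200 * (nG + 1) + (700 * (nG + 1) * (D + 1) * (q + 1) +
          (20 * (nonzeros (f1 (read_output st3)) + nonzeros (h0 (read_output st3))) +
           step3_cost * (nR + nG) + 40))"
          by (intro add_mono q(2))
        then have "t1 + (t2 + t3) \<le> 200 * (nG + 1) + 700 * (nG + 1) * (D + 1) * (q + 1) +
          (20 * (nonzeros (f1 (read_output st3)) + nonzeros (h0 (read_output st3))) +
           step3_cost * (nR + nG) + 40)"
          by (simp only: add.assoc)
        then show ?case unfolding post_def using z rel out q(1) by blast
      qed
    qed
  qed
  then have "post (fst (run path_algorithm (initial_state inp))) (snd (run path_algorithm (initial_state inp)))"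
    by (simp add: wp_def case_prod_beta)
  then show ?thesis
    unfolding post_def path_algorithm_output_def path_algorithm_time_def .
qed

lemma path_output_correct: "path_output inp (path_algorithm_output inp)"
proof -
  obtain row rel z where z: "choice_of row z"
    and rel: "\<And>s j. s < m \<Longrightarrow> j < rlen s \<Longrightarrow> rel (gix s j) = rix s j"
    and out: "path_algorithm_output inp = output_of row rel"
    using path_algorithm_correct by blast
  have p1: "sparse_column (pairs glen m) {(s, j), (s, Suc j)} [gix s j, Suc (gix s j)]"
    if "s < m" "j < rlen s" for s j
  proof -
    have "Suc j < glen s" "Suc (gix s j) = gix s (Suc j)" using that by auto
    then show ?thesis
      using that gix_less[of s "Suc j"] gix_less[of s j] nth_pairs[of s m "Suc j" glen] nth_pairs[of s m j glen]
      by (simp add: sparse_column_def)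
  qed
  show ?thesis
    unfolding path_output_def generators_eq relations_eq out output_of_def algorithm_output.simps
    apply (rule exI[of _ z])
    apply (intro conjI refl list_all2_pairs)
    subgoal using z by (auto simp: choice_of_def)
    subgoal using p1 by simp
    subgoal using sparse_column_f0[OF z] by (simp add: generators_eq)
    subgoal using f1_column(1)[OF z _ _ rel] by (simp add: relations_eq)
    subgoal using h0_column(1)[OF z _ _ rel] by (simp add: relations_eq)
    done
qed

text \<open>In the size bound, 4 stands for generators, relations and the two entries per column of
  \<open>p1\<close>, and \<open>D\<close> for the columns of \<open>f0\<close>. The other terms are
  the squared bounds on the work lists of \<open>f1\<close> and \<open>h0\<close>: at most that many
  pairs, each with a path of at most \<open>k\<close> entries.\<close>

lemma size_and_time:
  assumes k: "\<And>s. s < m \<Longrightarrow> glen s \<le> k" "1 \<le> k"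
  shows "nG \<le> output_size (path_algorithm_output inp)"
    and "output_size (path_algorithm_output inp) \<le> (4 + D + (2 * D) * (2 * D) + (D * D) * (D * D)) * (nG * k)"
    and "\<exists>q. passes q \<and> path_algorithm_time inp \<le>
      (940 + 2 * step3_cost + 700 * (D + 1)) * ((nG + 1) * (q + 1)) + 20 * output_size (path_algorithm_output inp)"
proof -
  let ?out = "path_algorithm_output inp"
  obtain row rel z q where z: "choice_of row z"
    and rel: "\<And>s j. s < m \<Longrightarrow> j < rlen s \<Longrightarrow> rel (gix s j) = rix s j"
    and out: "path_algorithm_output inp = output_of row rel"
    and q: "passes q"
    and time: "path_algorithm_time inp \<le> 200 * (nG + 1) + 700 * (nG + 1) * (D + 1) * (q + 1) +
      (20 * (nonzeros (f1 ?out) + nonzeros (h0 ?out)) + step3_cost * (nR + nG) + 40)"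
    using path_algorithm_correct by blast
  have size: "output_size ?out = nG + nR + nonzeros (p1 ?out) + nonzeros (f0 ?out) + nonzeros (f1 ?out) + nonzeros (h0 ?out)"
    by (simp add: output_size_def out output_of_def)
  then show "nG \<le> output_size ?out" by simp
  have "nonzeros (p1 ?out) = 2 * nR"
    unfolding out by (simp add: output_of_def nonzeros_map_upt offset_def)
  moreover have "nonzeros (f0 ?out) \<le> nG * D"
    unfolding out using length_facets_le own_less by (auto simp: output_of_def nonzeros_map_upt intro!: offset_le)
  moreover have "nonzeros (f1 ?out) \<le> nR * ((2 * D) * (2 * D) * k)"
    unfolding out output_of_def algorithm_output.simps nonzeros_map_upt
    by (rule offset_le) (metis rel_cases f1_column(2)[OF z _ _ rel] k(1))
  moreover have "nonzeros (h0 ?out) \<le> nG * ((D * D) * (D * D) * k)"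
    unfolding out output_of_def algorithm_output.simps nonzeros_map_upt
    by (rule offset_le) (metis gen_cases h0_column(2)[OF z _ _ rel] k(1))
  moreover have "nR * ((2 * D) * (2 * D) * k) \<le> nG * ((2 * D) * (2 * D) * k)"
    using nR_le_nG by (rule mult_le_mono1)
  moreover have nGk: "nG \<le> nG * k" using k(2) by simp
  moreover have "nG * D \<le> nG * k * D" using nGk by (rule mult_le_mono1)
  ultimately have "output_size ?out \<le> 4 * (nG * k) + nG * k * D + nG * ((2 * D) * (2 * D) * k) + nG * ((D * D) * (D * D) * k)"
    using size nR_le_nG by linarith
  also have "\<dots> = (4 + D + (2 * D) * (2 * D) + (D * D) * (D * D)) * (nG * k)"
    by (simp add: algebra_simps)
  finally show "output_size ?out \<le> (4 + D + (2 * D) * (2 * D) + (D * D) * (D * D)) * (nG * k)" .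
  define Z where "Z = (nG + 1) * (q + 1)"
  have Z: "nG + 1 \<le> Z" "1 \<le> Z" by (simp_all add: Z_def)
  have "path_algorithm_time inp \<le> (940 + 2 * step3_cost + 700 * (D + 1)) * Z + 20 * output_size ?out"
  proof -
    have "step3_cost * (nR + nG) \<le> step3_cost * (2 * Z)"
      by (rule mult_le_mono2) (use Z nR_le_nG in linarith)
    moreover have "700 * (nG + 1) * (D + 1) * (q + 1) = 700 * (D + 1) * Z" by (simp only: Z_def mult_ac)
    \<comment> \<open>The overhead of Step 1 and the additive constant of Step 3 are absorbed into
      multiples of \<open>Z\<close>, which is at least 1; the factor 940 is generous.\<close>
    moreover have "200 * n + 40 \<le> 940 * Z" if "n \<le> Z" for n using that Z(2) by simp
    note this[OF Z(1)]
    moreover have "20 * (nonzeros (f1 ?out) + nonzeros (h0 ?out)) \<le> 20 * output_size ?out"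
      using size by simp
    moreover have "(a + 2 * b + c) * Z = a * Z + b * (2 * Z) + c * Z" for a b c
      by (simp add: algebra_simps)
    note this[of 940 step3_cost "700 * (D + 1)"]
    ultimately show ?thesis using time by linarith
  qed
  then show "\<exists>q. passes q \<and> path_algorithm_time inp \<le>
      (940 + 2 * step3_cost + 700 * (D + 1)) * ((nG + 1) * (q + 1)) + 20 * output_size ?out"
    using q unfolding Z_def by blast
qed

end


section \<open>Inputs that encode a bifiltration\<close>

text \<open>Descending strictly in the product order lowers the sum of the coordinates, so a minimal
  grade is reached.\<close>

lemma min_grade_below:
  assumes "\<sigma> \<in> F t"
  shows "\<exists>s\<in>min_grades F \<sigma>. s \<le> (t :: grade)"
  using assms
proof (induction "fst t + snd t" arbitrary: t rule: less_induct)
  case less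
  show ?case
  proof (cases "t \<in> min_grades F \<sigma>")
    case False
    then obtain u where u: "\<sigma> \<in> F u" "u \<le> t" "u \<noteq> t" using less.prems by (auto simp: min_grades_def)
    then have "fst u + snd u < fst t + snd t"
      by (auto simp: less_eq_prod_def prod_eq_iff)
    then obtain s where "s \<in> min_grades F \<sigma>" "s \<le> u" using less.hyps u(1) by blast
    then show ?thesis using u(2) by (meson order_trans)
  qed blast
qed

lemma min_grades_antichain:
  "x \<in> min_grades F \<sigma> \<Longrightarrow> y \<in> min_grades F \<sigma> \<Longrightarrow> x \<le> y \<Longrightarrow> x = y"
  unfolding min_grades_def by blast

lemma facet_of_iff_Diff:
  assumes "finite \<sigma>"
  shows "facet_of \<tau> \<sigma> \<longleftrightarrow> \<tau> \<noteq> {} \<and> (\<exists>v\<in>\<sigma>. \<tau> = \<sigma> - {v})"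
proof
  assume "facet_of \<tau> \<sigma>"
  then have \<tau>: "\<tau> \<noteq> {}" "\<tau> \<subseteq> \<sigma>" "card \<sigma> = Suc (card \<tau>)" by (auto simp: facet_of_def)
  then have "card (\<sigma> - \<tau>) = 1"
    using assms by (subst card_Diff_subset) (auto intro: finite_subset)
  then obtain v where "\<sigma> - \<tau> = {v}" by (auto simp: card_1_singleton_iff)
  then show "\<tau> \<noteq> {} \<and> (\<exists>v\<in>\<sigma>. \<tau> = \<sigma> - {v})" using \<tau> by blast
next
  assume "\<tau> \<noteq> {} \<and> (\<exists>v\<in>\<sigma>. \<tau> = \<sigma> - {v})"
  then obtain v where "\<tau> \<noteq> {}" "v \<in> \<sigma>" "\<tau> = \<sigma> - {v}" by blast
  moreover have "Suc (card (\<sigma> - {v})) = card \<sigma>"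
    using assms \<open>v \<in> \<sigma>\<close> by (rule card_Suc_Diff1)
  ultimately show "facet_of \<tau> \<sigma>" unfolding facet_of_def by (metis Diff_subset)
qed

text \<open>A facet omits one vertex, and \<tau> arises from \<tau>1 by omitting one more. The three
  vertices omitted by the facets are all missing from \<tau>, which lacks only two vertices of
  \<sigma>; so two of them coincide.\<close>

lemma codim2_facets:
  assumes "finite \<sigma>" "facet_of \<tau>1 \<sigma>" "facet_of \<tau>2 \<sigma>" "facet_of \<tau>3 \<sigma>"
    and "facet_of \<tau> \<tau>1" "facet_of \<tau> \<tau>2" "facet_of \<tau> \<tau>3"
  shows "\<tau>1 = \<tau>2 \<or> \<tau>1 = \<tau>3 \<or> \<tau>2 = \<tau>3"
proof -
  obtain a b c where abc: "\<tau>1 = \<sigma> - {a}" "\<tau>2 = \<sigma> - {b}" "\<tau>3 = \<sigma> - {c}" "a \<in> \<sigma>" "b \<in> \<sigma>" "c \<in> \<sigma>"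
    using assms(1-4) by (auto simp: facet_of_iff_Diff)
  then obtain v where v: "v \<in> \<tau>1" "\<tau> = \<tau>1 - {v}"
    using assms(1,5) facet_of_iff_Diff[of \<tau>1 \<tau>] by auto
  have "\<tau> \<subseteq> \<tau>2" "\<tau> \<subseteq> \<tau>3" using assms by (auto simp: facet_of_def)
  then show ?thesis using abc v by blast
qed

text \<open>\<open>Suc d\<close> bounds the number of facets, since each facet omits one of at most
  d + 1 vertices. The other claims identify the number of generators with the description size and
  the list lengths with the numbers bounded by criticality.\<close>

lemma encodes_path_input:
  fixes K :: "'v set set"
  assumes K: "bifiltration K F" "has_dimension K d" and enc: "encodes K F inp"
  shows "path_input inp (Suc d)"
    and "(\<Sum>i<length inp. length (grades (inp ! i))) = description_size K F"
    and "s < length inp \<Longrightarrow> \<exists>\<sigma>\<in>K. set (grades (inp ! s)) = min_grades F \<sigma> \<and>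
      length (grades (inp ! s)) = card (min_grades F \<sigma>)"
proof -
  obtain \<sigma>s where dist: "distinct \<sigma>s" and set_\<sigma>s: "set \<sigma>s = K"
    and all2: "list_all2 (\<lambda>\<sigma> e. sdim e = dim_simplex \<sigma> \<and>
       set (grades e) = min_grades F \<sigma> \<and>
       sorted_wrt (\<lambda>x y. (x, y) \<in> less_than <*lex*> less_than) (grades e) \<and>
       distinct (facets e) \<and>
       set (facets e) = {i. i < length \<sigma>s \<and> facet_of (\<sigma>s ! i) \<sigma>}) \<sigma>s inp"
    using enc unfolding encodes_def by blast
  have len: "length \<sigma>s = length inp" using all2 by (rule list_all2_lengthD)
  have ent: "sdim (inp ! s) = dim_simplex (\<sigma>s ! s) \<and>
       set (grades (inp ! s)) = min_grades F (\<sigma>s ! s) \<and>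
       sorted_wrt (\<lambda>x y. (x, y) \<in> less_than <*lex*> less_than) (grades (inp ! s)) \<and>
       distinct (facets (inp ! s)) \<and>
       set (facets (inp ! s)) = {i. i < length \<sigma>s \<and> facet_of (\<sigma>s ! i) (\<sigma>s ! s)}"
    if "s < length inp" for s
    using list_all2_nthD2[OF all2 that] .
  have in_K: "\<sigma>s ! s \<in> K" if "s < length inp" for s using that len set_\<sigma>s nth_mem by metis
  have fin: "finite \<sigma>" "\<sigma> \<noteq> {}" if "\<sigma> \<in> K" for \<sigma>
    using K(1) that by (auto simp: bifiltration_def simplicial_complex_def)
  have card_le: "card \<sigma> \<le> Suc d" if "\<sigma> \<in> K" for \<sigma>
    using K(2) that by (force simp: has_dimension_def dim_simplex_def)
  have distinct_grades: "distinct (grades (inp ! s))" if "s < length inp" for s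
  proof -
    have "grades (inp ! s) ! i \<noteq> grades (inp ! s) ! j" if "i < j" "j < length (grades (inp ! s))" for i j
    proof -
      have "(grades (inp ! s) ! i, grades (inp ! s) ! j) \<in> less_than <*lex*> less_than"
        using ent[OF \<open>s < length inp\<close>] that by (meson sorted_wrt_nth_less)
      then show ?thesis by (cases "grades (inp ! s) ! j") auto
    qed
    then show ?thesis unfolding distinct_conv_nth by (metis linorder_neqE_nat)
  qed
  have glen: "length (grades (inp ! s)) = card (min_grades F (\<sigma>s ! s))" if "s < length inp" for s
    using distinct_card[OF distinct_grades[OF that]] ent[OF that] by simp
  show "\<exists>\<sigma>\<in>K. set (grades (inp ! s)) = min_grades F \<sigma> \<and>
      length (grades (inp ! s)) = card (min_grades F \<sigma>)" if "s < length inp"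
    using in_K[OF that] ent[OF that] glen[OF that] by blast
  have "(\<Sum>i<length inp. length (grades (inp ! i))) = (\<Sum>i<length \<sigma>s. card (min_grades F (\<sigma>s ! i)))"
    using glen len by simp
  also have "\<dots> = description_size K F"
    unfolding description_size_def set_\<sigma>s[symmetric]
    using sum.reindex_bij_betw[OF bij_betw_nth[OF dist refl refl], of "\<lambda>\<sigma>. card (min_grades F \<sigma>)"] by simp
  finally show size: "(\<Sum>i<length inp. length (grades (inp ! i))) = description_size K F" .
  show "path_input inp (Suc d)"
  proof
    fix s assume s: "s < length inp"
    let ?\<sigma> = "\<sigma>s ! s"
    obtain t where "?\<sigma> \<in> F t" using K(1) in_K[OF s] by (auto simp: bifiltration_def)
    from min_grade_below[of _ F, OF this] show ne: "grades (inp ! s) \<noteq> []" using ent[OF s] by auto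
    show "distinct (facets (inp ! s))" using ent[OF s] by blast
    show "fst (grades (inp ! s) ! i) < fst (grades (inp ! s) ! j) \<and>
        snd (grades (inp ! s) ! j) < snd (grades (inp ! s) ! i)"
      if "i < j" "j < length (grades (inp ! s))" for i j
    proof -
      let ?x = "grades (inp ! s) ! i" and ?y = "grades (inp ! s) ! j"
      have lex: "(?x, ?y) \<in> less_than <*lex*> less_than"
        using ent[OF s] that by (meson sorted_wrt_nth_less)
      have "?x \<in> min_grades F ?\<sigma>" "?y \<in> min_grades F ?\<sigma>" using ent[OF s] that nth_mem[of _ "grades (inp ! s)"] by auto
      moreover have "?x \<noteq> ?y" using lex by (cases ?y) auto
      \<comment> \<open>Lexicographic order together with incomparability leaves only a staircase:
        the first coordinate rises strictly and the second falls strictly.\<close>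
      ultimately have "\<not> ?x \<le> ?y" using min_grades_antichain by blast
      then show ?thesis using lex by (cases ?x; cases ?y) auto
    qed
    show "sdim (inp ! s) \<le> (\<Sum>i<length inp. length (grades (inp ! i)))"
    proof -
      have "length inp \<le> (\<Sum>i<length inp. length (grades (inp ! i)))"
      proof -
        have "1 \<le> length (grades (inp ! i))" if i: "i < length inp" for i
        proof -
          obtain t where "\<sigma>s ! i \<in> F t" using K(1) in_K[OF i] by (auto simp: bifiltration_def)
          from min_grade_below[of _ F, OF this] have "grades (inp ! i) \<noteq> []" using ent[OF i] by auto
          then show ?thesis by (simp add: Suc_leI)
        qed
        then have "(\<Sum>i<length inp. 1) \<le> (\<Sum>i<length inp. length (grades (inp ! i)))"
          by (intro sum_mono) auto
        then show ?thesis by simp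
      qed
      \<comment> \<open>The vertices of a simplex are themselves simplices of the complex, and every
        simplex contributes at least one grade. This bounds the dimension by the description
        size.\<close>
      moreover have "card ?\<sigma> \<le> length inp"
      proof -
        have "(\<lambda>v. {v}) ` ?\<sigma> \<subseteq> K"
          using K(1) in_K[OF s] by (auto simp: bifiltration_def simplicial_complex_def)
        then have "card ((\<lambda>v. {v}) ` ?\<sigma>) \<le> card K"
          using K(1) by (intro card_mono) (auto simp: bifiltration_def simplicial_complex_def)
        then show ?thesis using distinct_card[OF dist] set_\<sigma>s len by (simp add: card_image)
      qed
      ultimately show ?thesis using ent[OF s] by (simp add: dim_simplex_def)
    qed
    have \<tau>: "\<tau> < length inp \<and> facet_of (\<sigma>s ! \<tau>) ?\<sigma>" if "\<tau> \<in> set (facets (inp ! s))" for \<tau>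
      using that ent[OF s] len by auto
    show "\<tau> < length inp" if "\<tau> \<in> set (facets (inp ! s))" for \<tau> using \<tau>[OF that] by blast
    show "sdim (inp ! \<tau>) < sdim (inp ! s)" if "\<tau> \<in> set (facets (inp ! s))" for \<tau>
      using \<tau>[OF that] ent[OF s] ent[of \<tau>] fin[OF in_K[of \<tau>]]
      by (auto simp: dim_simplex_def facet_of_def card_gt_0_iff intro!: diff_less_mono)
    show "\<exists>i<length (grades (inp ! \<tau>)). grades (inp ! \<tau>) ! i \<le> grades (inp ! s) ! j"
      if "\<tau> \<in> set (facets (inp ! s))" "j < length (grades (inp ! s))" for \<tau> j
    proof -
      note \<tau>' = \<tau>[OF that(1)]
      let ?x = "grades (inp ! s) ! j"
      have "?\<sigma> \<in> F ?x" using ent[OF s] nth_mem[OF that(2)] by (auto simp: min_grades_def)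
      moreover have "simplicial_complex (F ?x)" using K(1) unfolding bifiltration_def by blast
      moreover have "\<sigma>s ! \<tau> \<noteq> {}" "\<sigma>s ! \<tau> \<subseteq> ?\<sigma>" using \<tau>' by (simp_all add: facet_of_def)
      \<comment> \<open>Each stage of the filtration is a complex, so a facet is present wherever
        its coface is; \<open>min_grade_below\<close> then yields a minimal grade of the facet below
        \<open>?x\<close>.\<close>
      ultimately have "\<sigma>s ! \<tau> \<in> F ?x" unfolding simplicial_complex_def by blast
      from min_grade_below[of _ F, OF this] obtain y where "y \<in> set (grades (inp ! \<tau>))" "y \<le> ?x"
        using ent[of \<tau>] \<tau>' by blast
      then show ?thesis by (metis in_set_conv_nth)
    qed
    show "length (facets (inp ! s)) \<le> Suc d"
    proof -
      have "inj_on ((!) \<sigma>s) (set (facets (inp ! s)))"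
        using \<tau> len by (intro inj_on_nth[OF dist]) simp
      moreover have "distinct (facets (inp ! s))" using ent[OF s] by blast
      ultimately have "length (facets (inp ! s)) = card ((!) \<sigma>s ` set (facets (inp ! s)))"
        by (simp add: card_image distinct_card)
      also have "\<dots> \<le> card ((\<lambda>v. ?\<sigma> - {v}) ` ?\<sigma>)"
      proof (rule card_mono)
        show "finite ((\<lambda>v. ?\<sigma> - {v}) ` ?\<sigma>)" using fin[OF in_K[OF s]] by simp
        show "(!) \<sigma>s ` set (facets (inp ! s)) \<subseteq> (\<lambda>v. ?\<sigma> - {v}) ` ?\<sigma>"
          using \<tau> facet_of_iff_Diff[OF fin(1)[OF in_K[OF s]]] by blast
      qed
      also have "\<dots> \<le> card ?\<sigma>" using fin[OF in_K[OF s]] by (intro card_image_le)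
      finally show ?thesis using card_le[OF in_K[OF s]] by simp
    qed
    show "\<tau>1 = \<tau>2 \<or> \<tau>1 = \<tau>3 \<or> \<tau>2 = \<tau>3"
      if "{\<tau>1, \<tau>2, \<tau>3} \<subseteq> set (facets (inp ! s))"
        "\<tau> \<in> set (facets (inp ! \<tau>1)) \<inter> set (facets (inp ! \<tau>2)) \<inter> set (facets (inp ! \<tau>3))" for \<tau>1 \<tau>2 \<tau>3 \<tau>
    proof -
      have less: "\<tau>1 < length inp" "\<tau>2 < length inp" "\<tau>3 < length inp" using that \<tau> by auto
      have "\<sigma>s ! \<tau>1 = \<sigma>s ! \<tau>2 \<or> \<sigma>s ! \<tau>1 = \<sigma>s ! \<tau>3 \<or> \<sigma>s ! \<tau>2 = \<sigma>s ! \<tau>3"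
        by (rule codim2_facets[of ?\<sigma> _ _ _ "\<sigma>s ! \<tau>"])
          (use that \<tau> ent less fin[OF in_K[OF s]] in auto)
      then show ?thesis using less dist len by (simp add: nth_eq_iff_index_eq)
    qed
  qed
qed

text \<open>Both time bounds follow from the same estimate in terms of \<open>q\<close>. With
  \<open>q\<close> \<le> \<open>e\<close> the term n e is paid by the output, which lists all n
  generators; with \<open>q\<close> \<le> \<open>k\<close> the output itself is replaced by its
  worst case.\<close>

theorem proposition10:
  fixes d :: nat
  shows "\<exists>c. \<forall>(K :: 'v set set) F k inp.
    bifiltration K F \<and> has_dimension K d \<and> critical k K F \<and> encodes K F inp \<longrightarrow>
      path_output inp (path_algorithm_output inp) \<and>
      (\<forall>e>0. grades_fit_words e K F \<longrightarrow>
         path_algorithm_time inp \<le> c * e * output_size (path_algorithm_output inp)) \<and>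
      output_size (path_algorithm_output inp) \<le> c * (description_size K F * k) \<and>
      path_algorithm_time inp \<le> c * (description_size K F * k)"
proof -
  define D where "D = Suc d"
  define A where "A = 4 + D + (2 * D) * (2 * D) + (D * D) * (D * D)"
  define C where "C = 940 + 2 * (60 * (D * D + 2 * D + 2) * (D * D + 2 * D + 2) + 80 * (D * D + 2 * D + 2) + 60) +
    700 * (D + 1)"
  \<comment> \<open>In the constant, \<open>4 * C\<close> pays for terms proportional to n times the
    number of passes, 20 for writing \<open>f1\<close> and \<open>h0\<close> measured by the output,
    and \<open>20 * A\<close> for the same writing measured by n k.\<close>
  have "path_output inp (path_algorithm_output inp) \<and>
      (\<forall>e>0. grades_fit_words e K F \<longrightarrow>
         path_algorithm_time inp \<le> (4 * C + 20 * A + 20) * e * output_size (path_algorithm_output inp)) \<and>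
      output_size (path_algorithm_output inp) \<le> (4 * C + 20 * A + 20) * (description_size K F * k) \<and>
      path_algorithm_time inp \<le> (4 * C + 20 * A + 20) * (description_size K F * k)"
    if K: "bifiltration K F" "has_dimension K d" and k: "critical k K F" and enc: "encodes K F inp"
    for K :: "'v set set" and F k inp
  proof -
    interpret path_input inp D unfolding D_def using encodes_path_input(1)[OF K enc] .
    define n where "n = description_size K F"
    define S where "S = output_size (path_algorithm_output inp)"
    define T where "T = path_algorithm_time inp"
    have nG: "nG = n" using encodes_path_input(2)[OF K enc] by (simp add: offset_def n_def)
    have glen: "glen s \<le> k" if "s < m" for s
      using encodes_path_input(3)[OF K enc that] k by (auto simp: critical_def)
    \<comment> \<open>A complex of dimension \<open>d\<close> contains a simplex, so n and
      \<open>k\<close> are positive. This is what allows additive constants to be absorbed.\<close>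
    have "K \<noteq> {}" using K(2) by (auto simp: has_dimension_def)
    then have "inp \<noteq> []" using enc by (auto simp: encodes_def)
    then have m: "0 < m" by simp
    have k1: "1 \<le> k" using glen[OF m] glen_pos[OF m] by linarith
    have n1: "1 \<le> n" using m m_le_nG nG by linarith
    obtain q where q: "passes q" and time: "T \<le> C * ((n + 1) * (q + 1)) + 20 * S"
      using size_and_time(3)[OF glen k1] unfolding nG C_def T_def S_def by blast
    have size: "n \<le> S" "S \<le> A * (n * k)"
      using size_and_time(1,2)[OF glen k1] unfolding nG A_def S_def by blast+
    have time': "T \<le> 4 * C * (n * r) + 20 * S" if "q \<le> r" "1 \<le> r" for r
    proof -
      \<comment> \<open>Positivity gives n + 1 \<le> 2 n and q + 1 \<le> 2 r, the origin of the
        factor 4.\<close>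
      have "(n + 1) * (q + 1) \<le> (2 * n) * (2 * r)" using n1 that by (intro mult_le_mono) auto
      then have "C * ((n + 1) * (q + 1)) \<le> C * ((2 * n) * (2 * r))" by (rule mult_le_mono2)
      then show ?thesis using time by (simp add: mult_ac)
    qed
    have "T \<le> (4 * C + 20 * A + 20) * e * S" if e: "0 < e" "grades_fit_words e K F" for e
    proof -
      have "fst (grd g) < (nG + 1) ^ e" if less: "g < nG" for g
      proof -
        obtain s j where g: "s < m" "j < glen s" "g = gix s j" using gen_cases[OF less] .
        then have "grd g \<in> set (grades (inp ! s))" by simp
        then show ?thesis
          using encodes_path_input(3)[OF K enc g(1)] e(2) unfolding grades_fit_words_def nG n_def by blast
      qed
      then have "q \<le> e" using q by (simp add: passes_def)
      then have "T \<le> 4 * C * (n * e) + 20 * S" using time' e(1) by simp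
      also have "4 * C * (n * e) \<le> 4 * C * (S * e)" using size(1) by (intro mult_le_mono) auto
      also have "20 * S \<le> 20 * (S * e)" using e(1) by simp
      also have "4 * C * (S * e) + 20 * (S * e) \<le> (4 * C + 20 * A + 20) * (S * e)"
        by (simp add: distrib_right)
      finally show ?thesis by (simp add: mult_ac)
    qed
    moreover have "A * (n * k) \<le> (4 * C + 20 * A + 20) * (n * k)" by (intro mult_le_mono1) simp
    then have "S \<le> (4 * C + 20 * A + 20) * (n * k)" using size(2) by linarith
    moreover have "T \<le> (4 * C + 20 * A + 20) * (n * k)"
    proof -
      have "q \<le> k" using q glen by (simp add: passes_def)
      then have "T \<le> 4 * C * (n * k) + 20 * S" using time' k1 by simp
      also have "20 * S \<le> 20 * A * (n * k)" using size(2) by simp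
      finally show ?thesis by (simp add: distrib_right)
    qed
    ultimately show ?thesis using path_output_correct unfolding S_def T_def n_def by blast
  qed
  then show ?thesis by blast
qed

end
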